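(* There is a randomized $\mathcal{O}(\sqrt{n})$-approximation algorithm for 1-DNR with uniform resistances (that is, $r \equiv 1$), where $n=|V|$ is the number of vertices of the input graph. That is, there is a randomized polynomial-time algorithm and a constant $C$ such that on every instance $\mathcal{I}$ of 1-DNR with uniform resistances the algorithm outputs a solution $T$ with $\mathbb{E}[L(T)] \le C\sqrt{n}\cdot \mathrm{OPT}(\mathcal{I})$.
   Context: Distribution Network Reconfiguration (DNR): The input is a connected undirected graph $G=(V,E)$, a demand function $d\colon V\to\mathbb{R}$ with $\sum_{x\in V} d(x)=0$, and a resistance function $r\colon E\to\mathbb{R}_{\ge 0}$. A solution is a spanning tree $T$ of $G$. The objective is to minimize $$L(T) = \sum_{\{x,y\}\in E(T)} r(\{x,y\})\Big(\sum_{v\in V(T_{x\setminus y})} d(v)\Big)^2,$$ where $T_{x\setminus y}$ is the component containing $x$ of the forest obtained by removing the edge $\{x,y\}$ from $T$. (Since the demands sum to $0$, choosing the component containing $y$ gives the same value.) $\mathrm{OPT}(\mathcal{I})$ denotes the minimum of $L(T)$ over all spanning trees $T$ of instance $\mathcal{I}$. A source is a vertex with negative demand. 1-DNR is DNR restricted to instances with a single source. *)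

theory Defs
  imports "HOL-Probability.Probability" "HOL-Computational_Algebra.Polynomial"
begin

section \<open>Distribution Network Reconfiguration\<close>

text \<open>Simple undirected graphs are given by a vertex set and a set of two-element edges;
  a spanning subgraph is given by its edge set alone.\<close>

definition simple_graph :: "'a set \<Rightarrow> 'a set set \<Rightarrow> bool" where
  "simple_graph V E \<longleftrightarrow>
     finite V \<and> (\<forall>e\<in>E. \<exists>x y. x \<in> V \<and> y \<in> V \<and> x \<noteq> y \<and> e = {x, y})"

definition component :: "'a set set \<Rightarrow> 'a \<Rightarrow> 'a set" where
  "component F x = {v. (x, v) \<in> {(a, b). {a, b} \<in> F}\<^sup>*}"

definition connected_graph :: "'a set \<Rightarrow> 'a set set \<Rightarrow> bool" where
  "connected_graph V F \<longleftrightarrow> V \<noteq> {} \<and> (\<forall>x\<in>V. \<forall>y\<in>V. y \<in> component F x)"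

definition is_cycle :: "'a set set \<Rightarrow> 'a list \<Rightarrow> bool" where
  "is_cycle F p \<longleftrightarrow>
     length p \<ge> 3 \<and> distinct p \<and> (\<forall>i. Suc i < length p \<longrightarrow> {p ! i, p ! Suc i} \<in> F)
     \<and> {last p, hd p} \<in> F"

definition spanning_tree :: "'a set \<Rightarrow> 'a set set \<Rightarrow> 'a set set \<Rightarrow> bool" where
  "spanning_tree V E T \<longleftrightarrow> T \<subseteq> E \<and> connected_graph V T \<and> (\<nexists>p. is_cycle T p)"

definition dnr_instance ::
    "'a set \<Rightarrow> 'a set set \<Rightarrow> ('a \<Rightarrow> real) \<Rightarrow> ('a set \<Rightarrow> real) \<Rightarrow> bool" where
  "dnr_instance V E d r \<longleftrightarrow>
     simple_graph V E \<and> connected_graph V E \<and> (\<Sum>x\<in>V. d x) = 0 \<and> (\<forall>e\<in>E. r e \<ge> 0)"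

definition sources :: "'a set \<Rightarrow> ('a \<Rightarrow> real) \<Rightarrow> 'a set" where
  "sources V d = {v \<in> V. d v < 0}"

text \<open>The endpoint of \<open>e\<close> is chosen arbitrarily: the demands sum to zero, so for a spanning tree
  the other endpoint gives the opposite value, which has the same square.\<close>

definition edge_load :: "('a \<Rightarrow> real) \<Rightarrow> 'a set set \<Rightarrow> 'a set \<Rightarrow> real" where
  "edge_load d T e = (\<Sum>v\<in>component (T - {e}) (SOME x. x \<in> e). d v)"

definition loss :: "('a \<Rightarrow> real) \<Rightarrow> ('a set \<Rightarrow> real) \<Rightarrow> 'a set set \<Rightarrow> real" where
  "loss d r T = (\<Sum>e\<in>T. r e * (edge_load d T e)\<^sup>2)"

definition OPT ::
    "'a set \<Rightarrow> 'a set set \<Rightarrow> ('a \<Rightarrow> real) \<Rightarrow> ('a set \<Rightarrow> real) \<Rightarrow> real" where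
  "OPT V E d r = Min (loss d r ` {T. spanning_tree V E T})"


section \<open>Randomized algorithms\<close>

text \<open>The model of computation is a structured random access machine with fair coin flips.
  Since demands are real numbers, there are arrays of reals besides arrays of natural numbers; a
  scalar variable is an array used only at index 0.

  As for the RAM of Cook and Reckhow, the operations are addition, subtraction and comparison.
  Without a unit-cost multiplication, the natural numbers occurring in a computation of length
  \<open>t\<close> on \<open>n\<close> vertices have \<open>O(t + log n)\<close> bits, and the reals are combinations of the demands
  and of 1 with integer coefficients of that size. Polynomially many
  steps hence mean polynomial time both for exact real arithmetic and, if the demands are
  rationals in binary, for Turing machines. Program constants are natural numbers, so that no
  information can be hidden in a real constant.\<close>

type_synonym vname = string

type_synonym state = "(vname \<Rightarrow> nat \<Rightarrow> nat) \<times> (vname \<Rightarrow> nat \<Rightarrow> real)"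

datatype nexp =
    NConst nat
  | NRead vname nexp
  | NAdd nexp nexp
  | NSub nexp nexp

datatype rexp =
    ROfNat nexp
  | RRead vname nexp
  | RAdd rexp rexp
  | RSub rexp rexp

datatype bexp =
    NLess nexp nexp
  | RLess rexp rexp
  | BNot bexp
  | BAnd bexp bexp

datatype com =
    Skip
  | NAssign vname nexp nexp
  | RAssign vname nexp rexp
  | Flip vname nexp
  | Seq com com
  | If bexp com com
  | While bexp com

primrec nval :: "nexp \<Rightarrow> state \<Rightarrow> nat" where
  "nval (NConst k) s = k"
| "nval (NRead x i) s = fst s x (nval i s)"
| "nval (NAdd a b) s = nval a s + nval b s"
| "nval (NSub a b) s = nval a s - nval b s"

primrec rval :: "rexp \<Rightarrow> state \<Rightarrow> real" where
  "rval (ROfNat a) s = real (nval a s)"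
| "rval (RRead x i) s = snd s x (nval i s)"
| "rval (RAdd a b) s = rval a s + rval b s"
| "rval (RSub a b) s = rval a s - rval b s"

primrec bval :: "bexp \<Rightarrow> state \<Rightarrow> bool" where
  "bval (NLess a b) s \<longleftrightarrow> nval a s < nval b s"
| "bval (RLess a b) s \<longleftrightarrow> rval a s < rval b s"
| "bval (BNot b) s \<longleftrightarrow> \<not> bval b s"
| "bval (BAnd b c) s \<longleftrightarrow> bval b s \<and> bval c s"

definition nupd :: "vname \<Rightarrow> nat \<Rightarrow> nat \<Rightarrow> state \<Rightarrow> state" where
  "nupd x i k s = ((fst s)(x := (fst s x)(i := k)), snd s)"

definition rupd :: "vname \<Rightarrow> nat \<Rightarrow> real \<Rightarrow> state \<Rightarrow> state" where
  "rupd x i a s = (fst s, (snd s)(x := (snd s x)(i := a)))"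

text \<open>One step of the machine. An expression is evaluated in a single step, which only matters for
  a constant factor because the expressions in a fixed program have bounded size. Termination is
  reaching \<open>Skip\<close>, in which the machine then stays.\<close>

primrec step :: "com \<Rightarrow> state \<Rightarrow> (com \<times> state) pmf" where
  "step Skip s = return_pmf (Skip, s)"
| "step (NAssign x i a) s = return_pmf (Skip, nupd x (nval i s) (nval a s) s)"
| "step (RAssign x i a) s = return_pmf (Skip, rupd x (nval i s) (rval a s) s)"
| "step (Flip x i) s =
     map_pmf (\<lambda>b. (Skip, nupd x (nval i s) (if b then 1 else 0) s)) (bernoulli_pmf (1/2))"
| "step (Seq c1 c2) s =
     (if c1 = Skip then return_pmf (c2, s)
      else map_pmf (\<lambda>(c, s'). (Seq c c2, s')) (step c1 s))"
| "step (If b c1 c2) s = return_pmf (if bval b s then c1 else c2, s)"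
| "step (While b c) s = return_pmf (if bval b s then Seq c (While b c) else Skip, s)"

primrec run :: "nat \<Rightarrow> com \<times> state \<Rightarrow> (com \<times> state) pmf" where
  "run 0 cs = return_pmf cs"
| "run (Suc t) cs = bind_pmf (step (fst cs) (snd cs)) (run t)"

definition halts_within :: "nat \<Rightarrow> com \<Rightarrow> state \<Rightarrow> bool" where
  "halts_within t c s \<longleftrightarrow> (\<forall>cs \<in> set_pmf (run t (c, s)). fst cs = Skip)"

text \<open>Graphs with vertex set \<open>{..<n}\<close> are represented by adjacency matrices stored row by row. As
  there is no resistance array, this is the input of an instance with uniform resistances.\<close>

definition input_state :: "nat \<Rightarrow> nat set set \<Rightarrow> (nat \<Rightarrow> real) \<Rightarrow> state" where
  "input_state n E d =
     ((\<lambda>x k. if x = ''n'' \<and> k = 0 then n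
             else if x = ''E'' \<and> k < n * n \<and> {k div n, k mod n} \<in> E then 1
             else 0),
      (\<lambda>x k. if x = ''d'' \<and> k < n then d k else 0))"

definition output_edges :: "nat \<Rightarrow> state \<Rightarrow> nat set set" where
  "output_edges n s = {{i, j} | i j. i < n \<and> j < n \<and> fst s ''T'' (i * n + j) \<noteq> 0}"

definition output_pmf ::
    "nat \<Rightarrow> com \<Rightarrow> nat \<Rightarrow> nat set set \<Rightarrow> (nat \<Rightarrow> real) \<Rightarrow> nat set set pmf" where
  "output_pmf t c n E d = map_pmf (\<lambda>cs. output_edges n (snd cs)) (run t (c, input_state n E d))"

end

theory Submission
  imports Defs
begin

text \<open>In a tree rooted at the source the loss is the sum of \<open>(F w)\<^sup>2\<close> over the other vertices \<open>w\<close>,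
  where \<open>F w\<close> is the total demand below \<open>w\<close>. The algorithm is deterministic. It scales the demands
  to integers \<open>c\<close> that are polynomially bounded and relaxes trees to flows, where \<open>F w\<close> is the flow
  through \<open>w\<close>. A local primal-dual method in the style of push-relabel algorithms finds a flow whose
  energy \<open>\<Phi> = \<Sum>w. (F w)\<^sup>2\<close> is at most \<open>12\<close> times the optimum, together with heights that strictly
  decrease along the flow.

  The flow is made confluent: by increasing height, every vertex selects as its parent one of the
  vertices that it sends flow to. If the parents were chosen at random with probabilities proportional to the
  flow, then, since two demands whose paths merge are counted where they first meet, the sum \<open>M\<close> of the
  squared loads of the children of the source would have expectation at most \<open>\<Phi>\<close>, while
  \<open>W = \<Sum>v. c v * depth v\<close> has expectation \<open>\<Sum>w. F w \<le> sqrt (n * \<Phi>)\<close>. The method of conditional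
  expectations, applied to \<open>M + \<mu> * W\<close> with \<open>\<mu>\<close> about \<open>\<Phi> / (\<Sum>w. F w)\<close>, yields a tree for which both
  bounds hold up to a constant. Every load is at most \<open>sqrt M\<close> and the loads sum up to \<open>W\<close>, so
  the loss is at most \<open>sqrt M * W = O(sqrt n * \<Phi>)\<close>.\<close>

text \<open>The demands are arbitrary reals and the machine neither multiplies nor divides, so a
  convex program cannot simply be solved. Unit tokens avoid this: once the demands are integers of
  size polynomial in \<open>n\<close>, products and quotients can be counted out, and every move
  changes an integer potential of polynomial size. Integrality also helps the analysis: a load or a
  flow is at most its square, which absorbs the linear error terms of discrete marginal costs.

  The heights certify the energy by weak duality: the price \<open>\<Sum>v. c v * h v\<close> is at
  least half the energy when read along the slots of the flow, and it is bounded by the loads of an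
  arbitrary tree when read along the paths of that tree. Completing squares leaves the factor
  \<open>12\<close> there. Rounding contributes \<open>6 * sqrt n\<close>, and the passage from real
  to integral demands contributes \<open>4\<close>; hence \<open>288 = 12 * 6 * 4\<close>.

  The heights have a second use: since they strictly decrease from a vertex to its parent, they are
  a rank function that certifies the computed tree.\<close>

section \<open>A Hoare logic for polynomial running time\<close>

inductive exe :: "com \<Rightarrow> state \<Rightarrow> nat \<Rightarrow> state \<Rightarrow> bool" where
  exe_Skip: "exe Skip s 0 s"
| exe_step: "c \<noteq> Skip \<Longrightarrow> step c s = return_pmf (c', s1) \<Longrightarrow> exe c' s1 t s2 \<Longrightarrow> exe c s (Suc t) s2"

declare split_paired_All [simp del] split_paired_Ex [simp del]

lemma run_Skip: "run t (Skip, s) = return_pmf (Skip, s)"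
  by (induction t) (auto simp: bind_return_pmf)

text \<open>\<open>Skip\<close> is absorbing, so every time budget of at least \<open>t\<close>
  yields the same point mass. A polynomial bound can therefore stand in for the exact running
  time.\<close>

lemma exe_run:
  assumes "exe c s t s'" "t \<le> T"
  shows "run T (c, s) = return_pmf (Skip, s')"
  using assms
proof (induction arbitrary: T rule: exe.induct)
  case (exe_Skip s)
  then show ?case by (simp add: run_Skip)
next
  case (exe_step c s c' s1 t s2)
  then obtain T' where T': "T = Suc T'" "t \<le> T'" by (cases T) auto
  then show ?case using exe_step by (simp add: bind_return_pmf)
qed

lemma exe_Seq:
  assumes "exe c1 s t1 s1" "exe c2 s1 t2 s2"
  shows "exe (Seq c1 c2) s (Suc (t1 + t2)) s2"
  using assms
proof (induction rule: exe.induct)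
  case (exe_Skip s)
  then show ?case by (auto intro: exe.intros)
next
  case (exe_step c s c' s1 t s2')
  have "step (Seq c c2) s = return_pmf (Seq c' c2, s1)"
    using exe_step by simp
  then have "exe (Seq c c2) s (Suc (Suc (t + t2))) s2"
    using exe_step by (auto intro: exe.intros)
  then show ?case by simp
qed

lemma exe_If:
  assumes "exe (if bval b s then c1 else c2) s t s'"
  shows "exe (If b c1 c2) s (Suc t) s'"
  using assms by (intro exe_step[where c' = "if bval b s then c1 else c2" and ?s1.0 = s]) auto

lemma exe_While_False: "\<not> bval b s \<Longrightarrow> exe (While b c) s 1 s"
  using exe_step[of "While b c" s Skip s 0 s] exe_Skip by simp

lemma exe_While_True:
  assumes "bval b s" "exe c s t1 s1" "exe (While b c) s1 t2 s2"
  shows "exe (While b c) s (t1 + t2 + 2) s2"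
  using exe_step[of "While b c" s "Seq c (While b c)" s "Suc (t1 + t2)" s2]
    exe_Seq[OF assms(2,3)] assms(1) by simp

definition poly_bounded :: "(nat \<Rightarrow> nat) \<Rightarrow> bool" where
  "poly_bounded f \<longleftrightarrow> (\<exists>p. \<forall>n. f n \<le> poly p n)"

lemma poly_bounded_const: "poly_bounded (\<lambda>_. k)"
  unfolding poly_bounded_def by (rule exI[of _ "[:k:]"]) simp

lemma poly_bounded_id: "poly_bounded (\<lambda>n. n)"
  unfolding poly_bounded_def by (rule exI[of _ "[:0, 1:]"]) simp

lemma poly_bounded_add:
  assumes "poly_bounded f" "poly_bounded g"
  shows "poly_bounded (\<lambda>n. f n + g n)"
proof -
  obtain p q where "\<forall>n. f n \<le> poly p n" "\<forall>n. g n \<le> poly q n"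
    using assms by (auto simp: poly_bounded_def)
  then show ?thesis
    unfolding poly_bounded_def by (intro exI[of _ "p + q"]) (auto intro: add_mono)
qed

lemma poly_bounded_mult:
  assumes "poly_bounded f" "poly_bounded g"
  shows "poly_bounded (\<lambda>n. f n * g n)"
proof -
  obtain p q where "\<forall>n. f n \<le> poly p n" "\<forall>n. g n \<le> poly q n"
    using assms by (auto simp: poly_bounded_def)
  then show ?thesis
    unfolding poly_bounded_def by (intro exI[of _ "p * q"]) (auto intro: mult_mono)
qed

lemma poly_bounded_Suc: "poly_bounded f \<Longrightarrow> poly_bounded (\<lambda>n. Suc (f n))"
  using poly_bounded_add[OF _ poly_bounded_const, of f 1] by simp

lemmas poly_bounded_intros = poly_bounded_const poly_bounded_id poly_bounded_add
  poly_bounded_mult poly_bounded_Suc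

text \<open>The auxiliary value \<open>z\<close> links the two assertions; the time bound must not depend on it.\<close>

definition hoare ::
  "(nat \<Rightarrow> 'z \<Rightarrow> state \<Rightarrow> bool) \<Rightarrow> com \<Rightarrow> (nat \<Rightarrow> 'z \<Rightarrow> state \<Rightarrow> bool) \<Rightarrow> bool" where
  "hoare P c Q \<longleftrightarrow> (\<exists>f. poly_bounded f \<and>
     (\<forall>n z s. P n z s \<longrightarrow> (\<exists>t s'. t \<le> f n \<and> exe c s t s' \<and> Q n z s')))"

lemma hoareI:
  assumes "poly_bounded f"
    and "\<And>n z s. P n z s \<Longrightarrow> \<exists>t s'. t \<le> f n \<and> exe c s t s' \<and> Q n z s'"
  shows "hoare P c Q"
  unfolding hoare_def using assms by blast

text \<open>The auxiliary value \<open>y\<close> may depend on the initial state and have another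
  type than \<open>z\<close>. This is how a specification is specialized to values read off the
  current state, such as an old loop variant.\<close>

lemma hoare_conseq:
  assumes "hoare P c Q"
    and "\<And>n z s. P' n z s \<Longrightarrow> \<exists>y. P n y s \<and> (\<forall>s'. Q n y s' \<longrightarrow> Q' n z s')"
  shows "hoare P' c Q'"
proof -
  obtain f where f: "poly_bounded f"
    "\<And>n z s. P n z s \<Longrightarrow> \<exists>t s'. t \<le> f n \<and> exe c s t s' \<and> Q n z s'"
    using assms(1) unfolding hoare_def by blast
  show ?thesis
  proof (rule hoareI[OF f(1)])
    fix n z s assume "P' n z s"
    then obtain y where y: "P n y s" "\<And>s'. Q n y s' \<Longrightarrow> Q' n z s'" using assms(2) by metis
    then show "\<exists>t s'. t \<le> f n \<and> exe c s t s' \<and> Q' n z s'" using f(2)[OF y(1)] by metis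
  qed
qed

lemma hoare_pre:
  assumes "hoare P c Q" "\<And>n z s. P' n z s \<Longrightarrow> P n z s"
  shows "hoare P' c Q"
  by (rule hoare_conseq[OF assms(1)]) (use assms(2) in blast)

lemma hoare_Seq:
  assumes "hoare P c1 Q" "hoare Q c2 R"
  shows "hoare P (Seq c1 c2) R"
proof -
  obtain f where f: "poly_bounded f"
    "\<And>n z s. P n z s \<Longrightarrow> \<exists>t s'. t \<le> f n \<and> exe c1 s t s' \<and> Q n z s'"
    using assms(1) unfolding hoare_def by blast
  obtain g where g: "poly_bounded g"
    "\<And>n z s. Q n z s \<Longrightarrow> \<exists>t s'. t \<le> g n \<and> exe c2 s t s' \<and> R n z s'"
    using assms(2) unfolding hoare_def by blast
  show ?thesis
  proof (rule hoareI[where f = "\<lambda>n. Suc (f n + g n)"])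
    fix n z s assume "P n z s"
    then obtain t s1 where 1: "t \<le> f n" "exe c1 s t s1" "Q n z s1" using f by blast
    then obtain t' s2 where 2: "t' \<le> g n" "exe c2 s1 t' s2" "R n z s2" using g by blast
    show "\<exists>t s'. t \<le> Suc (f n + g n) \<and> exe (Seq c1 c2) s t s' \<and> R n z s'"
      using exe_Seq[OF 1(2) 2(2)] 1 2
      by (intro exI[of _ "Suc (t + t')"] exI[of _ s2]) auto
  qed (intro poly_bounded_intros f(1) g(1))
qed

lemma hoare_If:
  assumes "hoare (\<lambda>n z s. P n z s \<and> bval b s) c1 Q"
    and "hoare (\<lambda>n z s. P n z s \<and> \<not> bval b s) c2 Q"
  shows "hoare P (If b c1 c2) Q"
proof -
  obtain f where f: "poly_bounded f"
    "\<And>n z s. P n z s \<and> bval b s \<Longrightarrow> \<exists>t s'. t \<le> f n \<and> exe c1 s t s' \<and> Q n z s'"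
    using assms(1) unfolding hoare_def by blast
  obtain g where g: "poly_bounded g"
    "\<And>n z s. P n z s \<and> \<not> bval b s \<Longrightarrow> \<exists>t s'. t \<le> g n \<and> exe c2 s t s' \<and> Q n z s'"
    using assms(2) unfolding hoare_def by blast
  show ?thesis
  proof (rule hoareI[where f = "\<lambda>n. Suc (f n + g n)"])
    fix n z s assume P: "P n z s"
    have "\<exists>t s'. t \<le> f n + g n \<and> exe (if bval b s then c1 else c2) s t s' \<and> Q n z s'"
    proof (cases "bval b s")
      case True
      then show ?thesis using f(2)[OF conjI[OF P True]] by (auto intro: trans_le_add1)
    next
      case False
      then show ?thesis using g(2)[OF conjI[OF P False]] by (auto intro: trans_le_add2)
    qed
    then show "\<exists>t s'. t \<le> Suc (f n + g n) \<and> exe (If b c1 c2) s t s' \<and> Q n z s'"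
      using exe_If by (meson Suc_le_mono)
  qed (intro poly_bounded_intros f(1) g(1))
qed

text \<open>The auxiliary \<open>v\<close> remembers the variant before the body. A polynomially
  bounded variant means polynomially many rounds, each of polynomial cost.\<close>

lemma hoare_While:
  fixes V :: "nat \<Rightarrow> 'z \<Rightarrow> state \<Rightarrow> nat"
  assumes body: "hoare (\<lambda>n (z, v) s. I n z s \<and> bval b s \<and> V n z s = v) c
                       (\<lambda>n (z, v) s. I n z s \<and> V n z s < v)"
    and bnd: "poly_bounded g" "\<And>n z s. I n z s \<Longrightarrow> V n z s \<le> g n"
  shows "hoare I (While b c) (\<lambda>n z s. I n z s \<and> \<not> bval b s)"
proof -
  obtain f where f: "poly_bounded f"
    "\<And>n z s. I n z s \<Longrightarrow> bval b s \<Longrightarrow>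
       \<exists>t s'. t \<le> f n \<and> exe c s t s' \<and> I n z s' \<and> V n z s' < V n z s"
  proof -
    obtain f where f: "poly_bounded f"
      "\<forall>n zv s. (case zv of (z, v) \<Rightarrow> \<lambda>s. I n z s \<and> bval b s \<and> V n z s = v) s \<longrightarrow>
        (\<exists>t s'. t \<le> f n \<and> exe c s t s' \<and> (case zv of (z, v) \<Rightarrow> \<lambda>s. I n z s \<and> V n z s < v) s')"
      using body unfolding hoare_def by blast
    have "\<exists>t s'. t \<le> f n \<and> exe c s t s' \<and> I n z s' \<and> V n z s' < V n z s"
      if "I n z s" "bval b s" for n z s
      using f(2)[rule_format, of n "(z, V n z s)" s] that by simp
    with f(1) show ?thesis using that by blast
  qed
  \<comment> \<open>A round costs its body and \<open>2\<close> further steps; the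
    \<open>+ 1\<close> pays for the final failing test.\<close>
  have *: "\<exists>t s'. t \<le> (V n z s + 1) * (f n + 2) \<and> exe (While b c) s t s' \<and> I n z s' \<and> \<not> bval b s'"
    if "I n z s" for n z s
    using that
  proof (induction "V n z s" arbitrary: s rule: less_induct)
    case less
    show ?case
    proof (cases "bval b s")
      case False
      then show ?thesis using exe_While_False[OF False] less(2) by (intro exI[of _ 1] exI[of _ s]) auto
    next
      case True
      then obtain t s1 where 1: "t \<le> f n" "exe c s t s1" "I n z s1" "V n z s1 < V n z s"
        using f(2) less(2) by blast
      then obtain t' s2 where 2: "t' \<le> (V n z s1 + 1) * (f n + 2)" "exe (While b c) s1 t' s2"
        "I n z s2" "\<not> bval b s2"
        using less(1) by blast
      have "(V n z s1 + 1) * (f n + 2) \<le> V n z s * (f n + 2)"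
        using 1(4) by (intro mult_right_mono) auto
      then have "t + t' + 2 \<le> (V n z s + 1) * (f n + 2)"
        using 1 2 by (simp add: algebra_simps)
      then show ?thesis using exe_While_True[OF True 1(2) 2(2)] 2 by blast
    qed
  qed
  show ?thesis
  proof (rule hoareI[where f = "\<lambda>n. (g n + 1) * (f n + 2)"])
    show "poly_bounded (\<lambda>n. (g n + 1) * (f n + 2))"
      by (intro poly_bounded_intros f(1) bnd(1))
    fix n z s assume I: "I n z s"
    have "(V n z s + 1) * (f n + 2) \<le> (g n + 1) * (f n + 2)"
      using bnd(2)[OF I] by (intro mult_right_mono) auto
    then show "\<exists>t s'. t \<le> (g n + 1) * (f n + 2) \<and> exe (While b c) s t s' \<and> I n z s' \<and> \<not> bval b s'"
      using *[OF I] le_trans by blast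
  qed
qed

section \<open>Loop-free programs and their effect\<close>

primrec straight :: "com \<Rightarrow> bool" where
  "straight Skip = True"
| "straight (NAssign x i a) = True"
| "straight (RAssign x i a) = True"
| "straight (Flip x i) = False"
| "straight (Seq c1 c2) = (straight c1 \<and> straight c2)"
| "straight (If b c1 c2) = (straight c1 \<and> straight c2)"
| "straight (While b c) = False"

text \<open>Symbolic execution: for \<open>straight\<close> programs a postcondition is evaluated by
  rewriting with these equations. Those for \<open>Flip\<close> and \<open>While\<close> are
  dummies.\<close>

primrec eff :: "com \<Rightarrow> state \<Rightarrow> state" where
  "eff Skip s = s"
| "eff (NAssign x i a) s = nupd x (nval i s) (nval a s) s"
| "eff (RAssign x i a) s = rupd x (nval i s) (rval a s) s"
| "eff (Flip x i) s = s"
| "eff (Seq c1 c2) s = eff c2 (eff c1 s)"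
| "eff (If b c1 c2) s = (if bval b s then eff c1 s else eff c2 s)"
| "eff (While b c) s = s"

lemma exe_straight: "straight c \<Longrightarrow> \<exists>t \<le> 2 * size c + 1. exe c s t (eff c s)"
proof (induction c arbitrary: s)
  case (Seq c1 c2)
  then obtain t1 t2 where "t1 \<le> 2 * size c1 + 1" "exe c1 s t1 (eff c1 s)"
    "t2 \<le> 2 * size c2 + 1" "exe c2 (eff c1 s) t2 (eff c2 (eff c1 s))" by fastforce
  then show ?case using exe_Seq by (intro exI[of _ "Suc (t1 + t2)"]) auto
next
  case (If b c1 c2)
  obtain t1 where t1: "t1 \<le> 2 * size c1 + 1" "exe c1 s t1 (eff c1 s)" using If by fastforce
  obtain t2 where t2: "t2 \<le> 2 * size c2 + 1" "exe c2 s t2 (eff c2 s)" using If by fastforce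
  show ?case
    using exe_If[of b s c1 c2 "if bval b s then t1 else t2" "eff (If b c1 c2) s"] t1 t2
    by (intro exI[of _ "Suc (if bval b s then t1 else t2)"]) auto
next
  case Skip
  show ?case using exe_Skip[of s] by (intro exI[of _ 0]) simp
next
  case (NAssign x i a)
  then show ?case using exe_step[OF _ _ exe_Skip, of "NAssign x i a" s] by auto
next
  case (RAssign x i a)
  then show ?case using exe_step[OF _ _ exe_Skip, of "RAssign x i a" s] by auto
qed auto

lemma hoare_straight:
  assumes "straight c" "\<And>n z s. P n z s \<Longrightarrow> Q n z (eff c s)"
  shows "hoare P c Q"
proof (rule hoareI[OF poly_bounded_const[of "2 * size c + 1"]])
  fix n z s assume "P n z s"
  then show "\<exists>t s'. t \<le> 2 * size c + 1 \<and> exe c s t s' \<and> Q n z s'"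
    using exe_straight[OF assms(1), of s] assms(2) by metis
qed

text \<open>As \<open>fst\<close> and \<open>snd\<close> are simplified away when a proof method splits a state into a pair, the
  assertions use opaque copies of them.\<close>

definition arr :: "state \<Rightarrow> vname \<Rightarrow> nat \<Rightarrow> nat" where "arr s = fst s"

definition rarr :: "state \<Rightarrow> vname \<Rightarrow> nat \<Rightarrow> real" where "rarr s = snd s"

lemma arr_nupd [simp]: "arr (nupd x i k s) = (arr s)(x := (arr s x)(i := k))"
  and rarr_nupd [simp]: "rarr (nupd x i k s) = rarr s"
  and arr_rupd [simp]: "arr (rupd x i a s) = arr s"
  and rarr_rupd [simp]: "rarr (rupd x i a s) = (rarr s)(x := (rarr s x)(i := a))"
  by (simp_all add: nupd_def rupd_def arr_def rarr_def)

lemma nval_NRead [simp]: "nval (NRead x i) s = arr s x (nval i s)"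
  and rval_RRead [simp]: "rval (RRead x i) s = rarr s x (nval i s)"
  by (simp_all add: arr_def rarr_def)

declare nval.simps(2) [simp del] rval.simps(2) [simp del]

abbreviation var :: "vname \<Rightarrow> nexp" where "var x \<equiv> NRead x (NConst 0)"

definition For :: "vname \<Rightarrow> nexp \<Rightarrow> com \<Rightarrow> com" where
  "For x m c = Seq (NAssign x (NConst 0) (NConst 0))
     (While (NLess (var x) m) (Seq c (NAssign x (NConst 0) (NAdd (var x) (NConst 1)))))"

text \<open>The bound \<open>m\<close> is evaluated anew before every round, so the invariant has to
  preserve its value \<open>M\<close>. The body must establish the invariant for the state with
  advanced counter, while leaving the counter itself alone.\<close>

lemma hoare_For:
  assumes body: "hoare (\<lambda>n (z, M, k) s. I n z M k s \<and> arr s x 0 = k \<and> k < M) c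
      (\<lambda>n (z, M, k) s. I n z M (Suc k) (nupd x 0 (Suc k) s) \<and> arr s x 0 = k)"
    and pb: "poly_bounded g" "\<And>n z M k s. I n z M k s \<Longrightarrow> nval m s = M \<and> M \<le> g n"
    and pre: "\<And>n z s. P n z s \<Longrightarrow> I n z (nval m s) 0 (nupd x 0 0 s)"
    and post: "\<And>n z M s. I n z M M s \<Longrightarrow> Q n z s"
  shows "hoare P (For x m c) Q"
proof -
  let ?J = "\<lambda>n (z, M) s. I n z M (arr s x 0) s \<and> arr s x 0 \<le> M"
  let ?b = "NLess (var x) m" and ?inc = "NAssign x (NConst 0) (NAdd (var x) (NConst 1))"
  let ?A = "\<lambda>n (y, v) s. ?J n y s \<and> bval ?b s \<and> snd y - arr s x 0 = v"
  \<comment> \<open>The variant \<open>v\<close> counts the remaining rounds, so the current index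
    is recovered as \<open>M - v\<close>.\<close>
  let ?K = "\<lambda>n ((z, M), v) s. v > 0 \<and> v \<le> M \<and> I n z M (Suc (M - v)) (nupd x 0 (Suc (M - v)) s) \<and> arr s x 0 = M - v"
  let ?R = "\<lambda>n (y, v) s. ?J n y s \<and> snd y - arr s x 0 < v"
  have "hoare ?A (Seq c ?inc) ?R"
  proof (rule hoare_Seq)
    show "hoare ?A c ?K"
    proof (rule hoare_conseq[OF body])
      fix n s and yv :: "('a \<times> nat) \<times> nat"
      obtain z M v where yv: "yv = ((z, M), v)" by (metis surj_pair)
      assume "?A n yv s"
      then have I: "I n z M (arr s x 0) s" and v: "M - arr s x 0 = v" and "arr s x 0 < nval m s"
        unfolding yv by auto
      then have k: "arr s x 0 < M" "M - v = arr s x 0" using pb(2)[OF I] by auto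
      show "\<exists>y. (case y of (z, M, k) \<Rightarrow> \<lambda>s. I n z M k s \<and> arr s x 0 = k \<and> k < M) s \<and>
          (\<forall>s'. (case y of (z, M, k) \<Rightarrow> \<lambda>s. I n z M (Suc k) (nupd x 0 (Suc k) s) \<and> arr s x 0 = k) s' \<longrightarrow> ?K n yv s')"
        unfolding yv using I v k by (intro exI[of _ "(z, M, arr s x 0)"]) auto
    qed
    show "hoare ?K ?inc ?R"
    proof (rule hoare_straight)
      fix n s and yv :: "('a \<times> nat) \<times> nat"
      obtain z M v where yv: "yv = ((z, M), v)" by (metis surj_pair)
      assume "?K n yv s"
      then show "?R n yv (eff ?inc s)" unfolding yv by auto
    qed simp
  qed
  then have "hoare ?J (While ?b (Seq c ?inc)) (\<lambda>n y s. ?J n y s \<and> \<not> bval ?b s)"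
  proof (rule hoare_While[where V = "\<lambda>n y s. snd y - arr s x 0", OF _ pb(1)])
    fix n s and y :: "'a \<times> nat"
    assume "?J n y s"
    then have "snd y \<le> g n" using pb(2)[of n "fst y" "snd y" "arr s x 0" s] by (simp add: split_def)
    then show "snd y - arr s x 0 \<le> g n" by linarith
  qed
  then have "hoare ?J (While ?b (Seq c ?inc)) (\<lambda>n y s. Q n (fst y) s)"
  proof (rule hoare_conseq)
    fix n s and y :: "'a \<times> nat"
    assume J: "?J n y s"
    have "Q n (fst y) s'" if *: "?J n y s' \<and> \<not> bval ?b s'" for s'
    proof -
      have I: "I n (fst y) (snd y) (arr s' x 0) s'" and "arr s' x 0 \<le> snd y" "\<not> arr s' x 0 < nval m s'"
        using * by (auto simp: split_def)
      then have "arr s' x 0 = snd y" using pb(2)[OF I] by simp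
      then show ?thesis using I post by metis
    qed
    then show "\<exists>y'. ?J n y' s \<and> (\<forall>s'. ?J n y' s' \<and> \<not> bval ?b s' \<longrightarrow> Q n (fst y) s')"
      using J by blast
  qed
  moreover have "hoare (\<lambda>n y s. P n (fst y) s \<and> nval m s = snd y) (NAssign x (NConst 0) (NConst 0)) ?J"
  proof (rule hoare_straight)
    fix n s and y :: "'a \<times> nat"
    assume "P n (fst y) s \<and> nval m s = snd y"
    then show "?J n y (eff (NAssign x (NConst 0) (NConst 0)) s)"
      using pre[of n "fst y" s] by (simp add: split_def)
  qed simp
  ultimately have "hoare (\<lambda>n y s. P n (fst y) s \<and> nval m s = snd y) (For x m c) (\<lambda>n y s. Q n (fst y) s)"
    unfolding For_def using hoare_Seq by blast
  then show ?thesis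
  proof (rule hoare_conseq)
    fix n s and z :: 'a
    assume "P n z s"
    then show "\<exists>y. (P n (fst y) s \<and> nval m s = snd y) \<and> (\<forall>s'. Q n (fst y) s' \<longrightarrow> Q n z s')"
      by (intro exI[of _ "(z, nval m s)"]) simp
  qed
qed

lemma hoare_For_straight:
  assumes "straight c"
    and body: "\<And>n z M k s. I n z M k s \<Longrightarrow> arr s x 0 = k \<Longrightarrow> k < M \<Longrightarrow>
      I n z M (Suc k) (nupd x 0 (Suc k) (eff c s)) \<and> arr (eff c s) x 0 = k"
    and pb: "poly_bounded g" "\<And>n z M k s. I n z M k s \<Longrightarrow> nval m s = M \<and> M \<le> g n"
    and pre: "\<And>n z s. P n z s \<Longrightarrow> I n z (nval m s) 0 (nupd x 0 0 s)"
    and post: "\<And>n z M s. I n z M M s \<Longrightarrow> Q n z s"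
  shows "hoare P (For x m c) Q"
proof (rule hoare_For[where I = I, OF _ pb pre post])
  show "hoare (\<lambda>n (z, M, k) s. I n z M k s \<and> arr s x 0 = k \<and> k < M) c
      (\<lambda>n (z, M, k) s. I n z M (Suc k) (nupd x 0 (Suc k) s) \<and> arr s x 0 = k)" (is "hoare ?P c ?Q")
  proof (rule hoare_straight[OF assms(1)])
    fix n s and y :: "'a \<times> nat \<times> nat"
    obtain z M k where y: "y = (z, M, k)" by (metis surj_pair)
    assume "?P n y s"
    then show "?Q n y (eff c s)" using body[of n z M k s] unfolding y by simp
  qed
qed

lemma hoare_While_straight:
  fixes V :: "nat \<Rightarrow> 'z \<Rightarrow> state \<Rightarrow> nat"
  assumes "straight c"
    and body: "\<And>n z s. I n z s \<Longrightarrow> bval b s \<Longrightarrow> I n z (eff c s) \<and> V n z (eff c s) < V n z s"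
    and pb: "poly_bounded g" "\<And>n z s. I n z s \<Longrightarrow> V n z s \<le> g n"
    and post: "\<And>n z s. I n z s \<Longrightarrow> \<not> bval b s \<Longrightarrow> Q n z s"
  shows "hoare I (While b c) Q"
proof -
  have "hoare I (While b c) (\<lambda>n z s. I n z s \<and> \<not> bval b s)"
  proof (rule hoare_While[where V = V, OF _ pb])
    show "hoare (\<lambda>n (z, v) s. I n z s \<and> bval b s \<and> V n z s = v) c
      (\<lambda>n (z, v) s. I n z s \<and> V n z s < v)" (is "hoare ?P c ?Q")
    proof (rule hoare_straight[OF assms(1)])
      fix n s and y :: "'z \<times> nat"
      obtain z v where y: "y = (z, v)" by (cases y)
      assume "?P n y s"
      then show "?Q n y (eff c s)" using body[of n z s] unfolding y by simp
    qed
  qed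
  then show ?thesis by (rule hoare_conseq) (use post in blast)
qed

section \<open>Write sets and a frame rule\<close>

primrec nat_writes :: "com \<Rightarrow> vname set" where
  "nat_writes Skip = {}"
| "nat_writes (NAssign x i a) = {x}"
| "nat_writes (RAssign x i a) = {}"
| "nat_writes (Flip x i) = {x}"
| "nat_writes (Seq c1 c2) = nat_writes c1 \<union> nat_writes c2"
| "nat_writes (If b c1 c2) = nat_writes c1 \<union> nat_writes c2"
| "nat_writes (While b c) = nat_writes c"

lemma step_writes:
  "(c', s') \<in> set_pmf (step c s) \<Longrightarrow>
    nat_writes c' \<subseteq> nat_writes c \<and> (\<forall>x. x \<notin> nat_writes c \<longrightarrow> arr s' x = arr s x)"
proof (induction c arbitrary: c' s')
  case (Seq c1 c2)
  show ?case
  proof (cases "c1 = Skip")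
    case False
    then obtain d where "(d, s') \<in> set_pmf (step c1 s)" "c' = Seq d c2" using Seq.prems by auto
    then show ?thesis using Seq.IH(1)[of d s'] by auto
  qed (use Seq.prems in auto)
qed (auto split: if_splits)

lemma exe_writes: "exe c s t s' \<Longrightarrow> x \<notin> nat_writes c \<Longrightarrow> arr s' x = arr s x"
proof (induction rule: exe.induct)
  case (exe_step c s c' s1 t s2)
  then show ?case using step_writes[of c' s1 c s] by auto
qed simp

text \<open>A specification that is silent about an array can thus be used under an invariant that
  mentions it; \<open>round_phase\<close> does this for \<open>hm\<close>, the bound of its outer
  loop.\<close>

lemma hoare_frame:
  assumes "hoare P c Q" "x \<notin> nat_writes c"
  shows "hoare (\<lambda>n (z, v) s. P n z s \<and> arr s x = v) c (\<lambda>n (z, v) s. Q n z s \<and> arr s x = v)"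
proof -
  obtain f where f: "poly_bounded f"
    "\<And>n z s. P n z s \<Longrightarrow> \<exists>t s'. t \<le> f n \<and> exe c s t s' \<and> Q n z s'"
    using assms(1) unfolding hoare_def by blast
  show ?thesis
  proof (rule hoareI[OF f(1)])
    fix n s and y :: "'a \<times> (nat \<Rightarrow> nat)"
    obtain z v where y: "y = (z, v)" by (cases y)
    assume "(case y of (z, v) \<Rightarrow> \<lambda>s. P n z s \<and> arr s x = v) s"
    then have "P n z s" and v: "arr s x = v" unfolding y by auto
    then obtain t s' where "t \<le> f n" and e: "exe c s t s'" and "Q n z s'" using f(2) by blast
    moreover have "arr s' x = v" using exe_writes[OF e assms(2)] v by simp
    ultimately show "\<exists>t s'. t \<le> f n \<and> exe c s t s' \<and> (case y of (z, v) \<Rightarrow> \<lambda>s. Q n z s \<and> arr s x = v) s'"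
      unfolding y by auto
  qed
qed

section \<open>Rooted trees\<close>

text \<open>Loop erasure: if the next vertex already lies on the path, the path is cut there instead
  of prolonged.\<close>

lemma exists_distinct_path:
  assumes "(x, y) \<in> r\<^sup>*"
  shows "\<exists>p. p \<noteq> [] \<and> hd p = x \<and> last p = y \<and> distinct p \<and>
    (\<forall>i. Suc i < length p \<longrightarrow> (p ! i, p ! Suc i) \<in> r)"
  using assms
proof (induction rule: rtrancl_induct)
  case base
  then show ?case by (intro exI[of _ "[x]"]) simp
next
  case (step y z)
  then obtain p where p: "p \<noteq> []" "hd p = x" "last p = y" "distinct p"
    "\<And>i. Suc i < length p \<Longrightarrow> (p ! i, p ! Suc i) \<in> r" by blast
  show ?case
  proof (cases "z \<in> set p")
    case True
    then obtain k where k: "k < length p" "p ! k = z" by (auto simp: in_set_conv_nth)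
    have "last (take (Suc k) p) = z" using k by (simp add: take_Suc_conv_app_nth)
    then show ?thesis using p k by (intro exI[of _ "take (Suc k) p"]) auto
  next
    case False
    have "((p @ [z]) ! i, (p @ [z]) ! Suc i) \<in> r" if "Suc i < length (p @ [z])" for i
    proof (cases "Suc i < length p")
      case True
      then show ?thesis using p(5)[of i] by (simp add: nth_append)
    next
      case False
      then have "i = length p - 1" "Suc i = length p" using that p(1) by auto
      then show ?thesis using step(2) p(1,3) by (simp add: nth_append last_conv_nth)
    qed
    then show ?thesis using p False by (intro exI[of _ "p @ [z]"]) auto
  qed
qed

text \<open>The rank certifies that parent chains end in \<open>root\<close>. Breadth-first
  distances serve for a given spanning tree, the heights of the flow for the computed one.\<close>

locale rooted_tree =
  fixes V :: "'a set" and root :: 'a and par :: "'a \<Rightarrow> 'a" and rank :: "'a \<Rightarrow> nat"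
  assumes finV: "finite V" and root: "root \<in> V"
    and par_in: "\<And>v. v \<in> V \<Longrightarrow> v \<noteq> root \<Longrightarrow> par v \<in> V"
    and rank_par: "\<And>v. v \<in> V \<Longrightarrow> v \<noteq> root \<Longrightarrow> rank (par v) < rank v"
begin

definition up :: "'a rel" where "up = {(v, par v) | v. v \<in> V \<and> v \<noteq> root}"

text \<open>\<open>anc v\<close> contains \<open>v\<close> but not \<open>root\<close>: a vertex
  \<open>w\<close> stands for the edge \<open>{w, par w}\<close>, so \<open>anc v\<close> encodes
  the edges of the path from \<open>v\<close> to the root.\<close>

definition anc :: "'a \<Rightarrow> 'a set" where "anc v = {a. a \<noteq> root \<and> (v, a) \<in> up\<^sup>*}"

definition sub :: "'a \<Rightarrow> 'a set" where "sub w = {v \<in> V. w \<in> anc v}"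

definition edges :: "'a set set" where "edges = (\<lambda>v. {v, par v}) ` (V - {root})"

definition load :: "('a \<Rightarrow> real) \<Rightarrow> 'a \<Rightarrow> real" where "load d w = sum d (sub w)"

lemma tree_induct [consumes 1, case_names root par]:
  assumes "v \<in> V" "P root" "\<And>v. v \<in> V \<Longrightarrow> v \<noteq> root \<Longrightarrow> P (par v) \<Longrightarrow> P v"
  shows "P v"
  using assms(1)
proof (induction "rank v" arbitrary: v rule: less_induct)
  case less
  then show ?case using assms(2,3) par_in rank_par by (cases "v = root") blast+
qed

lemma up_root: "(root, a) \<in> up\<^sup>* \<longleftrightarrow> a = root"
  by (auto simp: up_def elim: converse_rtranclE)

lemma up_step: "v \<in> V \<Longrightarrow> v \<noteq> root \<Longrightarrow> (v, a) \<in> up\<^sup>* \<longleftrightarrow> a = v \<or> (par v, a) \<in> up\<^sup>*"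
  by (auto simp: up_def elim: converse_rtranclE intro: converse_rtrancl_into_rtrancl)

lemma anc_root [simp]: "anc root = {}"
  by (auto simp: anc_def up_root)

lemma anc_step: "v \<in> V \<Longrightarrow> v \<noteq> root \<Longrightarrow> anc v = insert v (anc (par v))"
  by (auto simp: anc_def up_step)

lemma anc_subset: "v \<in> V \<Longrightarrow> anc v \<subseteq> V - {root}"
  by (induction rule: tree_induct) (auto simp: anc_step)

lemma rank_anc: "v \<in> V \<Longrightarrow> a \<in> anc v \<Longrightarrow> rank a \<le> rank v"
  by (induction arbitrary: a rule: tree_induct) (use rank_par in \<open>fastforce simp: anc_step\<close>)+

lemma not_anc_par: "v \<in> V \<Longrightarrow> v \<noteq> root \<Longrightarrow> v \<notin> anc (par v)"
  using rank_anc[of "par v" v] par_in rank_par[of v] by force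

lemma finite_anc: "v \<in> V \<Longrightarrow> finite (anc v)"
  using anc_subset finV by (meson finite_Diff finite_subset)

lemma telescope_anc:
  fixes g :: "'a \<Rightarrow> real"
  shows "v \<in> V \<Longrightarrow> (\<Sum>a\<in>anc v. g a - g (par a)) = g v - g root"
  by (induction rule: tree_induct) (simp_all add: anc_step not_anc_par finite_anc par_in)

text \<open>Double counting of the pairs of a demand and an edge on its path. With
  \<open>g = 1\<close> it equates the demand-weighted depths with the sum of the loads; with height
  differences it gives the upper bound of the duality argument.\<close>

lemma sum_anc_swap:
  fixes g :: "'a \<Rightarrow> real"
  shows "(\<Sum>v\<in>V. d v * (\<Sum>a\<in>anc v. g a)) = (\<Sum>w\<in>V - {root}. load d w * g w)"
proof -
  have "(\<Sum>v\<in>V. d v * (\<Sum>a\<in>anc v. g a)) = (\<Sum>v\<in>V. \<Sum>w\<in>V - {root}. if w \<in> anc v then d v * g w else 0)"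
  proof (rule sum.cong[OF refl])
    fix v assume v: "v \<in> V"
    have "(\<Sum>w\<in>V - {root}. if w \<in> anc v then d v * g w else 0) = (\<Sum>w\<in>(V - {root}) \<inter> anc v. d v * g w)"
      using finV by (simp add: sum.inter_restrict)
    also have "(V - {root}) \<inter> anc v = anc v" using anc_subset[OF v] by blast
    finally show "d v * (\<Sum>a\<in>anc v. g a) = (\<Sum>w\<in>V - {root}. if w \<in> anc v then d v * g w else 0)"
      by (simp add: sum_distrib_left)
  qed
  also have "\<dots> = (\<Sum>w\<in>V - {root}. \<Sum>v\<in>V. if w \<in> anc v then d v * g w else 0)"
    by (rule sum.swap)
  also have "\<dots> = (\<Sum>w\<in>V - {root}. load d w * g w)"
  proof (rule sum.cong[OF refl])
    fix w
    have "(\<Sum>v\<in>V. if w \<in> anc v then d v * g w else 0) = (\<Sum>v\<in>sub w. d v * g w)"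
      unfolding sub_def using finV by (simp add: sum.inter_filter)
    then show "(\<Sum>v\<in>V. if w \<in> anc v then d v * g w else 0) = load d w * g w"
      by (simp add: load_def sum_distrib_right)
  qed
  finally show ?thesis .
qed

lemma sub_self: "w \<in> V \<Longrightarrow> w \<noteq> root \<Longrightarrow> w \<in> sub w"
  by (auto simp: sub_def anc_step)

section \<open>Edges, components and losses of rooted trees\<close>

lemma edge_inj:
  assumes "v \<in> V - {root}" "w \<in> V - {root}" "{v, par v} = {w, par w}"
  shows "v = w"
  using assms rank_par[of v] rank_par[of w] by (auto simp: doubleton_eq_iff)

lemma component_closed:
  assumes "x \<in> S" "\<And>a b. a \<in> S \<Longrightarrow> {a, b} \<in> F \<Longrightarrow> b \<in> S"
  shows "component F x \<subseteq> S"
proof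
  fix v assume "v \<in> component F x"
  then have "(x, v) \<in> {(a, b). {a, b} \<in> F}\<^sup>*" by (simp add: component_def)
  then show "v \<in> S" by (induction rule: rtrancl_induct) (use assms in auto)
qed

lemma component_sym: "v \<in> component F x \<longleftrightarrow> x \<in> component F v"
proof -
  have "sym {(a, b). {a, b} \<in> F}" by (auto simp: sym_def insert_commute)
  then show ?thesis unfolding component_def by (auto dest: sym_rtrancl symD)
qed

lemma component_trans: "v \<in> component F x \<Longrightarrow> u \<in> component F v \<Longrightarrow> u \<in> component F x"
  by (auto simp: component_def)

lemma component_edge: "{x, v} \<in> F \<Longrightarrow> v \<in> component F x"
  by (auto simp: component_def)

lemma component_self: "x \<in> component F x"
  by (auto simp: component_def)

lemma root_in_component: "v \<in> V \<Longrightarrow> root \<in> component edges v"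
proof (induction rule: tree_induct)
  case root
  then show ?case by (rule component_self)
next
  case (par v)
  then have "{v, par v} \<in> edges" by (auto simp: edges_def)
  from component_trans[OF component_edge[OF this]] par show ?case by blast
qed

lemma component_edges: "v \<in> V \<Longrightarrow> w \<in> V \<Longrightarrow> w \<in> component edges v"
  using component_trans[OF root_in_component] root_in_component component_sym by metis

text \<open>\<open>sub w\<close> is closed under the remaining edges because only
  \<open>{w, par w}\<close> leaves it, and climbing from any of its vertices reaches
  \<open>w\<close> before that edge.\<close>

lemma component_child:
  assumes w: "w \<in> V" "w \<noteq> root"
  shows "component (edges - {{w, par w}}) w = sub w"
proof
  show "component (edges - {{w, par w}}) w \<subseteq> sub w"
  proof (rule component_closed)
    fix a b assume a: "a \<in> sub w" and e: "{a, b} \<in> edges - {{w, par w}}"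
    then obtain x where x: "x \<in> V" "x \<noteq> root" "{a, b} = {x, par x}" "x \<noteq> w" by (auto simp: edges_def)
    show "b \<in> sub w"
      using a x par_in by (auto simp: doubleton_eq_iff sub_def anc_step)
  qed (rule sub_self[OF w])
  have "v \<in> V \<Longrightarrow> w \<in> anc v \<Longrightarrow> w \<in> component (edges - {{w, par w}}) v" for v
  proof (induction rule: tree_induct)
    case (par v)
    show ?case
    proof (cases "v = w")
      case False
      then have "{v, par v} \<in> edges - {{w, par w}}" and w': "w \<in> anc (par v)"
        using par w edge_inj[of v w] by (auto simp: edges_def anc_step)
      from component_trans[OF component_edge[OF this(1)] par(3)[OF w']] show ?thesis .
    qed (simp add: component_self)
  qed simp
  then show "sub w \<subseteq> component (edges - {{w, par w}}) w"
    using component_sym[of w] by (auto simp: sub_def)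
qed

lemma component_par:
  assumes w: "w \<in> V" "w \<noteq> root"
  shows "component (edges - {{w, par w}}) (par w) = V - sub w"
proof
  show "component (edges - {{w, par w}}) (par w) \<subseteq> V - sub w"
  proof (rule component_closed)
    fix a b assume a: "a \<in> V - sub w" and e: "{a, b} \<in> edges - {{w, par w}}"
    then obtain x where x: "x \<in> V" "x \<noteq> root" "{a, b} = {x, par x}" "x \<noteq> w" by (auto simp: edges_def)
    show "b \<in> V - sub w"
      using a x par_in by (auto simp: doubleton_eq_iff sub_def anc_step)
  qed (use w par_in not_anc_par in \<open>auto simp: sub_def\<close>)
  have *: "v \<in> V \<Longrightarrow> w \<notin> anc v \<Longrightarrow> root \<in> component (edges - {{w, par w}}) v" for v
  proof (induction rule: tree_induct)
    case (par v)
    then have "{v, par v} \<in> edges - {{w, par w}}" and w': "w \<notin> anc (par v)"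
      using w edge_inj[of v w] by (auto simp: edges_def anc_step)
    from component_trans[OF component_edge[OF this(1)] par(3)[OF w']] show ?case .
  qed (rule component_self)
  have "root \<in> component (edges - {{w, par w}}) (par w)"
    using *[of "par w"] w par_in not_anc_par by blast
  show "V - sub w \<subseteq> component (edges - {{w, par w}}) (par w)"
  proof
    fix v assume "v \<in> V - sub w"
    then have "v \<in> component (edges - {{w, par w}}) root"
      using *[of v] component_sym[of root] by (auto simp: sub_def)
    with \<open>root \<in> component _ (par w)\<close> show "v \<in> component (edges - {{w, par w}}) (par w)"
      by (rule component_trans)
  qed
qed

lemma edge_load_eq:
  assumes w: "w \<in> V" "w \<noteq> root" and d: "sum d V = 0"
  shows "(edge_load d edges {w, par w})\<^sup>2 = (load d w)\<^sup>2"
proof -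
  have "(SOME x. x \<in> {w, par w}) \<in> {w, par w}" by (rule someI[of _ w]) simp
  then consider "(SOME x. x \<in> {w, par w}) = w" | "(SOME x. x \<in> {w, par w}) = par w" by blast
  then show ?thesis
  proof cases
    case 1
    then show ?thesis by (simp only: edge_load_def component_child[OF w] load_def)
  next
    case 2
    have "sum d (V - sub w) = - sum d (sub w)"
      using sum_diff[of V "sub w" d] finV d by (auto simp: sub_def)
    then show ?thesis
      using 2 by (simp only: edge_load_def component_par[OF w] load_def power2_minus)
  qed
qed

lemma loss_edges:
  assumes "sum d V = 0"
  shows "loss d (\<lambda>_. 1) edges = (\<Sum>w\<in>V - {root}. (load d w)\<^sup>2)"
proof -
  have "inj_on (\<lambda>v. {v, par v}) (V - {root})" by (rule inj_onI) (rule edge_inj)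
  then have "loss d (\<lambda>_. 1) edges = (\<Sum>w\<in>V - {root}. (edge_load d edges {w, par w})\<^sup>2)"
    unfolding loss_def edges_def by (simp add: sum.reindex)
  then show ?thesis using edge_load_eq[OF _ _ assms] by simp
qed

text \<open>At a vertex of maximal rank on a cycle both neighbours would have to be its parent, but
  on a cycle of length at least 3 they are distinct.\<close>

lemma no_cycle: "\<not> is_cycle edges p"
proof
  assume cyc: "is_cycle edges p"
  define l where "l = length p"
  have l: "l \<ge> 3" and dp: "distinct p" using cyc by (auto simp: is_cycle_def l_def)
  have adj: "{p ! i, p ! (Suc i mod l)} \<in> edges" if "i < l" for i
  proof (cases "Suc i < l")
    case True
    then show ?thesis using cyc by (simp add: is_cycle_def l_def)
  next
    case False
    then have i: "i = l - 1" "Suc i = l" using that by auto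
    have "p \<noteq> []" using l by (auto simp: l_def)
    then have "last p = p ! i" "hd p = p ! 0" using i by (auto simp: l_def last_conv_nth hd_conv_nth)
    then show ?thesis using cyc i by (simp add: is_cycle_def)
  qed
  \<comment> \<open>A maximum of \<open>rank\<close>, obtained as a minimum of its negation.\<close>
  obtain i where i: "i < l" "\<And>j. j < l \<Longrightarrow> rank (p ! j) \<le> rank (p ! i)"
  proof -
    have "{..<l} \<noteq> {}" using l by (auto simp: lessThan_empty_iff)
    with arg_min_if_finite(1)[of "{..<l}" "\<lambda>j. - int (rank (p ! j))"]
      arg_min_if_finite(2)[of "{..<l}" "\<lambda>j. - int (rank (p ! j))"] that
    show ?thesis by (metis finite_lessThan lessThan_iff linorder_not_less neg_less_iff_less of_nat_less_iff)
  qed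
  have nb: "x = par (p ! i)" if e: "{p ! i, x} \<in> edges" and x: "x = p ! j" "j < l" for x j
  proof -
    obtain v where v: "v \<in> V" "v \<noteq> root" "{p ! i, x} = {v, par v}" using e by (auto simp: edges_def)
    then show ?thesis using rank_par[of v] i(2)[OF x(2)] x(1) by (auto simp: doubleton_eq_iff)
  qed
  define j where "j = (if i = 0 then l - 1 else i - 1)"
  have j: "j < l" "Suc j mod l = i" using i l by (auto simp: j_def)
  have "p ! (Suc i mod l) = par (p ! i)" using nb[OF adj[OF i(1)]] l by simp
  moreover have "p ! j = par (p ! i)" using nb[of "p ! j" j] adj[OF j(1)] j by (simp add: insert_commute)
  ultimately have "Suc i mod l = j"
    using dp j l by (simp add: l_def distinct_conv_nth) (metis mod_less_divisor less_le_trans zero_less_numeral)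
  then show False using l i(1) by (auto simp: j_def mod_Suc split: if_splits)
qed

lemma edges_spanning:
  assumes "edges \<subseteq> E"
  shows "spanning_tree V E edges"
  using assms no_cycle root component_edges unfolding spanning_tree_def connected_graph_def by blast

end

text \<open>A breadth-first tree: \<open>rank\<close> is the distance from \<open>root\<close>, and
  the predecessor on a shortest path is closer.\<close>

lemma connected_imp_parents:
  fixes root :: 'a
  assumes "finite V" "root \<in> V" "connected_graph V F" "\<And>x y. {x, y} \<in> F \<Longrightarrow> x \<in> V"
  obtains par rank where "rooted_tree V root par rank"
    "\<And>v. v \<in> V \<Longrightarrow> v \<noteq> root \<Longrightarrow> {v, par v} \<in> F"
proof -
  define R where "R = {(a, b). {a, b} \<in> F}"
  define rank where "rank v = (LEAST k. (root, v) \<in> R ^^ k)" for v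
  have ex: "\<exists>u. {v, u} \<in> F \<and> rank u < rank v" if v: "v \<in> V" "v \<noteq> root" for v
  proof -
    have "(root, v) \<in> R\<^sup>*" using assms v by (auto simp: connected_graph_def component_def R_def)
    then have *: "(root, v) \<in> R ^^ rank v" unfolding rank_def by (metis LeastI rtrancl_power)
    then obtain k where k: "rank v = Suc k" using v(2) by (cases "rank v") auto
    then obtain u where u: "(root, u) \<in> R ^^ k" "(u, v) \<in> R" using * by auto
    have "rank u \<le> k" unfolding rank_def using u(1) by (rule Least_le)
    then show ?thesis using u k by (auto simp: R_def insert_commute)
  qed
  define par where "par v = (SOME u. {v, u} \<in> F \<and> rank u < rank v)" for v
  have par: "{v, par v} \<in> F \<and> rank (par v) < rank v" if v: "v \<in> V" "v \<noteq> root" for v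
    unfolding par_def using ex[OF v] by (rule someI_ex)
  show ?thesis
  proof (rule that)
    show "rooted_tree V root par rank"
    proof
      fix v assume v: "v \<in> V" "v \<noteq> root"
      show "par v \<in> V" using par[OF v] assms(4)[of "par v" v] by (simp add: insert_commute)
    qed (use par assms in auto)
  qed (use par in auto)
qed

text \<open>Breadth-first parents within \<open>T\<close> form a spanning tree contained in
  \<open>T\<close>. A further edge of \<open>T\<close> would close a cycle with the tree path
  between its ends.\<close>

lemma spanning_tree_rooted:
  fixes root :: 'a
  assumes "simple_graph V E" "spanning_tree V E T" "root \<in> V"
  obtains par rank where "rooted_tree V root par rank" "T = rooted_tree.edges V root par"
proof -
  have V: "finite V" and TE: "T \<subseteq> E" and T: "connected_graph V T" "\<And>p. \<not> is_cycle T p"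
    using assms by (auto simp: simple_graph_def spanning_tree_def)
  have E: "x \<in> V" if "{x, y} \<in> T" for x y
  proof -
    have "\<forall>e\<in>E. \<exists>a b. a \<in> V \<and> b \<in> V \<and> a \<noteq> b \<and> e = {a, b}"
      using assms(1) by (simp add: simple_graph_def)
    from bspec[OF this subsetD[OF TE that]]
    obtain a b where "a \<in> V" "b \<in> V" "{x, y} = {a, b}" by (elim exE conjE)
    then show ?thesis by (auto simp: doubleton_eq_iff)
  qed
  obtain par rank where pr: "rooted_tree V root par rank"
    "\<And>v. v \<in> V \<Longrightarrow> v \<noteq> root \<Longrightarrow> {v, par v} \<in> T"
  proof (rule connected_imp_parents[OF V assms(3) T(1)])
    show "x \<in> V" if "{x, y} \<in> T" for x y using E that .
  qed (rule that)
  interpret rooted_tree V root par rank by (rule pr(1))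
  have sub: "edges \<subseteq> T" using pr(2) by (auto simp: edges_def)
  have "T \<subseteq> edges"
  proof (rule ccontr)
    assume "\<not> T \<subseteq> edges"
    then obtain e where e: "e \<in> T" "e \<notin> edges" by blast
    obtain x y where xy: "e = {x, y}" "x \<in> V" "y \<in> V" "x \<noteq> y"
      using e(1) assms(1,2) unfolding simple_graph_def spanning_tree_def by blast
    have "y \<in> component edges x"
      using component_edges xy by blast
    then have "(x, y) \<in> {(a, b). {a, b} \<in> edges}\<^sup>*" by (simp add: component_def)
    from exists_distinct_path[OF this] obtain p where p: "p \<noteq> []" "hd p = x" "last p = y" "distinct p"
      "\<And>i. Suc i < length p \<Longrightarrow> {p ! i, p ! Suc i} \<in> edges" by blast
    have "length p \<noteq> 1" using p xy(4) by (cases p) auto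
    moreover have "length p \<noteq> 2"
    proof
      assume "length p = 2"
      then have "{x, y} \<in> edges" using p(5)[of 0] p by (auto simp: hd_conv_nth last_conv_nth)
      then show False using e xy by simp
    qed
    moreover have "length p \<noteq> 0" using p by simp
    ultimately have "length p \<ge> 3" by linarith
    then have "is_cycle T p" using p sub e xy by (auto simp: is_cycle_def insert_commute)
    then show False using T(2) by blast
  qed
  with sub have "T = edges" by blast
  then show ?thesis using that pr(1) by blast
qed

section \<open>Token flow\<close>

text \<open>The old value stands on the left, which avoids subtraction and so serves for natural
  numbers.\<close>

lemma sum_upd:
  fixes f :: "'a \<Rightarrow> 'b::comm_monoid_add"
  assumes "finite A" "a \<in> A"
  shows "sum (f(a := x)) A + f a = sum f A + x"
  using assms by (simp add: sum.remove[of A a] ac_simps)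

lemma sum_move_token:
  fixes e g :: "nat \<Rightarrow> nat"
  assumes "w < n" "u < n" "u \<noteq> w" "e w > 0"
  shows "(\<Sum>v<n. ((e(w := e w - 1))(u := e u + 1)) v * g v) + g w = (\<Sum>v<n. e v * g v) + g u"
proof -
  let ?f = "(\<lambda>v. e v * g v)(w := (e w - 1) * g w)"
  have *: "(\<lambda>v. ((e(w := e w - 1))(u := e u + 1)) v * g v) = ?f(u := (e u + 1) * g u)"
    using assms by (auto simp: fun_eq_iff)
  have "(\<Sum>v<n. ((e(w := e w - 1))(u := e u + 1)) v * g v) + ?f u = sum ?f {..<n} + (e u + 1) * g u"
    unfolding * by (rule sum_upd) (use assms in auto)
  moreover have "sum ?f {..<n} + e w * g w = (\<Sum>v<n. e v * g v) + (e w - 1) * g w"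
    by (rule sum_upd) (use assms in auto)
  moreover have "?f u = e u * g u" using assms by simp
  moreover have "e w * g w = (e w - 1) * g w + g w" using assms(4) by (cases "e w") auto
  ultimately show ?thesis by (simp only: distrib_right mult_1)
qed

text \<open>Connectivity enters as a tree of arcs towards the source; heights are bounded by adding
  up their differences along its paths.\<close>

locale token_flow =
  fixes n :: nat and src :: nat and adj :: "nat \<Rightarrow> nat \<Rightarrow> bool" and c :: "nat \<Rightarrow> nat"
  assumes src: "src < n" and c_src: "c src = 0"
    and ex_tree: "\<exists>par rank. rooted_tree {..<n} src par rank \<and>
      (\<forall>v<n. v \<noteq> src \<longrightarrow> adj v (par v))"
begin

definition N :: nat where "N = (\<Sum>v<n. c v)"

definition inflow :: "(nat \<Rightarrow> nat) \<Rightarrow> (nat \<Rightarrow> nat \<Rightarrow> nat) \<Rightarrow> nat \<Rightarrow> nat" where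
  "inflow F b v = (\<Sum>w<n. \<Sum>k<F w. of_bool (b w k = v))"

text \<open>The demands are tokens that travel to the source. At vertex \<open>w\<close> there are \<open>e w\<close>
  waiting tokens, and \<open>F w\<close> tokens have been forwarded, the \<open>k\<close>-th one to the neighbour
  \<open>b w k\<close>. The heights \<open>h\<close> are dual variables for the convex program of minimizing
  \<open>\<Sum>w. (F w)\<^sup>2\<close>: forwarding the \<open>k\<close>-th token costs about \<open>k\<close>.\<close>

definition flow_inv ::
  "(nat \<Rightarrow> nat) \<Rightarrow> (nat \<Rightarrow> nat) \<Rightarrow> (nat \<Rightarrow> nat) \<Rightarrow> (nat \<Rightarrow> nat \<Rightarrow> nat) \<Rightarrow> bool" where
  "flow_inv h e F b \<longleftrightarrow> h src = 0 \<and> F src = 0 \<and>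
     (\<forall>w<n. \<forall>k<F w. b w k < n \<and> adj w (b w k) \<and> h (b w k) + k + 1 \<le> h w) \<and>
     (\<forall>v<n. v \<noteq> src \<longrightarrow> F v + e v = c v + inflow F b v) \<and>
     (\<Sum>v<n. e v) = N \<and>
     (\<forall>w<n. \<forall>u<n. w \<noteq> src \<longrightarrow> adj w u \<longrightarrow> h w \<le> h u + F w + e w + 2)"

lemma flow_invD:
  assumes "flow_inv h e F b"
  shows "h src = 0" "F src = 0"
    "\<And>w k. w < n \<Longrightarrow> k < F w \<Longrightarrow> b w k < n"
    "\<And>w k. w < n \<Longrightarrow> k < F w \<Longrightarrow> adj w (b w k)"
    "\<And>w k. w < n \<Longrightarrow> k < F w \<Longrightarrow> h (b w k) + k + 1 \<le> h w"
    "\<And>v. v < n \<Longrightarrow> v \<noteq> src \<Longrightarrow> F v + e v = c v + inflow F b v"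
    "(\<Sum>v<n. e v) = N"
    "\<And>w u. w < n \<Longrightarrow> u < n \<Longrightarrow> w \<noteq> src \<Longrightarrow> adj w u \<Longrightarrow> h w \<le> h u + F w + e w + 2"
  using assms unfolding flow_inv_def by auto

lemma inflow_total:
  assumes "flow_inv h e F b"
  shows "(\<Sum>v<n. inflow F b v * g v) = (\<Sum>w<n. \<Sum>k<F w. g (b w k))"
proof -
  have "(\<Sum>v<n. inflow F b v * g v) = (\<Sum>v<n. \<Sum>w<n. \<Sum>k<F w. of_bool (b w k = v) * g v)"
    by (simp add: inflow_def sum_distrib_right)
  also have "\<dots> = (\<Sum>w<n. \<Sum>v<n. \<Sum>k<F w. of_bool (b w k = v) * g v)"
    by (rule sum.swap)
  also have "\<dots> = (\<Sum>w<n. \<Sum>k<F w. \<Sum>v<n. of_bool (b w k = v) * g v)"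
    by (intro sum.cong refl sum.swap)
  also have "\<dots> = (\<Sum>w<n. \<Sum>k<F w. g (b w k))"
  proof (intro sum.cong refl)
    fix w k assume "w \<in> {..<n}" "k \<in> {..<F w}"
    then have "b w k < n" using flow_invD(3)[OF assms] by auto
    have "(\<Sum>v<n. of_bool (b w k = v) * g v) = (\<Sum>v<n. if v = b w k then g v else 0)"
      by (intro sum.cong) auto
    then show "(\<Sum>v<n. of_bool (b w k = v) * g v) = g (b w k)"
      using \<open>b w k < n\<close> by (simp add: sum.delta')
  qed
  finally show ?thesis .
qed

text \<open>Consider the vertices at least as high as \<open>w\<close>: tokens entering this set come from within,
  and those forwarded by \<open>w\<close> leave it.\<close>

lemma throughput_le:
  assumes inv: "flow_inv h e F b" and w: "w < n" "w \<noteq> src"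
  shows "F w + e w \<le> N"
proof -
  define S where "S = {v. v < n \<and> v \<noteq> src \<and> h v \<ge> h w}"
  have fin: "finite S" and S: "S \<subseteq> {..<n}" and wS: "w \<in> S" using w by (auto simp: S_def)
  have "(\<Sum>v\<in>S. inflow F b v) = (\<Sum>v<n. inflow F b v * of_bool (v \<in> S))"
    using S by (simp add: sum.If_cases of_bool_def if_distrib Int_absorb1 cong: if_cong)
  also have "\<dots> = (\<Sum>x<n. \<Sum>k<F x. of_bool (b x k \<in> S))"
    by (rule inflow_total[OF inv])
  also have "\<dots> \<le> (\<Sum>x<n. if x \<in> S - {w} then F x else 0)"
  proof (rule sum_mono)
    fix x assume x: "x \<in> {..<n}"
    show "(\<Sum>k<F x. of_bool (b x k \<in> S)) \<le> (if x \<in> S - {w} then F x else 0)"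
    proof (cases "x \<in> S - {w}")
      case True
      have "(\<Sum>k<F x. of_bool (b x k \<in> S)) \<le> (\<Sum>k<F x. 1 :: nat)" by (rule sum_mono) auto
      then show ?thesis using True by simp
    next
      case False
      have "b x k \<notin> S" if "k < F x" for k
        using flow_invD(5)[OF inv, of x k] flow_invD(2)[OF inv] x that False
        by (cases "x = src") (auto simp: S_def)
      then show ?thesis using False by simp
    qed
  qed
  also have "\<dots> = (\<Sum>x\<in>S - {w}. F x)"
    using S by (subst sum.inter_restrict[symmetric]) (auto intro: sum.cong)
  finally have "(\<Sum>v\<in>S. inflow F b v) \<le> (\<Sum>x\<in>S - {w}. F x)" .
  moreover have "(\<Sum>v\<in>S. F v + e v) = (\<Sum>v\<in>S. c v) + (\<Sum>v\<in>S. inflow F b v)"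
    unfolding sum.distrib[symmetric] using flow_invD(6)[OF inv] by (intro sum.cong) (auto simp: S_def)
  moreover have "(\<Sum>v\<in>S. c v) \<le> N" unfolding N_def using S by (intro sum_mono2) auto
  moreover have "(\<Sum>v\<in>S. F v + e v) = F w + e w + (\<Sum>x\<in>S - {w}. F x) + (\<Sum>x\<in>S - {w}. e x)"
    using sum.remove[OF fin wS, of "\<lambda>v. F v + e v"] by (simp add: sum.distrib)
  ultimately show ?thesis by linarith
qed

definition hmax :: nat where "hmax = n * (N + 2)"

text \<open>Along an arc of the given tree the height drops by at most \<open>F + e + 2\<close>,
  which is at most \<open>N + 2\<close> by \<open>throughput_le\<close>; a path has at most
  \<open>n\<close> arcs.\<close>

lemma height_le:
  assumes inv: "flow_inv h e F b" and v: "v < n"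
  shows "h v \<le> hmax"
proof -
  obtain par rank where rt: "rooted_tree {..<n} src par rank"
    and adj: "\<And>v. v < n \<Longrightarrow> v \<noteq> src \<Longrightarrow> adj v (par v)" using ex_tree by blast
  interpret rooted_tree "{..<n}" src par rank by (rule rt)
  have "real (h v) = (\<Sum>a\<in>anc v. real (h a) - real (h (par a)))"
    using telescope_anc[of v "\<lambda>v. real (h v)"] v flow_invD(1)[OF inv] by simp
  also have "\<dots> \<le> (\<Sum>a\<in>anc v. real (N + 2))"
  proof (rule sum_mono)
    fix a assume "a \<in> anc v"
    then have a: "a < n" "a \<noteq> src" using anc_subset[of v] v by auto
    have "h a \<le> h (par a) + F a + e a + 2"
      using flow_invD(8)[OF inv a(1) _ a(2) adj[OF a]] par_in a by auto
    then show "real (h a) - real (h (par a)) \<le> real (N + 2)"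
      using throughput_le[OF inv a] by linarith
  qed
  also have "\<dots> = real (card (anc v) * (N + 2))" by (simp add: algebra_simps)
  also have "\<dots> \<le> real hmax"
    unfolding hmax_def of_nat_le_iff
    using card_mono[of "{..<n}" "anc v"] anc_subset[of v] v by (intro mult_right_mono) auto
  finally show ?thesis by simp
qed

text \<open>The weights make both token moves profitable. A push from \<open>w\<close> lowers the
  first summand by at least \<open>2 * (F w + 2)\<close> and raises the second by
  \<open>2 * F w + 3\<close>. Taking back slot \<open>y\<close> of \<open>x\<close> raises the first
  by \<open>2 * (y + 1) \<le> 2 * F x\<close> and lowers the second by
  \<open>2 * F x + 1\<close>.\<close>

definition energy :: "(nat \<Rightarrow> nat) \<Rightarrow> (nat \<Rightarrow> nat) \<Rightarrow> (nat \<Rightarrow> nat) \<Rightarrow> nat" where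
  "energy h e F = 2 * (\<Sum>v<n. e v * h v) + (\<Sum>v<n. F v * F v + 2 * F v)"

text \<open>Raising \<open>w\<close> by one costs the energy \<open>2 * e w \<le> 2 * N\<close>, so
  a unit of height is weighted with \<open>2 * N + 1\<close>. Heights never fall, and
  \<open>hmax\<close> bounds them.\<close>

definition progress :: "(nat \<Rightarrow> nat) \<Rightarrow> (nat \<Rightarrow> nat) \<Rightarrow> (nat \<Rightarrow> nat) \<Rightarrow> nat" where
  "progress h e F = (2 * N + 1) * (n * hmax - (\<Sum>v<n. h v)) + energy h e F"

lemma inflow_cong:
  assumes "\<And>w k. w < n \<Longrightarrow> k < F w \<Longrightarrow> b' w k = b w k"
  shows "inflow F b' = inflow F b"
  unfolding inflow_def using assms by (intro ext sum.cong) auto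

lemma flow_inv_cong:
  assumes "flow_inv h e F b" "\<And>w k. w < n \<Longrightarrow> k < F w \<Longrightarrow> b' w k = b w k"
  shows "flow_inv h e F b'"
  using assms inflow_cong[of F b' b] unfolding flow_inv_def by simp

text \<open>The guard leaves one unit more than the invariant demands of slot \<open>F w\<close>.
  Without this slack the energy could grow by one.\<close>

lemma push_step:
  assumes inv: "flow_inv h e F b" and w: "w < n" "w \<noteq> src" "e w > 0"
    and u: "u < n" "adj w u" "h u + F w + 2 \<le> h w"
    and b': "b' = (\<lambda>x k. if x = w \<and> k = F w then u else b x k)"
    and F': "F' = F(w := F w + 1)" and e': "e' = (e(w := e w - 1))(u := e u + 1)"
  shows "flow_inv h e' F' b'" "progress h e' F' < progress h e F"
proof -
  have uw: "u \<noteq> w" using u by auto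
  have infl: "inflow F' b' v = inflow F b v + of_bool (v = u)" for v
  proof -
    have "(\<Sum>k<F' x. of_bool (b' x k = v)) =
      (\<Sum>k<F x. of_bool (b x k = v)) + (if x = w then of_bool (v = u) else 0 :: nat)" for x
      unfolding F' b' by (cases "x = w") auto
    then show ?thesis unfolding inflow_def by (simp add: sum.distrib w(1))
  qed
  have sume: "(\<Sum>v<n. e' v * g v) + g w = (\<Sum>v<n. e v * g v) + g u" for g :: "nat \<Rightarrow> nat"
    unfolding e' by (rule sum_move_token) (use w u uw in auto)
  have ew: "e' w + 1 = e w" "e' u = e u + 1" "\<And>v. v \<noteq> w \<Longrightarrow> v \<noteq> u \<Longrightarrow> e' v = e v"
    using w uw by (auto simp: e')
  show "flow_inv h e' F' b'"
    unfolding flow_inv_def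
  proof (intro conjI allI impI)
    show "h src = 0" "F' src = 0" using flow_invD(1,2)[OF inv] w by (auto simp: F')
    fix x k assume "x < n" "k < F' x"
    then show "b' x k < n" "adj x (b' x k)" "h (b' x k) + k + 1 \<le> h x"
      using flow_invD(3-5)[OF inv, of x k] u by (auto simp: F' b' split: if_splits)
  next
    fix v assume v: "v < n" "v \<noteq> src"
    show "F' v + e' v = c v + inflow F' b' v"
      using flow_invD(6)[OF inv v] w uw unfolding infl by (auto simp: F' e')
  next
    show "(\<Sum>v<n. e' v) = N" using sume[of "\<lambda>_. 1"] flow_invD(7)[OF inv] by simp
  next
    fix x y assume "x < n" "y < n" "x \<noteq> src" "adj x y"
    then have "h x \<le> h y + F x + e x + 2" using flow_invD(8)[OF inv] by blast
    moreover have "F x + e x \<le> F' x + e' x"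
      using ew(1,2) ew(3)[of x] uw by (cases "x = u") (auto simp: F')
    ultimately show "h x \<le> h y + F' x + e' x + 2" by simp
  qed
  have "(\<lambda>v. F' v * F' v + 2 * F' v) = (\<lambda>v. F v * F v + 2 * F v)(w := (F w + 1) * (F w + 1) + 2 * (F w + 1))"
    by (auto simp: F' fun_eq_iff)
  then have "(\<Sum>v<n. F' v * F' v + 2 * F' v) + (F w * F w + 2 * F w) =
      (\<Sum>v<n. F v * F v + 2 * F v) + ((F w + 1) * (F w + 1) + 2 * (F w + 1))"
    using sum_upd[of "{..<n}" w "\<lambda>v. F v * F v + 2 * F v" "(F w + 1) * (F w + 1) + 2 * (F w + 1)"] w(1)
    by (metis finite_lessThan lessThan_iff)
  then have "(\<Sum>v<n. F' v * F' v + 2 * F' v) = (\<Sum>v<n. F v * F v + 2 * F v) + (2 * F w + 3)"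
    by (simp add: algebra_simps)
  then show "progress h e' F' < progress h e F"
    using sume[of h] u(3) unfolding progress_def energy_def by simp
qed

text \<open>A tight slot into \<open>w\<close> blocks raising \<open>w\<close>, so its token is
  recalled by the sender \<open>x\<close>. The gap is filled with the last slot of \<open>x\<close>,
  whose condition only weakens at a smaller index.\<close>

lemma return_step:
  assumes inv: "flow_inv h e F b" and w: "w < n" "w \<noteq> src" "e w > 0"
    and stuck: "\<And>u. u < n \<Longrightarrow> adj w u \<Longrightarrow> h w \<le> h u + F w + 1"
    and x: "x < n" "y < F x" "b x y = w" "h x = h w + y + 1"
    and b': "b' = (\<lambda>v k. if v = x \<and> k = y then b x (F x - 1) else b v k)"
    and F': "F' = F(x := F x - 1)" and e': "e' = (e(x := e x + 1))(w := e w - 1)"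
  shows "flow_inv h e' F' b'" "progress h e' F' < progress h e F"
proof -
  have xw: "x \<noteq> w" and xs: "x \<noteq> src" using x flow_invD(2)[OF inv] by auto
  obtain f where f: "F x = Suc f" using x by (cases "F x") auto
  have infl: "inflow F' b' v + of_bool (v = w) = inflow F b v" for v
  proof -
    have "(\<Sum>k<F' z. of_bool (b' z k = v)) + (if z = x then of_bool (v = w) else 0) =
      (\<Sum>k<F z. of_bool (b z k = v) :: nat)" for z
    proof (cases "z = x")
      case True
      show ?thesis
      proof (cases "y = f")
        case True
        then show ?thesis using \<open>z = x\<close> x f by (auto simp: F' b' intro!: sum.cong)
      next
        case False
        then have y: "y < f" using x f by simp
        have *: "(\<lambda>k. of_bool (b' x k = v) :: nat) = (\<lambda>k. of_bool (b x k = v))(y := of_bool (b x f = v))"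
          using f by (auto simp: b' fun_eq_iff)
        have "(\<Sum>k<f. of_bool (b' x k = v)) + of_bool (b x y = v)
          = (\<Sum>k<f. of_bool (b x k = v)) + (of_bool (b x f = v) :: nat)"
          unfolding * by (rule sum_upd) (use y in auto)
        then show ?thesis using \<open>z = x\<close> x f by (simp add: F' eq_commute)
      qed
    qed (auto simp: F' b' intro!: sum.cong)
    then have "(\<Sum>z<n. (\<Sum>k<F' z. of_bool (b' z k = v)) + (if z = x then of_bool (v = w) else 0)) = inflow F b v"
      unfolding inflow_def by simp
    then show ?thesis unfolding inflow_def by (simp add: sum.distrib x(1))
  qed
  have e'': "e' = (e(w := e w - 1))(x := e x + 1)" using xw by (auto simp: e')
  have sume: "(\<Sum>v<n. e' v * g v) + g w = (\<Sum>v<n. e v * g v) + g x" for g :: "nat \<Rightarrow> nat"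
    unfolding e'' by (rule sum_move_token) (use w x xw in auto)
  have ew: "e' w + 1 = e w" "e' x = e x + 1" "\<And>v. v \<noteq> w \<Longrightarrow> v \<noteq> x \<Longrightarrow> e' v = e v"
    using w xw by (auto simp: e')
  show "flow_inv h e' F' b'"
    unfolding flow_inv_def
  proof (intro conjI allI impI)
    show "h src = 0" "F' src = 0" using flow_invD(1,2)[OF inv] by (auto simp: F')
    fix z k assume z: "z < n" "k < F' z"
    show "b' z k < n" "adj z (b' z k)" "h (b' z k) + k + 1 \<le> h z"
      using flow_invD(3-5)[OF inv z(1), of k] flow_invD(3-5)[OF inv x(1), of f] z f
      by (auto simp: F' b' split: if_splits)
  next
    fix v assume v: "v < n" "v \<noteq> src"
    show "F' v + e' v = c v + inflow F' b' v"
      using flow_invD(6)[OF inv v] infl[of v] w xw f by (auto simp: F' e')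
  next
    show "(\<Sum>v<n. e' v) = N" using sume[of "\<lambda>_. 1"] flow_invD(7)[OF inv] by simp
  next
    fix z u assume z: "z < n" "u < n" "z \<noteq> src" "adj z u"
    show "h z \<le> h u + F' z + e' z + 2"
    \<comment> \<open>\<open>F + e\<close> decreases only at \<open>w\<close>, and there
      \<open>stuck\<close> is stronger than the required bound.\<close>
    proof (cases "z = w")
      case True
      then show ?thesis using stuck[of u] z xw by (simp add: F')
    next
      case False
      have "F' z + e' z = F z + e z" using False f by (auto simp: F' e')
      then show ?thesis using flow_invD(8)[OF inv z(1,2,3,4)] by simp
    qed
  qed
  have "(\<lambda>v. F' v * F' v + 2 * F' v) = (\<lambda>v. F v * F v + 2 * F v)(x := f * f + 2 * f)"
    using f by (auto simp: F' fun_eq_iff)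
  then have "(\<Sum>v<n. F' v * F' v + 2 * F' v) + (F x * F x + 2 * F x) =
      (\<Sum>v<n. F v * F v + 2 * F v) + (f * f + 2 * f)"
    using sum_upd[of "{..<n}" x "\<lambda>v. F v * F v + 2 * F v" "f * f + 2 * f"] x(1)
    by (metis finite_lessThan lessThan_iff)
  then have "(\<Sum>v<n. F' v * F' v + 2 * F' v) + (2 * f + 3) = (\<Sum>v<n. F v * F v + 2 * F v)"
    by (simp add: algebra_simps f)
  then show "progress h e' F' < progress h e F"
    using sume[of h] x f unfolding progress_def energy_def by simp
qed

text \<open>\<open>stuck\<close> provides the unit that the upper bound on the height of
  \<open>w\<close> loses, and in the absence of tight slots the senders to \<open>w\<close> remain
  high enough.\<close>

lemma raise_step:
  assumes inv: "flow_inv h e F b" and w: "w < n" "w \<noteq> src" "e w > 0"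
    and stuck: "\<And>u. u < n \<Longrightarrow> adj w u \<Longrightarrow> h w \<le> h u + F w + 1"
    and no_return: "\<And>x y. x < n \<Longrightarrow> y < F x \<Longrightarrow> b x y = w \<Longrightarrow> h x \<noteq> h w + y + 1"
    and h': "h' = h(w := h w + 1)"
  shows "flow_inv h' e F b" "progress h' e F < progress h e F"
proof -
  show inv': "flow_inv h' e F b"
    unfolding flow_inv_def
  proof (intro conjI allI impI)
    show "h' src = 0" "F src = 0" using flow_invD(1,2)[OF inv] w by (auto simp: h')
    fix z k assume z: "z < n" "k < F z"
    show "b z k < n" "adj z (b z k)" using flow_invD(3,4)[OF inv z] by auto
    show "h' (b z k) + k + 1 \<le> h' z"
      using flow_invD(5)[OF inv z] no_return[OF z] by (auto simp: h')
  next
    fix z u assume z: "z < n" "u < n" "z \<noteq> src" "adj z u"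
    have hu: "h u \<le> h' u" by (simp add: h')
    show "h' z \<le> h' u + F z + e z + 2"
    proof (cases "z = w")
      case True
      then show ?thesis using stuck[of u] z hu by (simp add: h')
    next
      case False
      then show ?thesis using flow_invD(8)[OF inv z(1,2,3,4)] hu by (simp add: h')
    qed
  qed (use flow_invD(6,7)[OF inv] in auto)
  \<comment> \<open>Bounding the raised heights excludes that the truncated difference in
    \<open>progress\<close> was already \<open>0\<close>.\<close>
  have "(\<Sum>v<n. h' v) \<le> n * hmax"
    using sum_bounded_above[of "{..<n}" h' hmax] height_le[OF inv'] by simp
  moreover have sh: "(\<Sum>v<n. h' v) = (\<Sum>v<n. h v) + 1"
    unfolding h' using sum_upd[of "{..<n}" w h "h w + 1"] w by simp
  ultimately obtain r where r: "n * hmax - (\<Sum>v<n. h v) = Suc r" "n * hmax - (\<Sum>v<n. h' v) = r"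
    by (cases "n * hmax - (\<Sum>v<n. h v)") auto
  have *: "(\<lambda>v. e v * h' v) = (\<lambda>v. e v * h v)(w := e w * (h w + 1))" by (auto simp: h')
  have "(\<Sum>v<n. e v * h' v) + e w * h w = (\<Sum>v<n. e v * h v) + e w * (h w + 1)"
    unfolding * by (rule sum_upd) (use w in auto)
  then have "(\<Sum>v<n. e v * h' v) = (\<Sum>v<n. e v * h v) + e w" by simp
  moreover have "e w \<le> N" using throughput_le[OF inv w(1,2)] by simp
  ultimately show "progress h' e F < progress h e F"
    unfolding progress_def energy_def r by simp
qed

lemma flow_inv_init:
  assumes "\<And>v. v < n \<Longrightarrow> e v = c v"
  shows "flow_inv (\<lambda>_. 0) e (\<lambda>_. 0) b"
  using assms by (auto simp: flow_inv_def inflow_def N_def intro!: sum.cong)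

lemma progress_bound:
  assumes inv: "flow_inv h e F b"
  shows "progress h e F \<le> (2 * N + 1) * (n * hmax) + 2 * (N * hmax) + n * (N * N + 2 * N)"
proof -
  have "(\<Sum>v<n. e v * h v) \<le> (\<Sum>v<n. e v * hmax)"
    using height_le[OF inv] by (intro sum_mono mult_left_mono) auto
  also have "\<dots> = N * hmax" using flow_invD(7)[OF inv] by (simp add: sum_distrib_right[symmetric])
  finally have 1: "(\<Sum>v<n. e v * h v) \<le> N * hmax" .
  have F: "F v \<le> N" if "v < n" for v
    using throughput_le[OF inv that] flow_invD(2)[OF inv] by (cases "v = src") auto
  have 2: "(\<Sum>v<n. F v * F v + 2 * F v) \<le> n * (N * N + 2 * N)"
    using sum_bounded_above[of "{..<n}" "\<lambda>v. F v * F v + 2 * F v" "N * N + 2 * N"] F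
    by (auto intro!: add_mono mult_mono)
  have "(2 * N + 1) * (n * hmax - (\<Sum>v<n. h v)) \<le> (2 * N + 1) * (n * hmax)"
    by (intro mult_left_mono) auto
  then show ?thesis using 1 2 unfolding progress_def energy_def by linarith
qed

text \<open>Weak duality: \<open>\<Sum>v. c v * h v\<close> is evaluated along the slots of the flow
  and along the paths of an arbitrary tree. Per vertex, the former gives at least
  \<open>F\<^sup>2 / 2\<close> and the latter at most \<open>load * (F + 2)\<close>.\<close>

lemma final_energy:
  assumes inv: "flow_inv h e F b" and e: "\<And>v. v < n \<Longrightarrow> v \<noteq> src \<Longrightarrow> e v = 0"
    and rt: "rooted_tree {..<n} src par rk"
    and adj: "\<And>v. v < n \<Longrightarrow> v \<noteq> src \<Longrightarrow> adj v (par v)"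
  shows "(\<Sum>w<n. (real (F w))\<^sup>2) \<le>
    12 * (\<Sum>w\<in>{..<n} - {src}. (rooted_tree.load {..<n} src par (\<lambda>v. real (c v)) w)\<^sup>2)"
proof -
  interpret rooted_tree "{..<n}" src par rk by (rule rt)
  let ?ld = "load (\<lambda>v. real (c v))"
  have conserve: "real (F v) * real (h v) = real (c v) * real (h v) + real (inflow F b v * h v)"
    if "v < n" for v
  proof (cases "v = src")
    case True
    then show ?thesis using flow_invD(1)[OF inv] by simp
  next
    case False
    then have "F v = c v + inflow F b v" using flow_invD(6)[OF inv that] e that by simp
    then show ?thesis by (simp add: algebra_simps)
  qed
  have dual: "(\<Sum>v<n. real (c v) * real (h v)) = (\<Sum>w<n. \<Sum>k<F w. real (h w) - real (h (b w k)))"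
  proof -
    have "(\<Sum>v<n. real (F v) * real (h v)) = (\<Sum>v<n. real (c v) * real (h v)) + real (\<Sum>v<n. inflow F b v * h v)"
      using conserve by (simp add: sum.distrib)
    also have "(\<Sum>v<n. inflow F b v * h v) = (\<Sum>w<n. \<Sum>k<F w. h (b w k))"
      by (rule inflow_total[OF inv])
    finally show ?thesis by (simp add: sum_subtractf)
  qed
  \<comment> \<open>Slot \<open>k\<close> descends by at least \<open>k + 1\<close>, and these
    numbers add up to at least half a square.\<close>
  have "(\<Sum>w<n. (real (F w))\<^sup>2 / 2) \<le> (\<Sum>w<n. \<Sum>k<F w. real (h w) - real (h (b w k)))"
  proof (rule sum_mono)
    fix w assume "w \<in> {..<n}"
    then have w: "w < n" by simp
    have "(real m)\<^sup>2 / 2 \<le> (\<Sum>k<m. real k + 1)" for m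
      by (induction m) (auto simp: power2_eq_square algebra_simps)
    also have "(\<Sum>k<F w. real k + 1) \<le> (\<Sum>k<F w. real (h w) - real (h (b w k)))"
      using flow_invD(5)[OF inv w] by (intro sum_mono) fastforce
    finally show "(real (F w))\<^sup>2 / 2 \<le> (\<Sum>k<F w. real (h w) - real (h (b w k)))" .
  qed
  also have "\<dots> = (\<Sum>v<n. real (c v) * (\<Sum>a\<in>anc v. real (h a) - real (h (par a))))"
    unfolding dual[symmetric] using telescope_anc[of _ "\<lambda>v. real (h v)"] flow_invD(1)[OF inv]
    by (intro sum.cong) auto
  also have "\<dots> = (\<Sum>w\<in>{..<n} - {src}. ?ld w * (real (h w) - real (h (par w))))"
    by (rule sum_anc_swap)
  also have "\<dots> \<le> (\<Sum>w\<in>{..<n} - {src}. (real (F w))\<^sup>2 / 4 + 3 * (?ld w)\<^sup>2)"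
  proof (rule sum_mono)
    fix w assume "w \<in> {..<n} - {src}"
    then have w: "w < n" "w \<noteq> src" by auto
    have ld: "?ld w = real (\<Sum>v\<in>sub w. c v)" by (simp add: load_def)
    have "h w \<le> h (par w) + F w + 2"
      using flow_invD(8)[OF inv w(1) _ w(2) adj[OF w]] e[OF w] par_in w by auto
    then have "real (h w) - real (h (par w)) \<le> real (F w) + 2" by linarith
    then have 1: "?ld w * (real (h w) - real (h (par w))) \<le> ?ld w * (real (F w) + 2)"
      by (intro mult_left_mono) (simp_all only: ld of_nat_0_le_iff)
    \<comment> \<open>The weight \<open>1 / 4\<close> is half of the \<open>1 / 2\<close> on the
      other side. Subtracting it leaves \<open>F\<^sup>2 / 4\<close> against
      \<open>3 * load\<^sup>2\<close>, which is the factor \<open>12\<close>.\<close>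
    have 2: "?ld w * (real (F w) + 2) \<le> (real (F w))\<^sup>2 / 4 + (?ld w)\<^sup>2 + 2 * ?ld w"
      using sum_squares_ge_zero[of "real (F w) / 2 - ?ld w" 0] by (simp add: power2_eq_square algebra_simps)
    \<comment> \<open>Loads of integral demands are integers, so the square absorbs the linear
      term.\<close>
    have 3: "?ld w \<le> (?ld w)\<^sup>2"
      unfolding ld of_nat_power[symmetric] of_nat_le_iff by (simp add: power2_eq_square)
    show "?ld w * (real (h w) - real (h (par w))) \<le> (real (F w))\<^sup>2 / 4 + 3 * (?ld w)\<^sup>2"
      using 1 2 3 by linarith
  qed
  also have "\<dots> = (\<Sum>w\<in>{..<n} - {src}. (real (F w))\<^sup>2) / 4 + 3 * (\<Sum>w\<in>{..<n} - {src}. (?ld w)\<^sup>2)"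
    by (simp add: sum.distrib sum_distrib_left sum_divide_distrib)
  also have "(\<Sum>w\<in>{..<n} - {src}. (real (F w))\<^sup>2) \<le> (\<Sum>w<n. (real (F w))\<^sup>2)"
    by (rule sum_mono2) auto
  finally show ?thesis by (simp add: sum_divide_distrib[symmetric])
qed

end

section \<open>Rounding the flow to a tree\<close>

locale rounding = token_flow +
  fixes h e F :: "nat \<Rightarrow> nat" and b :: "nat \<Rightarrow> nat \<Rightarrow> nat" and \<mu> :: nat
  assumes inv: "flow_inv h e F b" and e0: "\<And>v. v < n \<Longrightarrow> v \<noteq> src \<Longrightarrow> e v = 0"
    and c_pos: "\<And>v. v < n \<Longrightarrow> v \<noteq> src \<Longrightarrow> c v > 0"
begin

definition slots :: "nat \<Rightarrow> nat \<Rightarrow> nat" where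
  "slots x v = (\<Sum>k<F x. of_bool (b x k = v))"

definition out :: "nat set \<Rightarrow> nat \<Rightarrow> nat" where
  "out S v = c v + (\<Sum>x\<in>{..<n} - S. slots x v)"

text \<open>The vertices of \<open>S\<close> have got their parent. All tokens at a vertex of \<open>S\<close>, its own and those
  arriving from outside \<open>S\<close>, now follow the tree. The colour of a vertex is the child of the source
  through which its tree path runs, \<open>A\<close> is the load of a colour, and \<open>m\<close> is \<open>\<mu>\<close> times the depth.
  If the parent of a vertex \<open>w\<close> were a uniformly random one of its \<open>F w\<close> token targets, the
  potential would grow by at most \<open>(F w)\<^sup>2 + \<mu> * F w\<close> in expectation; minimizing the part that
  depends on the choice does not need randomness.\<close>

definition round_inv ::
  "nat set \<Rightarrow> (nat \<Rightarrow> nat) \<Rightarrow> (nat \<Rightarrow> nat) \<Rightarrow> (nat \<Rightarrow> nat) \<Rightarrow> (nat \<Rightarrow> nat) \<Rightarrow> bool" where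
  "round_inv S par col m A \<longleftrightarrow>
     S \<subseteq> {..<n} - {src} \<and> col src = src \<and> m src = 0 \<and>
     (\<forall>w\<in>S. (\<exists>k<F w. b w k = par w) \<and> (\<forall>k<F w. b w k \<in> insert src S) \<and>
        col w = (if par w = src then w else col (par w)) \<and> col w \<in> S \<and> m w = m (par w) + \<mu>) \<and>
     (\<forall>a. A a = (\<Sum>v\<in>{v \<in> S. col v = a}. out S v)) \<and>
     (\<Sum>a<n. A a * A a) + (\<Sum>v\<in>S. out S v * m v) \<le> (\<Sum>w\<in>S. F w * F w + \<mu> * F w)"

lemma round_invD:
  assumes "round_inv S par col m A"
  shows "S \<subseteq> {..<n} - {src}" "col src = src" "m src = 0"
    "\<And>w. w \<in> S \<Longrightarrow> \<exists>k<F w. b w k = par w"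
    "\<And>w k. w \<in> S \<Longrightarrow> k < F w \<Longrightarrow> b w k \<in> insert src S"
    "\<And>w. w \<in> S \<Longrightarrow> col w = (if par w = src then w else col (par w))"
    "\<And>w. w \<in> S \<Longrightarrow> col w \<in> S"
    "\<And>w. w \<in> S \<Longrightarrow> m w = m (par w) + \<mu>"
    "\<And>a. A a = (\<Sum>v\<in>{v \<in> S. col v = a}. out S v)"
    "(\<Sum>a<n. A a * A a) + (\<Sum>v\<in>S. out S v * m v) \<le> (\<Sum>w\<in>S. F w * F w + \<mu> * F w)"
proof -
  note u1 = assms[unfolded round_inv_def]
  note u2 = conjunct2[OF u1] note u3 = conjunct2[OF u2] note u4 = conjunct2[OF u3]
  note u5 = conjunct2[OF u4]
  show "S \<subseteq> {..<n} - {src}" "col src = src" "m src = 0"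
    by (rule conjunct1[OF u1] conjunct1[OF u2] conjunct1[OF u3])+
  show "A a = (\<Sum>v\<in>{v \<in> S. col v = a}. out S v)" for a
    by (rule spec[OF conjunct1[OF u5]])
  show "(\<Sum>a<n. A a * A a) + (\<Sum>v\<in>S. out S v * m v) \<le> (\<Sum>w\<in>S. F w * F w + \<mu> * F w)"
    by (rule conjunct2[OF u5])
  fix w assume "w \<in> S"
  note v1 = bspec[OF conjunct1[OF u4] this]
  note v2 = conjunct2[OF v1] note v3 = conjunct2[OF v2] note v4 = conjunct2[OF v3]
  show "\<exists>k<F w. b w k = par w" "col w = (if par w = src then w else col (par w))" "col w \<in> S"
    "m w = m (par w) + \<mu>"
    by (rule conjunct1[OF v1] conjunct1[OF v3] conjunct1[OF v4] conjunct2[OF v4])+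
  show "b w k \<in> insert src S" if "k < F w" for k
    using conjunct1[OF v2] that by (elim allE impE)
qed

lemma round_inv_init: "col src = src \<Longrightarrow> m src = 0 \<Longrightarrow> A = (\<lambda>_. 0) \<Longrightarrow> round_inv {} par col m A"
  by (simp add: round_inv_def)

text \<open>Every vertex but the source has a target to choose as its parent; this is why the scaled
  demands are made positive.\<close>

lemma F_pos: "v < n \<Longrightarrow> v \<noteq> src \<Longrightarrow> F v > 0"
  using flow_invD(6)[OF inv, of v] c_pos[of v] e0[of v] by simp

lemma sum_slots:
  fixes g :: "nat \<Rightarrow> nat"
  assumes "finite S"
  shows "(\<Sum>v\<in>S. slots w v * g v) = (\<Sum>k<F w. if b w k \<in> S then g (b w k) else 0)"
proof -
  have "(\<Sum>v\<in>S. slots w v * g v) = (\<Sum>k<F w. \<Sum>v\<in>S. of_bool (b w k = v) * g v)"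
    unfolding slots_def sum_distrib_right by (rule sum.swap)
  also have "\<dots> = (\<Sum>k<F w. \<Sum>v\<in>S. if v = b w k then g v else 0)"
    by (intro sum.cong refl) auto
  also have "\<dots> = (\<Sum>k<F w. if b w k \<in> S then g (b w k) else 0)"
    using assms by (intro sum.cong refl) simp
  finally show ?thesis .
qed

lemma out_insert:
  assumes "w < n" "w \<notin> S"
  shows "out S v = out (insert w S) v + slots w v"
proof -
  have *: "{..<n} - S = insert w ({..<n} - insert w S)" using assms by auto
  show ?thesis unfolding out_def * by simp
qed

text \<open>Targets of \<open>S\<close> lie in \<open>S\<close> or are the source, and
  \<open>w\<close> does not send to itself. So all tokens reaching \<open>w\<close> come from
  outside, and conservation applies.\<close>

lemma out_self:
  assumes ri: "round_inv S par col m A" and w: "w < n" "w \<noteq> src" "w \<notin> S"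
  shows "out (insert w S) w = F w"
proof -
  have "slots x w = 0" if "x \<in> insert w S" for x
  proof -
    have "b x k \<noteq> w" if "k < F x" for k
    proof (cases "x = w")
      case True
      then show ?thesis using flow_invD(5)[OF inv w(1), of k] that by auto
    next
      case False
      then show ?thesis using round_invD(5)[OF ri, of x k] that \<open>x \<in> insert w S\<close> w by auto
    qed
    then show ?thesis by (simp add: slots_def)
  qed
  then have "(\<Sum>x\<in>{..<n} - insert w S. slots x w) = (\<Sum>x<n. slots x w)"
    by (intro sum.mono_neutral_left) auto
  then have "out (insert w S) w = c w + inflow F b w" by (simp add: out_def inflow_def slots_def)
  then show ?thesis using flow_invD(6)[OF inv w(1,2)] e0[OF w(1,2)] by simp
qed

text \<open>Let \<open>K a\<close> be the number of slots of \<open>w\<close> whose target has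
  colour \<open>a\<close>; for \<open>a \<noteq> src\<close> the old load is
  \<open>A1 a + K a\<close>. Merging all \<open>F w\<close> tokens into one colour replaces the
  cross terms \<open>2 * A1 a * K a\<close> by \<open>2 * F w * A1 (col u)\<close>, and the depth
  terms change likewise. A minimal key is at most the average over the slots, so the potential grows
  by at most \<open>F w * F w + \<mu> * F w\<close>.\<close>

lemma round_step:
  assumes ri: "round_inv S par col m A" and w: "w < n" "w \<noteq> src" "w \<notin> S"
    and ready: "\<And>k. k < F w \<Longrightarrow> b w k \<in> insert src S"
    and A1: "\<And>a. A1 a = A a - (\<Sum>k<F w. of_bool (col (b w k) = a))"
    and k0: "k0 < F w" "u = b w k0"
    and best: "\<And>k. k < F w \<Longrightarrow> 2 * A1 (col u) + m u \<le> 2 * A1 (col (b w k)) + m (b w k)"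
    and par': "par' = par(w := u)" and m': "m' = m(w := m u + \<mu>)"
    and col': "col' = col(w := if u = src then w else col u)"
    and A': "A' = A1(col' w := A1 (col' w) + F w)"
  shows "round_inv (insert w S) par' col' m' A'"
proof -
  note S = round_invD(1)[OF ri]
  have finS: "finite S" using S finite_subset by blast
  have uS: "u \<in> insert src S" using ready k0 by simp
  have uw: "u \<noteq> w" using uS w by auto
  have colS: "col v \<noteq> src" "col v \<noteq> w" "col v < n" if "v \<in> S" for v
    using round_invD(7)[OF ri that] S w(3) by auto
  let ?K = "\<lambda>a. \<Sum>k<F w. of_bool (col (b w k) = a) :: nat"
  have K: "(\<Sum>v\<in>{v \<in> S. col v = a}. slots w v) = ?K a" if "a \<noteq> src" for a
  proof -
    have "(\<Sum>v\<in>{v \<in> S. col v = a}. slots w v) =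
        (\<Sum>k<F w. if b w k \<in> {v \<in> S. col v = a} then 1 else 0)"
      using sum_slots[of "{v \<in> S. col v = a}" w "\<lambda>_. 1"] finS by simp
    also have "\<dots> = ?K a"
      using ready that round_invD(2)[OF ri] by (intro sum.cong refl) force
    finally show ?thesis .
  qed
  have A0: "A src = 0" "A w = 0"
  proof -
    have e: "{v \<in> S. col v = src} = {}" "{v \<in> S. col v = w}= {}" using colS by auto
    show "A src = 0" "A w = 0" unfolding round_invD(9)[OF ri] e by simp_all
  qed
  have A_split: "A a = (\<Sum>v\<in>{v \<in> S. col v = a}. out (insert w S) v) + ?K a" if "a \<noteq> src" for a
    using K[OF that] out_insert[OF w(1,3)] by (simp add: round_invD(9)[OF ri] sum.distrib)
  have A1_eq: "A1 a = (\<Sum>v\<in>{v \<in> S. col v = a}. out (insert w S) v)" for a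
  \<comment> \<open>Slots aimed at the source are counted for the colour \<open>src\<close>, which
    has no load; truncated subtraction keeps it at \<open>0\<close>.\<close>
  proof (cases "a = src")
    case True
    then have e: "{v \<in> S. col v = a} = {}" using colS by auto
    show ?thesis unfolding e using A1[of a] A0 True by simp
  next
    case False
    then show ?thesis using A1[of a] A_split[of a] by simp
  qed
  have A1_0: "A1 src = 0" "A1 w = 0" using A1 A0 by auto
  have col'_w: "col' w \<in> insert w S"
    using col' round_invD(7)[OF ri, of u] uS by auto
  have col'_n: "col' w < n" using col'_w w S by auto
  \<comment> \<open>A child of the source opens the new colour \<open>w\<close>. Both
    \<open>w\<close> and \<open>src\<close> have load \<open>0\<close>, so the two cases
    agree.\<close>
  have A1_col': "A1 (col' w) = A1 (col u)"
    using A1_0 round_invD(2)[OF ri] by (auto simp: col')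
  have col'_S: "col' v = col v" "m' v = m v" if "v \<in> S" for v using that w by (auto simp: col' m')
  let ?F = "F w"
  have P1: "(\<Sum>a<n. A' a * A' a) = (\<Sum>a<n. A1 a * A1 a) + 2 * (?F * A1 (col u)) + ?F * ?F"
  proof -
    let ?c = "A1 (col' w)"
    have *: "(\<lambda>a. A' a * A' a) = (\<lambda>a. A1 a * A1 a)(col' w := (?c + ?F) * (?c + ?F))"
      by (auto simp: A' fun_eq_iff)
    have "(\<Sum>a<n. A' a * A' a) + ?c * ?c = (\<Sum>a<n. A1 a * A1 a) + (?c + ?F) * (?c + ?F)"
      unfolding * by (rule sum_upd) (use col'_n in auto)
    then show ?thesis unfolding A1_col' by (simp add: algebra_simps)
  qed
  \<comment> \<open>Expanding the square of \<open>A1 a + K a\<close>, the square of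
    \<open>K a\<close> is dropped.\<close>
  have P2: "(\<Sum>a<n. A1 a * A1 a) + 2 * (\<Sum>k<?F. A1 (col (b w k))) \<le> (\<Sum>a<n. A a * A a)"
  proof -
    have "(\<Sum>a<n. A1 a * A1 a + 2 * (A1 a * ?K a)) \<le> (\<Sum>a<n. A a * A a)"
    proof (rule sum_mono)
      fix a
      show "A1 a * A1 a + 2 * (A1 a * ?K a) \<le> A a * A a"
      proof (cases "a = src")
        case False
        then have "A a = A1 a + ?K a" using A_split A1_eq by simp
        then show ?thesis by (simp add: algebra_simps)
      qed (simp add: A1_0)
    qed
    moreover have "(\<Sum>a<n. A1 a * ?K a) = (\<Sum>k<?F. A1 (col (b w k)))"
    proof -
      have "(\<Sum>a<n. A1 a * ?K a) = (\<Sum>k<?F. \<Sum>a<n. A1 a * of_bool (col (b w k) = a))"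
        unfolding sum_distrib_left by (rule sum.swap)
      also have "\<dots> = (\<Sum>k<?F. A1 (col (b w k)))"
      proof (rule sum.cong[OF refl])
        fix k assume "k \<in> {..<?F}"
        then have "col (b w k) < n"
          using ready[of k] colS(3) round_invD(2)[OF ri] src by auto
        moreover have "(\<Sum>a<n. A1 a * of_bool (col (b w k) = a)) = (\<Sum>a<n. if a = col (b w k) then A1 a else 0)"
          by (intro sum.cong) auto
        ultimately show "(\<Sum>a<n. A1 a * of_bool (col (b w k) = a)) = A1 (col (b w k))" by simp
      qed
      finally show ?thesis .
    qed
    ultimately show ?thesis by (simp add: sum.distrib sum_distrib_left[symmetric])
  qed
  have P3: "(\<Sum>v\<in>insert w S. out (insert w S) v * m' v) + (\<Sum>k<?F. m (b w k)) =
      ?F * m u + ?F * \<mu> + (\<Sum>v\<in>S. out S v * m v)"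
  proof -
    have "(\<Sum>v\<in>S. slots w v * m v) = (\<Sum>k<?F. m (b w k))"
      unfolding sum_slots[OF finS] using ready round_invD(3)[OF ri] by (intro sum.cong refl) force
    then have "(\<Sum>v\<in>S. out (insert w S) v * m v) + (\<Sum>k<?F. m (b w k)) = (\<Sum>v\<in>S. out S v * m v)"
      using out_insert[OF w(1,3)] by (simp add: sum.distrib algebra_simps)
    moreover have "(\<Sum>v\<in>S. out (insert w S) v * m' v) = (\<Sum>v\<in>S. out (insert w S) v * m v)"
      using col'_S by (intro sum.cong) auto
    moreover have "out (insert w S) w * m' w = ?F * m u + ?F * \<mu>"
      using out_self[OF ri w] by (simp add: m' algebra_simps)
    ultimately show ?thesis using finS w by simp
  qed
  \<comment> \<open>The best slot counted \<open>F w\<close> times, against the sum over all slots: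
    this replaces the uniformly random choice.\<close>
  have "(\<Sum>k<?F. 2 * A1 (col u) + m u) \<le> (\<Sum>k<?F. 2 * A1 (col (b w k)) + m (b w k))"
    using best by (intro sum_mono) auto
  then have P4: "2 * (?F * A1 (col u)) + ?F * m u \<le> 2 * (\<Sum>k<?F. A1 (col (b w k))) + (\<Sum>k<?F. m (b w k))"
    by (simp add: sum.distrib sum_distrib_left[symmetric] algebra_simps)
  show ?thesis
    unfolding round_inv_def
  proof (intro conjI ballI allI impI)
    show "insert w S \<subseteq> {..<n} - {src}" using S w by simp
    show "col' src = src" using w(2) round_invD(2)[OF ri] unfolding col' by simp
    show "m' src = 0" using w(2) round_invD(3)[OF ri] unfolding m' by simp
    fix x assume x: "x \<in> insert w S"
    show "\<exists>k<F x. b x k = par' x" using x k0 round_invD(4)[OF ri, of x] w by (auto simp: par')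
    show "b x k \<in> insert src (insert w S)" if "k < F x" for k
      using x ready round_invD(5)[OF ri, of x] that by auto
    show "col' x \<in> insert w S"
      using x col'_w col'_S round_invD(7)[OF ri, of x] by auto
    have px: "par x \<in> insert src S" if "x \<in> S"
      using round_invD(4,5)[OF ri that] by force
    show "col' x = (if par' x = src then x else col' (par' x))"
      using x px uw w round_invD(6)[OF ri, of x] by (auto simp: par' col')
    show "m' x = m' (par' x) + \<mu>"
      using x px uw w round_invD(8)[OF ri, of x] by (auto simp: par' m')
  next
    fix a
    have "(\<Sum>v\<in>{v \<in> insert w S. col' v = a}. out (insert w S) v) = A1 a + (if col' w = a then F w else 0)"
    proof -
      have "{v \<in> insert w S. col' v = a} = (if col' w = a then insert w {v \<in> S. col v = a} else {v \<in> S. col v = a})"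
        using col'_S w by auto
      then show ?thesis using finS w out_self[OF ri w] by (simp add: A1_eq)
    qed
    then show "A' a = (\<Sum>v\<in>{v \<in> insert w S. col' v = a}. out (insert w S) v)"
      by (simp add: A')
  next
    show "(\<Sum>a<n. A' a * A' a) + (\<Sum>v\<in>insert w S. out (insert w S) v * m' v)
      \<le> (\<Sum>w\<in>insert w S. F w * F w + \<mu> * F w)"
      using P1 P2 P3 P4 round_invD(10)[OF ri] finS w by (simp add: algebra_simps)
  qed
qed

text \<open>\<open>\<mu> * W\<close> lies between \<open>P\<close> and
  \<open>P + W \<le> 2 * P\<close>, so both summands of the potential are at most
  \<open>3 * P\<close>. The first then bounds every load by \<open>sqrt (3 * P)\<close>, the second
  bounds the sum of the loads by \<open>3 * W\<close>, and Cauchy-Schwarz bounds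
  \<open>W\<close>.\<close>

lemma round_final:
  assumes ri: "round_inv ({..<n} - {src}) par col m A"
    and \<mu>: "(\<Sum>w<n. F w * F w) \<le> \<mu> * (\<Sum>w<n. F w)"
      "\<mu> * (\<Sum>w<n. F w) \<le> (\<Sum>w<n. F w * F w) + (\<Sum>w<n. F w)"
  shows "rooted_tree {..<n} src par h"
    and "(\<Sum>w\<in>{..<n} - {src}. (rooted_tree.load {..<n} src par (\<lambda>v. real (c v)) w)\<^sup>2)
      \<le> 6 * sqrt n * (\<Sum>w<n. (real (F w))\<^sup>2)"
proof -
  let ?S = "{..<n} - {src}"
  have par: "par w < n" "h (par w) < h w" if wn: "w < n" "w \<noteq> src" for w
  proof -
    obtain k where "k < F w" "b w k = par w" using round_invD(4)[OF ri, of w] wn by auto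
    then show "par w < n" "h (par w) < h w" using flow_invD(3,5)[OF inv wn(1), of k] by auto
  qed
  show "rooted_tree {..<n} src par h"
    by standard (use par src in auto)
  then interpret rooted_tree "{..<n}" src par h .
  let ?ld = "load (\<lambda>v. real (c v))"
  define P where "P = (\<Sum>w<n. F w * F w)"
  define W where "W = (\<Sum>w<n. F w)"
  define M where "M = (\<Sum>a<n. A a * A a)"
  have out: "out ?S v = c v" for v
    unfolding out_def using flow_invD(2)[OF inv] by (auto simp: slots_def)
  have "(\<Sum>w\<in>?S. F w * F w + \<mu> * F w) \<le> (\<Sum>w<n. F w * F w + \<mu> * F w)" by (rule sum_mono2) auto
  then have bound: "M + (\<Sum>v\<in>?S. c v * m v) \<le> P + \<mu> * W"
    using round_invD(10)[OF ri] unfolding M_def P_def W_def out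
    by (simp add: sum.distrib sum_distrib_left)
  \<comment> \<open>Integrality again: \<open>F w \<le> F w * F w\<close>.\<close>
  have WP: "W \<le> P" unfolding W_def P_def by (rule sum_mono) simp
  have M: "M \<le> 3 * P" and D: "(\<Sum>v\<in>?S. c v * m v) \<le> 3 * P"
    using bound WP \<mu> unfolding P_def W_def by linarith+
  have ld_nonneg: "?ld w \<ge> 0" for w by (simp add: load_def sum_nonneg)
  have ld_le: "?ld w \<le> sqrt (3 * P)" if w: "w < n" "w \<noteq> src" for w
  proof -
    \<comment> \<open>A subtree has a single colour, so the load of \<open>w\<close> is at most the
      load of that colour, whose square is a summand of \<open>M\<close>.\<close>
    have "w \<in> anc v \<longrightarrow> col v = col w" if "v \<in> {..<n}" for v
      using that
    proof (induction rule: tree_induct)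
      case (par v)
      then show ?case using round_invD(6)[OF ri, of v] anc_step[of v] by auto
    qed simp
    then have "sub w \<subseteq> {v \<in> ?S. col v = col w}"
      using anc_root by (auto simp: sub_def)
    then have "(\<Sum>v\<in>sub w. c v) \<le> (\<Sum>v\<in>{v \<in> ?S. col v = col w}. c v)"
      by (intro sum_mono2) auto
    then have le: "(\<Sum>v\<in>sub w. c v) \<le> A (col w)" unfolding round_invD(9)[OF ri] out .
    have "col w < n" using round_invD(7)[OF ri, of w] w by auto
    then have "A (col w) * A (col w) \<le> M"
      unfolding M_def by (intro member_le_sum) auto
    then have "(\<Sum>v\<in>sub w. c v)\<^sup>2 \<le> 3 * P"
      using mult_mono[OF le le] M by (simp add: power2_eq_square)
    then have "(real (\<Sum>v\<in>sub w. c v))\<^sup>2 \<le> real (3 * P)"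
      unfolding of_nat_power[symmetric] of_nat_le_iff .
    then show ?thesis unfolding load_def by (intro real_le_rsqrt) simp
  qed
  have m: "m v = \<mu> * card (anc v)" if "v \<in> {..<n}" for v
    using that
  proof (induction rule: tree_induct)
    case root
    then show ?case using round_invD(3)[OF ri] by simp
  next
    case (par v)
    then show ?case
      using round_invD(8)[OF ri, of v] anc_step[of v] not_anc_par[of v] finite_anc[of "par v"] par_in[of v] by simp
  qed
  have "real (\<Sum>v<n. c v * m v) = \<mu> * (\<Sum>v<n. real (c v) * (\<Sum>a\<in>anc v. 1))"
    using m by (simp add: sum_distrib_left mult_ac)
  also have "\<dots> = \<mu> * (\<Sum>w\<in>?S. ?ld w)"
    unfolding sum_anc_swap by simp
  finally have "\<mu> * (\<Sum>w\<in>?S. ?ld w) = real (\<Sum>v<n. c v * m v)" by simp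
  also have "(\<Sum>v<n. c v * m v) = (\<Sum>v\<in>?S. c v * m v)"
    using src by (simp add: sum.remove[of "{..<n}" src] c_src)
  finally have \<mu>ld: "\<mu> * (\<Sum>w\<in>?S. ?ld w) \<le> 3 * real P"
    using D by (simp only: of_nat_le_iff[symmetric, where 'a = real] of_nat_mult of_nat_numeral)
  have sum_ld: "(\<Sum>w\<in>?S. ?ld w) \<le> 3 * real W"
  \<comment> \<open>\<open>P \<le> \<mu> * W\<close> allows \<open>\<mu>\<close> to be cancelled. If
    \<open>P = 0\<close>, there is no vertex besides the source.\<close>
  proof (cases "P = 0")
    case True
    then have "F w = 0" if "w < n" for w using that by (auto simp: P_def)
    then have S_empty: "?S = {}" using F_pos by fastforce
    show ?thesis unfolding S_empty by simp
  next
    case False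
    have nn: "(\<Sum>w\<in>?S. ?ld w) \<ge> 0" by (intro sum_nonneg ld_nonneg)
    have "real P * (\<Sum>w\<in>?S. ?ld w) \<le> real (\<mu> * W) * (\<Sum>w\<in>?S. ?ld w)"
      using \<mu>(1) nn unfolding P_def W_def by (intro mult_right_mono) (simp_all only: of_nat_le_iff)
    also have "\<dots> = real W * (\<mu> * (\<Sum>w\<in>?S. ?ld w))" by simp
    also have "\<dots> \<le> real W * (3 * real P)" using \<mu>ld by (intro mult_left_mono) auto
    finally have "real P * (\<Sum>w\<in>?S. ?ld w) \<le> real P * (3 * real W)" by (simp only: mult_ac)
    then show ?thesis using False by simp
  qed
  have P_real: "(\<Sum>w<n. (real (F w))\<^sup>2) = real P" by (simp add: P_def power2_eq_square)
  have W: "real W \<le> sqrt n * sqrt P"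
  proof -
    have "(\<Sum>w<n. real (F w))\<^sup>2 \<le> (\<Sum>w<n. (real (F w))\<^sup>2) * n"
      using sum_squared_le_sum_of_squares[of "\<lambda>w. real (F w)" "{..<n}"] by simp
    then show ?thesis
      unfolding P_real real_sqrt_mult[symmetric] W_def of_nat_sum
      by (intro real_le_rsqrt) (simp only: mult.commute)
  qed
  have "(\<Sum>w\<in>?S. (?ld w)\<^sup>2) \<le> (\<Sum>w\<in>?S. sqrt (3 * P) * ?ld w)"
  proof (rule sum_mono)
    fix w assume "w \<in> ?S"
    then have "?ld w \<le> sqrt (3 * P)" using ld_le[of w] by auto
    from mult_right_mono[OF this ld_nonneg] show "(?ld w)\<^sup>2 \<le> sqrt (3 * P) * ?ld w"
      by (simp only: power2_eq_square)
  qed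
  also have "\<dots> = sqrt (3 * P) * (\<Sum>w\<in>?S. ?ld w)" by (simp add: sum_distrib_left)
  \<comment> \<open>\<open>sqrt 3\<close> is rounded up to \<open>2\<close>, which makes the
    constant \<open>6\<close>.\<close>
  also have "\<dots> \<le> (2 * sqrt P) * (3 * (sqrt n * sqrt P))"
  proof (rule mult_mono)
    have "sqrt (3 * P) \<le> sqrt (2\<^sup>2 * P)" by simp
    also have "\<dots> = 2 * sqrt P" by (simp add: real_sqrt_mult)
    finally show "sqrt (3 * P) \<le> 2 * sqrt P" .
    show "(\<Sum>w\<in>?S. ?ld w) \<le> 3 * (sqrt n * sqrt P)" using sum_ld W by linarith
    show "(\<Sum>w\<in>?S. ?ld w) \<ge> 0" by (intro sum_nonneg ld_nonneg)
  qed simp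
  also have "\<dots> = 6 * sqrt n * (sqrt P * sqrt P)" by simp
  also have "sqrt P * sqrt P = real P" by simp
  finally show "(\<Sum>w\<in>?S. (?ld w)\<^sup>2) \<le> 6 * sqrt n * (\<Sum>w<n. (real (F w))\<^sup>2)"
    unfolding P_real .
qed

end

section \<open>Integral demands\<close>

lemma (in rounding) round_approx:
  assumes "round_inv ({..<n} - {src}) par col m A"
    and "(\<Sum>w<n. F w * F w) \<le> \<mu> * (\<Sum>w<n. F w)"
      "\<mu> * (\<Sum>w<n. F w) \<le> (\<Sum>w<n. F w * F w) + (\<Sum>w<n. F w)"
    and "rooted_tree {..<n} src par' rk" "\<And>v. v < n \<Longrightarrow> v \<noteq> src \<Longrightarrow> adj v (par' v)"
  shows "(\<Sum>w\<in>{..<n} - {src}. (rooted_tree.load {..<n} src par (\<lambda>v. real (c v)) w)\<^sup>2)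
    \<le> 72 * sqrt n * (\<Sum>w\<in>{..<n} - {src}. (rooted_tree.load {..<n} src par' (\<lambda>v. real (c v)) w)\<^sup>2)"
proof -
  have "6 * sqrt n * (\<Sum>w<n. (real (F w))\<^sup>2) \<le>
    6 * sqrt n * (12 * (\<Sum>w\<in>{..<n} - {src}. (rooted_tree.load {..<n} src par' (\<lambda>v. real (c v)) w)\<^sup>2))"
    using final_energy[OF inv e0 assms(4,5)] by (intro mult_left_mono) auto
  with round_final(2)[OF assms(1-3)] show ?thesis by simp
qed

text \<open>\<open>c v\<close> is about \<open>n\<^sup>2 * d v / D\<close>. The rounding error of a load is at most \<open>n\<close>, in total
  \<open>n\<^sup>3\<close> after squaring, and every tree has loss at least \<open>D\<^sup>2 / n\<close>, which is scaled to \<open>n\<^sup>3\<close>.\<close>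

definition scaled :: "nat \<Rightarrow> nat \<Rightarrow> (nat \<Rightarrow> real) \<Rightarrow> (nat \<Rightarrow> nat) \<Rightarrow> bool" where
  "scaled n src d c \<longleftrightarrow> c src = 0 \<and> (\<forall>v<n. v \<noteq> src \<longrightarrow> 0 < c v \<and>
     real (n * n) * d v \<le> real (c v) * (- d src) \<and> real (c v) * (- d src) \<le> real (n * n) * d v - d src)"

lemma (in rooted_tree) load_nonneg:
  assumes "\<And>v. v \<in> V \<Longrightarrow> v \<noteq> root \<Longrightarrow> d v \<ge> 0"
  shows "load d w \<ge> 0"
  unfolding load_def
proof (rule sum_nonneg)
  fix v assume "v \<in> sub w"
  then show "d v \<ge> 0" using assms[of v] anc_root by (cases "v = root") (auto simp: sub_def)
qed

lemma demand_sum: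
  fixes d :: "nat \<Rightarrow> real"
  assumes "(\<Sum>v<n. d v) = 0" "src < n"
  shows "(\<Sum>v\<in>{..<n} - {src}. d v) = - d src"
  using assms sum.remove[of "{..<n}" src d] by simp

text \<open>Every unit of demand crosses at least one edge, so the loads add up to at least
  \<open>- d src\<close>; Cauchy-Schwarz over fewer than \<open>n\<close> edges gives the
  square.\<close>

lemma loss_lower_bound:
  fixes d :: "nat \<Rightarrow> real"
  assumes "rooted_tree {..<n} src par rk" and sum0: "(\<Sum>v<n. d v) = 0"
    and pos: "\<And>v. v < n \<Longrightarrow> v \<noteq> src \<Longrightarrow> d v \<ge> 0"
  shows "(d src)\<^sup>2 \<le> n * (\<Sum>w\<in>{..<n} - {src}. (rooted_tree.load {..<n} src par d w)\<^sup>2)"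
proof -
  interpret rooted_tree "{..<n}" src par rk by (rule assms(1))
  have src: "src < n" using root by simp
  have "- d src = (\<Sum>v\<in>{..<n} - {src}. d v * 1)" using demand_sum[OF sum0 src] by simp
  also have "\<dots> \<le> (\<Sum>v\<in>{..<n} - {src}. d v * card (anc v))"
  proof (rule sum_mono)
    fix v assume v: "v \<in> {..<n} - {src}"
    then have "card (anc v) \<ge> 1"
      using anc_step[of v] finite_anc[of v] by (auto simp: Suc_le_eq card_gt_0_iff)
    then show "d v * 1 \<le> d v * card (anc v)" using pos v by (intro mult_left_mono) auto
  qed
  also have "\<dots> = (\<Sum>v<n. d v * (\<Sum>a\<in>anc v. 1))"
    using src by (simp add: sum.remove[of "{..<n}" src])
  also have "\<dots> = (\<Sum>w\<in>{..<n} - {src}. load d w)" unfolding sum_anc_swap by simp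
  finally have le: "- d src \<le> (\<Sum>w\<in>{..<n} - {src}. load d w)" .
  have "- d src \<ge> 0" unfolding demand_sum[OF sum0 src, symmetric] using pos by (intro sum_nonneg) auto
  with le have "(- d src)\<^sup>2 \<le> (\<Sum>w\<in>{..<n} - {src}. load d w)\<^sup>2" by (rule power_mono)
  also have "\<dots> \<le> (\<Sum>w\<in>{..<n} - {src}. (load d w)\<^sup>2) * card ({..<n} - {src})"
    by (rule sum_squared_le_sum_of_squares)
  also have "\<dots> \<le> (\<Sum>w\<in>{..<n} - {src}. (load d w)\<^sup>2) * n"
    by (intro mult_left_mono sum_nonneg) (auto intro: order.trans[OF card_Diff1_le])
  finally show ?thesis by (simp add: mult.commute)
qed

text \<open>Rounding only goes upwards, so the error is one-sided; in a subtree of at most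
  \<open>n\<close> vertices it adds up to at most \<open>n\<close> units of size
  \<open>- d src\<close>.\<close>

lemma scaled_load:
  fixes d :: "nat \<Rightarrow> real"
  assumes "rooted_tree {..<n} src par rk" and sc: "scaled n src d c" and src: "d src < 0"
  shows "real (n * n) * rooted_tree.load {..<n} src par d w \<le>
      (- d src) * rooted_tree.load {..<n} src par (\<lambda>v. real (c v)) w" (is ?A)
    and "(- d src) * rooted_tree.load {..<n} src par (\<lambda>v. real (c v)) w \<le>
      real (n * n) * rooted_tree.load {..<n} src par d w + n * (- d src)" (is ?B)
proof -
  interpret rooted_tree "{..<n}" src par rk by (rule assms(1))
  have sub: "v < n" "v \<noteq> src" if "v \<in> sub w" for v
    using that anc_root by (auto simp: sub_def)
  show ?A unfolding load_def sum_distrib_left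
    using sc sub unfolding scaled_def by (intro sum_mono) (auto simp: mult.commute)
  have "(\<Sum>v\<in>sub w. (- d src) * real (c v)) \<le> (\<Sum>v\<in>sub w. real (n * n) * d v + (- d src))"
  proof (rule sum_mono)
    fix v assume "v \<in> sub w"
    then show "(- d src) * real (c v) \<le> real (n * n) * d v + (- d src)"
      using sc sub[of v] unfolding scaled_def by (auto simp: mult.commute)
  qed
  also have "\<dots> = (\<Sum>v\<in>sub w. real (n * n) * d v) + card (sub w) * (- d src)"
    by (simp only: sum.distrib sum_constant)
  also have "real (card (sub w)) * (- d src) \<le> n * (- d src)"
    using src card_mono[of "{..<n}" "sub w"] by (intro mult_right_mono) (auto simp: sub_def)
  finally show ?B unfolding load_def sum_distrib_left by simp
qed

text \<open>One-sided rounding costs nothing for the computed tree. For its competitor,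
  \<open>(a + b)\<^sup>2 \<le> 2 * a\<^sup>2 + 2 * b\<^sup>2\<close> splits off the rounding error,
  whose total of at most \<open>n * (n * D)\<^sup>2\<close> is at most \<open>K\<^sup>2\<close>
  times the loss by \<open>loss_lower_bound\<close>. The scale \<open>n * n\<close> is chosen for
  this match, and \<open>4 = 2 + 2\<close>.\<close>

lemma scaled_loss:
  fixes d :: "nat \<Rightarrow> real"
  assumes rt: "rooted_tree {..<n} src par rk" "rooted_tree {..<n} src par' rk'"
    and sc: "scaled n src d c" and sum0: "(\<Sum>v<n. d v) = 0"
    and src: "d src < 0" and pos: "\<And>v. v < n \<Longrightarrow> v \<noteq> src \<Longrightarrow> d v \<ge> 0"
    and n: "n > 0"
    and approx: "(\<Sum>w\<in>{..<n} - {src}. (rooted_tree.load {..<n} src par (\<lambda>v. real (c v)) w)\<^sup>2)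
    \<le> C * (\<Sum>w\<in>{..<n} - {src}. (rooted_tree.load {..<n} src par' (\<lambda>v. real (c v)) w)\<^sup>2)" and C: "C \<ge> 0"
  shows "(\<Sum>w\<in>{..<n} - {src}. (rooted_tree.load {..<n} src par d w)\<^sup>2)
    \<le> 4 * C * (\<Sum>w\<in>{..<n} - {src}. (rooted_tree.load {..<n} src par' d w)\<^sup>2)"
proof -
  interpret T: rooted_tree "{..<n}" src par rk by (rule rt)
  interpret T': rooted_tree "{..<n}" src par' rk' by (rule rt)
  let ?S = "{..<n} - {src}"
  define K where "K = real (n * n)"
  define D where "D = - d src"
  let ?c = "\<lambda>v. real (c v)"
  have D: "D > 0" and K: "K > 0" using src n by (auto simp: D_def K_def)
  have "K\<^sup>2 * (\<Sum>w\<in>?S. (T.load d w)\<^sup>2) = (\<Sum>w\<in>?S. (K * T.load d w)\<^sup>2)"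
    by (simp add: sum_distrib_left power_mult_distrib)
  also have "\<dots> \<le> (\<Sum>w\<in>?S. (D * T.load ?c w)\<^sup>2)"
    using scaled_load(1)[OF rt(1) sc src] T.load_nonneg[of d] pos K
    unfolding K_def D_def by (intro sum_mono power_mono) auto
  also have "\<dots> = D\<^sup>2 * (\<Sum>w\<in>?S. (T.load ?c w)\<^sup>2)"
    by (simp add: sum_distrib_left power_mult_distrib)
  also have "\<dots> \<le> D\<^sup>2 * (C * (\<Sum>w\<in>?S. (T'.load ?c w)\<^sup>2))"
    using approx by (intro mult_left_mono) auto
  also have "\<dots> = C * (\<Sum>w\<in>?S. (D * T'.load ?c w)\<^sup>2)"
    by (simp add: sum_distrib_left power_mult_distrib mult_ac)
  finally have 1: "K\<^sup>2 * (\<Sum>w\<in>?S. (T.load d w)\<^sup>2) \<le> C * (\<Sum>w\<in>?S. (D * T'.load ?c w)\<^sup>2)" .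
  have "(\<Sum>w\<in>?S. (D * T'.load ?c w)\<^sup>2) \<le> (\<Sum>w\<in>?S. 2 * (K * T'.load d w)\<^sup>2 + 2 * (n * D)\<^sup>2)"
  proof (rule sum_mono)
    fix w
    have "D * T'.load ?c w \<le> K * T'.load d w + n * D"
      using scaled_load(2)[OF rt(2) sc src] unfolding K_def D_def .
    moreover have "D * T'.load ?c w \<ge> 0"
      using D T'.load_nonneg[of ?c] by simp
    ultimately have "(D * T'.load ?c w)\<^sup>2 \<le> (K * T'.load d w + n * D)\<^sup>2" by (rule power_mono)
    also have "\<dots> \<le> 2 * (K * T'.load d w)\<^sup>2 + 2 * (n * D)\<^sup>2"
      using sum_squares_ge_zero[of "K * T'.load d w - n * D" 0]
      by (simp add: power2_eq_square algebra_simps)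
    finally show "(D * T'.load ?c w)\<^sup>2 \<le> 2 * (K * T'.load d w)\<^sup>2 + 2 * (n * D)\<^sup>2" .
  qed
  also have "\<dots> = 2 * K\<^sup>2 * (\<Sum>w\<in>?S. (T'.load d w)\<^sup>2) + 2 * (card ?S * (n * D)\<^sup>2)"
    by (simp add: sum.distrib sum_distrib_left power_mult_distrib mult_ac)
  also have "real (card ?S) * (n * D)\<^sup>2 \<le> n * (n * D)\<^sup>2"
    by (intro mult_right_mono) (auto intro: order.trans[OF card_Diff1_le])
  also have "n * (n * D)\<^sup>2 = real n ^ 3 * (d src)\<^sup>2"
    by (simp add: D_def power2_eq_square power3_eq_cube)
  also have "real n ^ 3 * (d src)\<^sup>2 \<le> real n ^ 3 * (n * (\<Sum>w\<in>?S. (T'.load d w)\<^sup>2))"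
    by (intro mult_left_mono loss_lower_bound[OF rt(2) sum0 pos]) auto
  also have "\<dots> = K\<^sup>2 * (\<Sum>w\<in>?S. (T'.load d w)\<^sup>2)"
    by (simp add: K_def power2_eq_square power3_eq_cube)
  finally have "(\<Sum>w\<in>?S. (D * T'.load ?c w)\<^sup>2) \<le> 4 * (K\<^sup>2 * (\<Sum>w\<in>?S. (T'.load d w)\<^sup>2))" by simp
  from order.trans[OF 1 mult_left_mono[OF this C]]
  have "K\<^sup>2 * (\<Sum>w\<in>?S. (T.load d w)\<^sup>2) \<le> K\<^sup>2 * (4 * C * (\<Sum>w\<in>?S. (T'.load d w)\<^sup>2))"
    by (simp only: mult_ac)
  then show ?thesis using K by simp
qed

text \<open>There are finitely many spanning trees, so \<open>OPT\<close> is attained; rooted at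
  \<open>src\<close>, an optimal tree is one of the competitors in \<open>approx\<close>.\<close>

lemma loss_le_OPT:
  fixes E :: "nat set set" and d :: "nat \<Rightarrow> real"
  assumes inst: "dnr_instance {..<n} E d (\<lambda>_. 1)" and src: "src < n"
    and rt: "rooted_tree {..<n} src par rk" and E: "\<And>v. v < n \<Longrightarrow> v \<noteq> src \<Longrightarrow> {v, par v} \<in> E"
    and approx: "\<And>par' rk'. rooted_tree {..<n} src par' rk' \<Longrightarrow>
      (\<And>v. v < n \<Longrightarrow> v \<noteq> src \<Longrightarrow> {v, par' v} \<in> E) \<Longrightarrow>
      (\<Sum>w\<in>{..<n} - {src}. (rooted_tree.load {..<n} src par d w)\<^sup>2)
      \<le> C * (\<Sum>w\<in>{..<n} - {src}. (rooted_tree.load {..<n} src par' d w)\<^sup>2)"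
  shows "spanning_tree {..<n} E (rooted_tree.edges {..<n} src par)"
    and "loss d (\<lambda>_. 1) (rooted_tree.edges {..<n} src par) \<le> C * OPT {..<n} E d (\<lambda>_. 1)"
proof -
  interpret rooted_tree "{..<n}" src par rk by (rule rt)
  have simple: "simple_graph {..<n} E" and sum0: "sum d {..<n} = 0"
    using inst by (auto simp: dnr_instance_def)
  have "edges \<subseteq> E" using E by (auto simp: edges_def)
  then show span: "spanning_tree {..<n} E edges" by (rule edges_spanning)
  have "E \<subseteq> Pow {..<n}" using simple by (auto simp: simple_graph_def)
  then have "finite E" by (rule finite_subset) simp
  then have fin: "finite {T. spanning_tree {..<n} E T}"
    by (rule finite_subset[rotated, OF finite_Pow_iff[THEN iffD2]]) (auto simp: spanning_tree_def)
  have "OPT {..<n} E d (\<lambda>_. 1) \<in> loss d (\<lambda>_. 1) ` {T. spanning_tree {..<n} E T}"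
    unfolding OPT_def using span fin by (intro Min_in) auto
  then obtain T where T: "spanning_tree {..<n} E T" "OPT {..<n} E d (\<lambda>_. 1) = loss d (\<lambda>_. 1) T" by blast
  obtain par' rk' where T': "rooted_tree {..<n} src par' rk'" "T = rooted_tree.edges {..<n} src par'"
    using spanning_tree_rooted[OF simple T(1)] src by auto
  have "{v, par' v} \<in> E" if "v < n" "v \<noteq> src" for v
    using T(1) T'(2) that by (auto simp: spanning_tree_def rooted_tree.edges_def[OF T'(1)])
  from approx[OF T'(1) this] show "loss d (\<lambda>_. 1) edges \<le> C * OPT {..<n} E d (\<lambda>_. 1)"
    unfolding T(2) T'(2) loss_edges[OF sum0] rooted_tree.loss_edges[OF T'(1) sum0] .
qed

section \<open>The program\<close>

text \<open>Without multiplication, the offsets \<open>i * n\<close> and \<open>i * N\<close> of the rows of the matrices \<open>E\<close>, \<open>T\<close>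
  and \<open>b\<close> are tabulated in \<open>R\<close> and \<open>B\<close>. The arrays \<open>h\<close>, \<open>e\<close>, \<open>F\<close> and \<open>b\<close> are those of the token flow,
  \<open>g\<close> tells whether the last pass has changed it, and \<open>C\<close>, \<open>A\<close>, \<open>m\<close> and \<open>P\<close> are the colours, their loads,
  the depths times \<open>mu\<close>, and the parents.\<close>

definition NEq :: "nexp \<Rightarrow> nexp \<Rightarrow> bexp" where
  "NEq a b = BAnd (BNot (NLess a b)) (BNot (NLess b a))"

lemma bval_NEq [simp]: "bval (NEq a b) s \<longleftrightarrow> nval a s = nval b s"
  by (auto simp: NEq_def)

abbreviation put :: "vname \<Rightarrow> nexp \<Rightarrow> com" where "put x a \<equiv> NAssign x (NConst 0) a"

abbreviation put_real :: "vname \<Rightarrow> rexp \<Rightarrow> com" where "put_real x a \<equiv> RAssign x (NConst 0) a"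

abbreviation var_real :: "vname \<Rightarrow> rexp" where "var_real x \<equiv> RRead x (NConst 0)"

abbreviation inc :: "vname \<Rightarrow> nexp \<Rightarrow> nexp \<Rightarrow> com" where
  "inc x i a \<equiv> NAssign x i (NAdd (NRead x i) a)"

abbreviation dec :: "vname \<Rightarrow> nexp \<Rightarrow> com" where
  "dec x i \<equiv> NAssign x i (NSub (NRead x i) (NConst 1))"

abbreviation mark_source :: com where
  "mark_source \<equiv> Seq (NAssign ''R'' (var ''i'') (var ''r''))
     (Seq (inc ''r'' (NConst 0) (var ''n''))
          (If (RLess (RRead ''d'' (var ''i'')) (ROfNat (NConst 0))) (put ''s'' (var ''i'')) Skip))"

definition find_source :: com where
  "find_source = Seq (put ''r'' (NConst 0)) (For ''i'' (var ''n'')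
     mark_source)"

abbreviation multiply_demand :: com where
  "multiply_demand \<equiv> For ''j'' (var ''n'') (For ''k'' (var ''n'')
     (put_real ''x'' (RAdd (var_real ''x'') (RRead ''d'' (var ''i'')))))"

text \<open>Division by repeated subtraction. As \<open>c\<close> starts at \<open>1\<close>, the
  result is the floor of the quotient plus one: an upper approximation that is positive even for
  zero demands.\<close>

abbreviation count_quotient :: com where
  "count_quotient \<equiv> While (BNot (RLess (var_real ''x'') (var_real ''D'')))
     (Seq (put_real ''x'' (RSub (var_real ''x'') (var_real ''D''))) (inc ''c'' (var ''i'') (NConst 1)))"

definition scale_demand :: com where
  "scale_demand = Seq (put_real ''x'' (ROfNat (NConst 0)))
     (Seq (multiply_demand)
     (Seq (NAssign ''c'' (var ''i'') (NConst 1))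
        (count_quotient)))"

abbreviation set_demand :: com where
  "set_demand \<equiv> Seq (NAssign ''c'' (var ''i'') (NConst 0))
     (Seq (If (NEq (var ''i'') (var ''s'')) Skip scale_demand)
     (Seq (NAssign ''e'' (var ''i'') (NRead ''c'' (var ''i''))) (inc ''N'' (NConst 0) (NRead ''c'' (var ''i'')))))"

definition scale_demands :: com where
  "scale_demands = Seq (put_real ''D'' (RSub (ROfNat (NConst 0)) (RRead ''d'' (var ''s''))))
     (Seq (put ''N'' (NConst 0)) (For ''i'' (var ''n'')
        set_demand))"

text \<open>Rows of length \<open>N\<close> suffice, because no vertex ever has more than
  \<open>N\<close> forwarded tokens.\<close>

definition slot_bases :: com where
  "slot_bases = Seq (put ''q'' (NConst 0)) (For ''i'' (var ''n'')
     (Seq (NAssign ''B'' (var ''i'') (var ''q'')) (inc ''q'' (NConst 0) (var ''N''))))"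

section \<open>Assertions about the input and the scaled demands\<close>

type_synonym dnr_data = "nat set set \<times> (nat \<Rightarrow> real)"

definition gph :: "dnr_data \<Rightarrow> nat set set" where "gph = fst"

definition dmd :: "dnr_data \<Rightarrow> nat \<Rightarrow> real" where "dmd = snd"

definition Inst :: "nat \<Rightarrow> dnr_data \<Rightarrow> state \<Rightarrow> bool" where
  "Inst n z s \<longleftrightarrow> dnr_instance {..<n} (gph z) (dmd z) (\<lambda>_. 1) \<and> card (sources {..<n} (dmd z)) = 1 \<and>
     arr s ''n'' 0 = n \<and> (\<forall>i<n. \<forall>j<n. arr s ''E'' (i * n + j) \<noteq> 0 \<longleftrightarrow> {i, j} \<in> gph z) \<and>
     (\<forall>v<n. rarr s ''d'' v = dmd z v)"

definition Zero :: "state \<Rightarrow> bool" where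
  "Zero s \<longleftrightarrow> (\<forall>x\<in>{''h'', ''F'', ''T'', ''A'', ''m''}. arr s x = (\<lambda>_. 0))"

definition Src :: "nat \<Rightarrow> dnr_data \<Rightarrow> state \<Rightarrow> bool" where
  "Src n z s \<longleftrightarrow> Inst n z s \<and> (\<forall>i<n. arr s ''R'' i = i * n) \<and> arr s ''s'' 0 < n \<and>
     dmd z (arr s ''s'' 0) < 0 \<and> (\<forall>v<n. v \<noteq> arr s ''s'' 0 \<longrightarrow> dmd z v \<ge> 0)"

definition Dem :: "nat \<Rightarrow> dnr_data \<Rightarrow> state \<Rightarrow> bool" where
  "Dem n z s \<longleftrightarrow> Src n z s \<and> scaled n (arr s ''s'' 0) (dmd z) (arr s ''c'') \<and>
     arr s ''N'' 0 = (\<Sum>v<n. arr s ''c'' v) \<and> arr s ''N'' 0 \<le> n * (n * n + 1) \<and>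
     (\<forall>i<n. arr s ''B'' i = i * arr s ''N'' 0)"

lemma Inst_nupd [simp]: "x \<notin> {''n'', ''E''} \<Longrightarrow> Inst n z (nupd x i k s) = Inst n z s"
  and Inst_rupd [simp]: "x \<noteq> ''d'' \<Longrightarrow> Inst n z (rupd x i a s) = Inst n z s"
  by (auto simp: Inst_def)

lemma Zero_nupd [simp]: "x \<notin> {''h'', ''F'', ''T'', ''A'', ''m''} \<Longrightarrow> Zero (nupd x i k s) = Zero s"
  and Zero_rupd [simp]: "Zero (rupd x i a s) = Zero s"
  by (auto simp: Zero_def)

lemma Src_nupd [simp]: "x \<notin> {''n'', ''E'', ''R'', ''s''} \<Longrightarrow> Src n z (nupd x i k s) = Src n z s"
  and Src_rupd [simp]: "x \<noteq> ''d'' \<Longrightarrow> Src n z (rupd x i a s) = Src n z s"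
  by (auto simp: Src_def)

lemma Dem_nupd [simp]:
  "x \<notin> {''n'', ''E'', ''R'', ''s'', ''c'', ''N'', ''B''} \<Longrightarrow> Dem n z (nupd x i k s) = Dem n z s"
  by (auto simp: Dem_def)

lemma InstD:
  assumes "Inst n z s"
  shows "arr s ''n'' 0 = n" "\<And>v. v < n \<Longrightarrow> rarr s ''d'' v = dmd z v"
    "\<exists>v. {w. w < n \<and> dmd z w < 0} = {v}" "(\<Sum>v<n. dmd z v) = 0"
  using assms by (auto simp: Inst_def sources_def dnr_instance_def card_1_singleton_iff)

lemma SrcD:
  assumes "Src n z s"
  shows "Inst n z s" "arr s ''n'' 0 = n" "\<And>i. i < n \<Longrightarrow> arr s ''R'' i = i * n" "arr s ''s'' 0 < n"
    "dmd z (arr s ''s'' 0) < 0" "\<And>v. v < n \<Longrightarrow> v \<noteq> arr s ''s'' 0 \<Longrightarrow> dmd z v \<ge> 0"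
    "\<And>v. v < n \<Longrightarrow> rarr s ''d'' v = dmd z v" "(\<Sum>v<n. dmd z v) = 0"
  using assms InstD[of n z s] by (auto simp: Src_def)

lemma find_source:
  "hoare (\<lambda>n z s. Inst n z s \<and> Zero s) find_source (\<lambda>n z s. Src n z s \<and> Zero s)"
  unfolding find_source_def
proof (rule hoare_Seq)
  show "hoare (\<lambda>n z s. Inst n z s \<and> Zero s) (put ''r'' (NConst 0))
      (\<lambda>n z s. Inst n z s \<and> Zero s \<and> arr s ''r'' 0 = 0)"
    by (rule hoare_straight) simp_all
  \<comment> \<open>The clause for \<open>s\<close> is conditional: \<open>s\<close> is right as
    soon as the scan has passed the only source.\<close>
  let ?I = "\<lambda>n z M k s. Inst n z s \<and> Zero s \<and> M = n \<and> arr s ''r'' 0 = k * n \<and>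
      (\<forall>i<k. arr s ''R'' i = i * n) \<and>
      (\<forall>v<k. {w. w < n \<and> dmd z w < 0} = {v} \<longrightarrow> arr s ''s'' 0 = v)"
  show "hoare (\<lambda>n z s. Inst n z s \<and> Zero s \<and> arr s ''r'' 0 = 0)
     (For ''i'' (var ''n'') mark_source)
     (\<lambda>n z s. Src n z s \<and> Zero s)" (is "hoare _ (For _ _ ?c) _")
  proof (rule hoare_For_straight[where I = ?I, OF _ _ poly_bounded_id])
    fix n z M k s assume I: "?I n z M k s" and k: "arr s ''i'' 0 = k" "k < M"
    let ?s' = "nupd ''i'' 0 (Suc k) (eff ?c s)"
    have I': "Inst n z s" "Zero s" "M = n" "arr s ''r'' 0 = k * n" "\<forall>i<k. arr s ''R'' i = i * n"
      using I by blast+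
    have "arr ?s' ''s'' 0 = v" if "v < Suc k" and v: "{w. w < n \<and> dmd z w < 0} = {v}" for v
    proof (cases "v = k")
      case True
      then have "dmd z k < 0" using v by auto
      then show ?thesis using True k I' by (simp add: InstD(2))
    next
      case False
      then have "k \<notin> {w. w < n \<and> dmd z w < 0}" unfolding v by simp
      then have "\<not> dmd z k < 0" using k I' by simp
      moreover have "v < k" using that(1) False by simp
      then have "arr s ''s'' 0 = v" using I v by simp
      ultimately show ?thesis using k I' by (simp add: InstD(2))
    qed
    moreover have "Inst n z ?s' \<and> Zero ?s' \<and> M = n \<and> arr ?s' ''r'' 0 = Suc k * n \<and>
        (\<forall>i<Suc k. arr ?s' ''R'' i = i * n) \<and> arr (eff ?c s) ''i'' 0 = k"
    proof (cases "dmd z k < 0")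
      case True
      then show ?thesis using I' k InstD(1,2)[OF I'(1)] by (simp add: less_Suc_eq)
    next
      case False
      then show ?thesis using I' k InstD(1,2)[OF I'(1)] by (simp add: less_Suc_eq)
    qed
    ultimately show "?I n z M (Suc k) ?s' \<and> arr (eff ?c s) ''i'' 0 = k" by blast
  next
    fix n z M s assume I: "?I n z M M s"
    have I': "Inst n z s" "Zero s" "M = n" "\<forall>i<M. arr s ''R'' i = i * n" using I by blast+
    obtain v where v: "{w. w < n \<and> dmd z w < 0} = {v}" using InstD(3)[OF I'(1)] by blast
    have iff: "w < n \<and> dmd z w < 0 \<longleftrightarrow> w = v" for w
      using v by (simp add: set_eq_iff)
    have vn: "v < n" "dmd z v < 0" using iff[of v] by simp_all
    have others: "\<not> dmd z w < 0" if "w < n" "w \<noteq> v" for w using iff[of w] that by simp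
    have "arr s ''s'' 0 = v" using I v vn(1) I'(3) by simp
    then show "Src n z s \<and> Zero s"
      using I' vn others unfolding Src_def by (auto simp: not_less)
  qed (auto simp: InstD(1))
qed

lemma demand_le:
  fixes d :: "nat \<Rightarrow> real"
  assumes "(\<Sum>v<n. d v) = 0" "src < n" "\<And>v. v < n \<Longrightarrow> v \<noteq> src \<Longrightarrow> d v \<ge> 0" "v < n" "v \<noteq> src"
  shows "d v \<le> - d src"
  using member_le_sum[of v "{..<n} - {src}" d] assms demand_sum[OF assms(1,2)] by auto

text \<open>Pointwise form of \<open>scaled\<close>, with a bound on \<open>c\<close> that keeps the
  number of tokens polynomial.\<close>

definition scaled_at :: "nat \<Rightarrow> nat \<Rightarrow> (nat \<Rightarrow> real) \<Rightarrow> nat \<Rightarrow> nat \<Rightarrow> bool" where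
  "scaled_at n src d v k \<longleftrightarrow> (if v = src then k = 0 else 0 < k \<and> k \<le> n * n + 1 \<and>
     real (n * n) * d v \<le> real k * (- d src) \<and> real k * (- d src) \<le> real (n * n) * d v - d src)"

text \<open>\<open>c\<close> is the demand array before the iteration, and \<open>Q\<close> is any relation on parts of the state
  that the iteration does not touch.\<close>

abbreviation scaling_pre where
  "scaling_pre Q \<equiv> \<lambda>n (z, c, i) s. Src n z s \<and> Zero s \<and> rarr s ''D'' 0 = - dmd z (arr s ''s'' 0) \<and>
     arr s ''i'' 0 = i \<and> i < n \<and> i \<noteq> arr s ''s'' 0 \<and> (\<forall>v. v \<noteq> i \<longrightarrow> arr s ''c'' v = c v) \<and>
     Q n z c i (arr s ''e'') (arr s ''N'' 0) (arr s ''s'' 0)"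

abbreviation scaling_post where
  "scaling_post Q \<equiv> \<lambda>n (z, c, i) s. Src n z s \<and> Zero s \<and> rarr s ''D'' 0 = - dmd z (arr s ''s'' 0) \<and>
     arr s ''i'' 0 = i \<and> (\<forall>v. v \<noteq> i \<longrightarrow> arr s ''c'' v = c v) \<and>
     Q n z c i (arr s ''e'') (arr s ''N'' 0) (arr s ''s'' 0) \<and>
     scaled_at n (arr s ''s'' 0) (dmd z) i (arr s ''c'' i)"

lemma scale_demand:
  "hoare (scaling_pre Q) scale_demand
     (scaling_post Q)"
proof -
  let ?B = "scaling_pre Q"
  let ?X = "\<lambda>n y s t. ?B n y s \<and> rarr s ''x'' 0 = t * dmd (fst y) (snd (snd y))"
  show ?thesis
    unfolding scale_demand_def
  proof (rule hoare_Seq)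
    show "hoare ?B (put_real ''x'' (ROfNat (NConst 0))) (\<lambda>n y s. ?X n y s 0)"
      by (rule hoare_straight) auto
    show "hoare (\<lambda>n y s. ?X n y s 0) (Seq (multiply_demand)
     (Seq (NAssign ''c'' (var ''i'') (NConst 1))
        (count_quotient)))
     (scaling_post Q)"
    proof (rule hoare_Seq)
      show "hoare (\<lambda>n y s. ?X n y s 0) (multiply_demand)
        (\<lambda>n y s. ?X n y s (real (n * n)))"
      proof (rule hoare_For[where I = "\<lambda>n y M j s. ?X n y s (real (j * n)) \<and> M = n", OF _ poly_bounded_id])
        show "hoare (\<lambda>n (y, M, j) s. (?X n y s (real (j * n)) \<and> M = n) \<and> arr s ''j'' 0 = j \<and> j < M)
          (For ''k'' (var ''n'') (put_real ''x'' (RAdd (var_real ''x'') (RRead ''d'' (var ''i'')))))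
          (\<lambda>n (y, M, j) s. (?X n y (nupd ''j'' 0 (Suc j) s) (real (Suc j * n)) \<and> M = n) \<and> arr s ''j'' 0 = j)"
          by (rule hoare_For[where I = "\<lambda>n (y, M', j) M k s. ?X n y s (real (j * n + k)) \<and> M = n \<and> M' = n \<and> arr s ''j'' 0 = j",
                OF _ poly_bounded_id], rule hoare_straight) (auto simp: SrcD(2,7) algebra_simps)
      qed (auto simp: SrcD(2))
      \<comment> \<open>Invariant of Euclidean division: \<open>c - 1\<close> copies of
        \<open>D\<close> have been removed from the scaled demand, and \<open>x\<close> is
        left.\<close>
      let ?W = "\<lambda>n y s. ?B n y s \<and> (case y of (z, c, i) \<Rightarrow> arr s ''c'' i > 0 \<and> rarr s ''x'' 0 \<ge> 0 \<and>
        rarr s ''x'' 0 + (real (arr s ''c'' i) - 1) * (- dmd z (arr s ''s'' 0)) = real (n * n) * dmd z i)"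
      \<comment> \<open>No demand exceeds \<open>D\<close>, so at most \<open>n * n\<close> copies
        can be removed.\<close>
      have W_bound: "arr s ''c'' (snd (snd y)) \<le> n * n + 1" if W: "?W n y s" for n y s
      proof -
        obtain z c i where y: "y = (z, c, i)" by (metis surj_pair)
        let ?src = "arr s ''s'' 0" and ?k = "arr s ''c'' i"
        have S: "Src n z s" and i: "i < n" "i \<noteq> ?src" and k: "?k > 0" and "rarr s ''x'' 0 \<ge> 0"
          and eq: "rarr s ''x'' 0 + (real ?k - 1) * (- dmd z ?src) = real (n * n) * dmd z i"
          using W unfolding y by auto
        then have "(real ?k - 1) * (- dmd z ?src) \<le> real (n * n) * dmd z i" by linarith
        also have "\<dots> \<le> real (n * n) * (- dmd z ?src)"
          using demand_le[of "dmd z" n ?src i] SrcD[OF S] i by (intro mult_left_mono) auto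
        finally have "real ?k - 1 \<le> real (n * n)" using SrcD(5)[OF S] by (simp add: mult_le_cancel_right)
        then have "real ?k \<le> real (n * n + 1)" by simp
        then show ?thesis unfolding y of_nat_le_iff by simp
      qed
      show "hoare (\<lambda>n y s. ?X n y s (real (n * n))) (Seq (NAssign ''c'' (var ''i'') (NConst 1))
        (count_quotient))
     (scaling_post Q)"
      proof (rule hoare_Seq)
        show "hoare (\<lambda>n y s. ?X n y s (real (n * n))) (NAssign ''c'' (var ''i'') (NConst 1)) ?W"
          by (rule hoare_straight) (auto simp: SrcD(6))
        show "hoare ?W (count_quotient)
     (scaling_post Q)" (is "hoare _ (While ?b ?c) ?R")
        proof (rule hoare_While_straight[where V = "\<lambda>n y s. n * n + 2 - arr s ''c'' (snd (snd y))"
                and g = "\<lambda>n. n * n + 2"])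
          fix n y s assume W: "?W n y s" and b: "bval ?b s"
          have W': "?W n y (eff ?c s)"
            using W b by (auto simp: algebra_simps split: prod.splits)
          moreover from W_bound[OF W'] have "arr s ''c'' (snd (snd y)) + 1 \<le> n * n + 1"
            using W by (auto split: prod.splits)
          moreover have "arr (eff ?c s) ''c'' (snd (snd y)) = arr s ''c'' (snd (snd y)) + 1"
            using W by (auto split: prod.splits)
          ultimately show "?W n y (eff ?c s) \<and>
              n * n + 2 - arr (eff ?c s) ''c'' (snd (snd y)) < n * n + 2 - arr s ''c'' (snd (snd y))"
            by simp
        next
          fix n y s assume W: "?W n y s" and nb: "\<not> bval ?b s"
          obtain z c i where y: "y = (z, c, i)" by (metis surj_pair)
          have "arr s ''c'' i \<le> n * n + 1" using W_bound[OF W] y by simp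
          then show "?R n y s" using W nb unfolding y by (auto simp: scaled_at_def algebra_simps)
        qed (simp_all, intro poly_bounded_intros)
      qed
    qed
  qed
qed

lemma scale_demands:
  "hoare (\<lambda>n z s. Src n z s \<and> Zero s) scale_demands
     (\<lambda>n z s. Src n z s \<and> Zero s \<and> (\<forall>v<n. scaled_at n (arr s ''s'' 0) (dmd z) v (arr s ''c'' v)) \<and>
        (\<forall>v<n. arr s ''e'' v = arr s ''c'' v) \<and> arr s ''N'' 0 = (\<Sum>v<n. arr s ''c'' v))"
proof -
  let ?J = "\<lambda>n z M k s. Src n z s \<and> Zero s \<and> rarr s ''D'' 0 = - dmd z (arr s ''s'' 0) \<and> M = n \<and>
      (\<forall>v<k. scaled_at n (arr s ''s'' 0) (dmd z) v (arr s ''c'' v)) \<and>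
      (\<forall>v<k. arr s ''e'' v = arr s ''c'' v) \<and> arr s ''N'' 0 = (\<Sum>v<k. arr s ''c'' v)"
  let ?A1 = "\<lambda>n z M k s. ?J n z M k s \<and> arr s ''i'' 0 = k \<and> k < M \<and> arr s ''c'' k = 0"
  let ?A2 = "\<lambda>n z M k s. ?J n z M k s \<and> arr s ''i'' 0 = k \<and> k < M \<and>
      scaled_at n (arr s ''s'' 0) (dmd z) k (arr s ''c'' k)"
  have cond: "hoare (\<lambda>n (z, M, k) s. ?A1 n z M k s) (If (NEq (var ''i'') (var ''s'')) Skip scale_demand)
      (\<lambda>n (z, M, k) s. ?A2 n z M k s)"
  proof (rule hoare_If)
    show "hoare (\<lambda>n x s. (case x of (z, M, k) \<Rightarrow> \<lambda>s. ?A1 n z M k s) s \<and> bval (NEq (var ''i'') (var ''s'')) s)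
        Skip (\<lambda>n (z, M, k) s. ?A2 n z M k s)"
      by (rule hoare_straight) (auto simp: scaled_at_def)
    \<comment> \<open>The facts about the vertices already treated pass through
      \<open>scale_demand\<close> as its arbitrary relation.\<close>
    let ?Q = "\<lambda>n z c k e N src. (\<forall>v<k. scaled_at n src (dmd z) v (c v)) \<and> (\<forall>v<k. e v = c v) \<and> N = (\<Sum>v<k. c v)"
    show "hoare (\<lambda>n x s. (case x of (z, M, k) \<Rightarrow> \<lambda>s. ?A1 n z M k s) s \<and> \<not> bval (NEq (var ''i'') (var ''s'')) s)
        scale_demand (\<lambda>n (z, M, k) s. ?A2 n z M k s)"
    proof (rule hoare_conseq[OF scale_demand[of ?Q]])
      fix n s and x :: "dnr_data \<times> nat \<times> nat"
      obtain z M k where x: "x = (z, M, k)" by (metis surj_pair)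
      assume *: "(case x of (z, M, k) \<Rightarrow> \<lambda>s. ?A1 n z M k s) s \<and> \<not> bval (NEq (var ''i'') (var ''s'')) s"
      have **: "?A1 n z M k s" "k \<noteq> arr s ''s'' 0" using * unfolding x by simp_all
      show "\<exists>y. scaling_pre ?Q n y s \<and>
         (\<forall>s'. scaling_post ?Q n y s' \<longrightarrow>
           (case x of (z, M, k) \<Rightarrow> \<lambda>s. ?A2 n z M k s) s')"
      proof (intro exI[of _ "(z, arr s ''c'', k)"] conjI allI impI)
        fix s'
        assume a: "scaling_post ?Q n (z, arr s ''c'', k) s'"
        then have "arr s' ''c'' v = arr s ''c'' v" if "v < k" for v using that by simp
        moreover from this have "(\<Sum>v<k. arr s' ''c'' v) = (\<Sum>v<k. arr s ''c'' v)" by simp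
        ultimately show "(case x of (z, M, k) \<Rightarrow> \<lambda>s. ?A2 n z M k s) s'"
          using a ** unfolding x by simp
      qed (use ** in simp)
    qed
  qed
  have "hoare (\<lambda>n z s. ?J n z n 0 s) (For ''i'' (var ''n'')
        set_demand)
     (\<lambda>n z s. ?J n z n n s)"
  proof (rule hoare_For[where I = ?J, OF _ poly_bounded_id])
    show "hoare (\<lambda>n (z, M, k) s. ?J n z M k s \<and> arr s ''i'' 0 = k \<and> k < M)
      set_demand
      (\<lambda>n (z, M, k) s. ?J n z M (Suc k) (nupd ''i'' 0 (Suc k) s) \<and> arr s ''i'' 0 = k)"
    proof (rule hoare_Seq[OF _ hoare_Seq[OF cond]])
      show "hoare (\<lambda>n (z, M, k) s. ?J n z M k s \<and> arr s ''i'' 0 = k \<and> k < M)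
        (NAssign ''c'' (var ''i'') (NConst 0)) (\<lambda>n (z, M, k) s. ?A1 n z M k s)"
        by (rule hoare_straight) auto
      show "hoare (\<lambda>n (z, M, k) s. ?A2 n z M k s)
        (Seq (NAssign ''e'' (var ''i'') (NRead ''c'' (var ''i'')))
             (inc ''N'' (NConst 0) (NRead ''c'' (var ''i''))))
        (\<lambda>n (z, M, k) s. ?J n z M (Suc k) (nupd ''i'' 0 (Suc k) s) \<and> arr s ''i'' 0 = k)"
        by (rule hoare_straight) (auto simp: less_Suc_eq)
    qed
  qed (auto dest: SrcD(2))
  moreover have "hoare (\<lambda>n z s. Src n z s \<and> Zero s \<and> rarr s ''D'' 0 = - dmd z (arr s ''s'' 0))
      (put ''N'' (NConst 0)) (\<lambda>n z s. ?J n z n 0 s)"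
    by (rule hoare_straight) auto
  moreover have "hoare (\<lambda>n z s. Src n z s \<and> Zero s)
      (put_real ''D'' (RSub (ROfNat (NConst 0)) (RRead ''d'' (var ''s''))))
      (\<lambda>n z s. Src n z s \<and> Zero s \<and> rarr s ''D'' 0 = - dmd z (arr s ''s'' 0))"
    by (rule hoare_straight) (auto simp: SrcD(4,7))
  ultimately have "hoare (\<lambda>n z s. Src n z s \<and> Zero s) scale_demands (\<lambda>n z s. ?J n z n n s)"
    unfolding scale_demands_def using hoare_Seq by blast
  then show ?thesis by (rule hoare_conseq) blast
qed

lemma slot_bases:
  "hoare (\<lambda>n z s. Src n z s \<and> Zero s \<and> (\<forall>v<n. scaled_at n (arr s ''s'' 0) (dmd z) v (arr s ''c'' v)) \<and>
        (\<forall>v<n. arr s ''e'' v = arr s ''c'' v) \<and> arr s ''N'' 0 = (\<Sum>v<n. arr s ''c'' v)) slot_bases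
     (\<lambda>n z s. Dem n z s \<and> Zero s \<and> (\<forall>v<n. arr s ''e'' v = arr s ''c'' v))"
  unfolding slot_bases_def
proof (rule hoare_Seq)
  let ?P = "\<lambda>n z s. Src n z s \<and> Zero s \<and> (\<forall>v<n. scaled_at n (arr s ''s'' 0) (dmd z) v (arr s ''c'' v)) \<and>
        (\<forall>v<n. arr s ''e'' v = arr s ''c'' v) \<and> arr s ''N'' 0 = (\<Sum>v<n. arr s ''c'' v)"
  show "hoare ?P (put ''q'' (NConst 0)) (\<lambda>n z s. ?P n z s \<and> arr s ''q'' 0 = 0)"
    by (rule hoare_straight) auto
  show "hoare (\<lambda>n z s. ?P n z s \<and> arr s ''q'' 0 = 0) (For ''i'' (var ''n'')
     (Seq (NAssign ''B'' (var ''i'') (var ''q'')) (inc ''q'' (NConst 0) (var ''N''))))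
     (\<lambda>n z s. Dem n z s \<and> Zero s \<and> (\<forall>v<n. arr s ''e'' v = arr s ''c'' v))"
  proof (rule hoare_For_straight[where I = "\<lambda>n z M k s. ?P n z s \<and> M = n \<and>
        arr s ''q'' 0 = k * arr s ''N'' 0 \<and> (\<forall>i<k. arr s ''B'' i = i * arr s ''N'' 0)", OF _ _ poly_bounded_id])
    fix n z M s
    assume *: "?P n z s \<and> M = n \<and> arr s ''q'' 0 = M * arr s ''N'' 0 \<and> (\<forall>i<M. arr s ''B'' i = i * arr s ''N'' 0)"
    then have S: "Src n z s" and s1: "\<And>v. v < n \<Longrightarrow> scaled_at n (arr s ''s'' 0) (dmd z) v (arr s ''c'' v)" by blast+
    have "scaled n (arr s ''s'' 0) (dmd z) (arr s ''c'')"
      using s1 SrcD(4)[OF S] unfolding scaled_def scaled_at_def by (metis less_irrefl)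
    moreover have "arr s ''c'' v \<le> n * n + 1" if "v < n" for v
      using s1[OF that] by (auto simp: scaled_at_def split: if_splits)
    then have "(\<Sum>v<n. arr s ''c'' v) \<le> n * (n * n + 1)"
      using sum_bounded_above[of "{..<n}" "arr s ''c''" "n * n + 1"] by simp
    ultimately show "Dem n z s \<and> Zero s \<and> (\<forall>v<n. arr s ''e'' v = arr s ''c'' v)"
      using * unfolding Dem_def by metis
  qed (auto simp: less_Suc_eq dest: SrcD(2))
qed

section \<open>The flow phase: moving tokens and raising heights\<close>

definition push :: com where
  "push = Seq (NAssign ''b'' (NAdd (NRead ''B'' (var ''i'')) (NRead ''F'' (var ''i''))) (var ''u''))
     (Seq (inc ''F'' (var ''i'') (NConst 1)) (Seq (dec ''e'' (var ''i'')) (inc ''e'' (var ''u'') (NConst 1))))"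

text \<open>\<open>F\<close> is decremented first, so that \<open>B v + F v\<close> addresses the
  last slot, which moves into the gap.\<close>

definition give_back :: com where
  "give_back = Seq (dec ''F'' (var ''v''))
     (Seq (NAssign ''b'' (NAdd (NRead ''B'' (var ''v'')) (var ''y''))
        (NRead ''b'' (NAdd (NRead ''B'' (var ''v'')) (NRead ''F'' (var ''v'')))))
     (Seq (inc ''e'' (var ''v'') (NConst 1)) (dec ''e'' (var ''i''))))"

definition raise :: com where "raise = inc ''h'' (var ''i'') (NConst 1)"

abbreviation test_lower :: com where
  "test_lower \<equiv> If
     (BAnd (NLess (NConst 0) (NRead ''E'' (NAdd (NRead ''R'' (var ''i'')) (var ''j''))))
        (NLess (NAdd (NAdd (NRead ''h'' (var ''j'')) (NRead ''F'' (var ''i''))) (NConst 1)) (NRead ''h'' (var ''i''))))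
     (put ''u'' (var ''j'')) Skip"

text \<open>\<open>u = n\<close> encodes that no neighbour is low enough; \<open>find_slot\<close>
  uses \<open>v = n\<close> in the same way.\<close>

definition find_lower :: com where
  "find_lower = Seq (put ''u'' (var ''n'')) (For ''j'' (var ''n'') test_lower)"

abbreviation test_slot :: com where
  "test_slot \<equiv> If
     (BAnd (NEq (NRead ''b'' (NAdd (NRead ''B'' (var ''j'')) (var ''k''))) (var ''i''))
        (NEq (NRead ''h'' (var ''j'')) (NAdd (NAdd (NRead ''h'' (var ''i'')) (var ''k'')) (NConst 1))))
     (Seq (put ''v'' (var ''j'')) (put ''y'' (var ''k''))) Skip"

definition find_slot :: com where
  "find_slot = Seq (put ''v'' (var ''n'')) (For ''j'' (var ''n'') (For ''k'' (NRead ''F'' (var ''j'')) test_slot))"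

definition act :: com where
  "act = Seq find_lower (If (NLess (var ''u'') (var ''n'')) push
     (Seq find_slot (If (NLess (var ''v'') (var ''n'')) give_back raise)))"

abbreviation visit :: com where
  "visit \<equiv> If (BAnd (NLess (NConst 0) (NRead ''e'' (var ''i''))) (BNot (NEq (var ''i'') (var ''s''))))
     (Seq (put ''g'' (NConst 1)) act) Skip"

definition flow_phase :: com where
  "flow_phase = Seq (put ''g'' (NConst 1)) (While (NLess (NConst 0) (var ''g''))
     (Seq (put ''g'' (NConst 0)) (For ''i'' (var ''n'')
        visit)))"

definition slot :: "state \<Rightarrow> nat \<Rightarrow> nat \<Rightarrow> nat" where
  "slot s w k = arr s ''b'' (w * arr s ''N'' 0 + k)"

abbreviation adjacent :: "dnr_data \<Rightarrow> nat \<Rightarrow> nat \<Rightarrow> bool" where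
  "adjacent z \<equiv> \<lambda>w u. {w, u} \<in> gph z"

abbreviation state_net :: "nat \<Rightarrow> dnr_data \<Rightarrow> state \<Rightarrow> bool" where
  "state_net n z s \<equiv> token_flow n (arr s ''s'' 0) (adjacent z) (arr s ''c'')"

abbreviation state_inv :: "nat \<Rightarrow> dnr_data \<Rightarrow> state \<Rightarrow> bool" where
  "state_inv n z s \<equiv> token_flow.flow_inv n (arr s ''s'' 0) (adjacent z) (arr s ''c'')
     (arr s ''h'') (arr s ''e'') (arr s ''F'') (slot s)"

abbreviation clean :: "state \<Rightarrow> bool" where
  "clean s \<equiv> \<forall>x\<in>{''T'', ''A'', ''m''}. arr s x = (\<lambda>_. 0)"

definition Flow :: "nat \<Rightarrow> dnr_data \<Rightarrow> state \<Rightarrow> bool" where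
  "Flow n z s \<longleftrightarrow> Dem n z s \<and> clean s \<and>
     state_inv n z s"

definition prog :: "nat \<Rightarrow> state \<Rightarrow> nat" where
  "prog n s = token_flow.progress n (arr s ''c'') (arr s ''h'') (arr s ''e'') (arr s ''F'')"

lemma slot_nupd [simp]: "x \<notin> {''b'', ''N''} \<Longrightarrow> slot (nupd x i k s) = slot s"
  by (auto simp: slot_def fun_eq_iff)

lemma Flow_nupd [simp]:
  "x \<notin> {''n'', ''E'', ''R'', ''s'', ''c'', ''N'', ''B'', ''T'', ''A'', ''m'', ''h'', ''e'', ''F'', ''b''} \<Longrightarrow>
     Flow n z (nupd x i k s) = Flow n z s"
  by (auto simp: Flow_def)

lemma prog_nupd [simp]: "x \<notin> {''c'', ''h'', ''e'', ''F''} \<Longrightarrow> prog n (nupd x i k s) = prog n s"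
  by (auto simp: prog_def)

lemma DemD:
  assumes "Dem n z s"
  shows "Src n z s" "arr s ''n'' 0 = n" "\<And>i. i < n \<Longrightarrow> arr s ''R'' i = i * n" "arr s ''s'' 0 < n"
    "scaled n (arr s ''s'' 0) (dmd z) (arr s ''c'')" "arr s ''N'' 0 = (\<Sum>v<n. arr s ''c'' v)"
    "arr s ''N'' 0 \<le> n * (n * n + 1)" "\<And>i. i < n \<Longrightarrow> arr s ''B'' i = i * arr s ''N'' 0"
    "\<And>i j. i < n \<Longrightarrow> j < n \<Longrightarrow> arr s ''E'' (i * n + j) > 0 \<longleftrightarrow> {i, j} \<in> gph z"
  using assms SrcD(1-4)[of n z s] unfolding Dem_def Inst_def by auto

lemma Dem_token_flow:
  assumes "Dem n z s"
  shows "state_net n z s"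
proof
  show "arr s ''s'' 0 < n" by (rule DemD(4)[OF assms])
  show "arr s ''c'' (arr s ''s'' 0) = 0" using DemD(5)[OF assms] by (simp add: scaled_def)
  have inst: "dnr_instance {..<n} (gph z) (dmd z) (\<lambda>_. 1)"
    using SrcD(1)[OF DemD(1)[OF assms]] by (simp add: Inst_def)
  have conn: "connected_graph {..<n} (gph z)" using inst by (simp add: dnr_instance_def)
  have V: "x \<in> {..<n}" if "{x, y} \<in> gph z" for x y
  proof -
    have "\<forall>e\<in>gph z. \<exists>a b. a \<in> {..<n} \<and> b \<in> {..<n} \<and> a \<noteq> b \<and> e = {a, b}"
      using inst by (simp add: dnr_instance_def simple_graph_def)
    from bspec[OF this that] show ?thesis by (auto simp: doubleton_eq_iff)
  qed
  show "\<exists>par rank. rooted_tree {..<n} (arr s ''s'' 0) par rank \<and>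
      (\<forall>v<n. v \<noteq> arr s ''s'' 0 \<longrightarrow> {v, par v} \<in> gph z)"
  proof (rule connected_imp_parents[of "{..<n}" "arr s ''s'' 0" "gph z"])
    show "arr s ''s'' 0 \<in> {..<n}" using DemD(4)[OF assms] by simp
  qed (use conn V in auto)
qed

lemma slot_index:
  fixes k k' N :: nat
  assumes "k < N" "k' < N"
  shows "w * N + k = w' * N + k' \<longleftrightarrow> w = w' \<and> k = k'"
proof
  assume *: "w * N + k = w' * N + k'"
  have "w = (w * N + k) div N" "k = (w * N + k) mod N" using assms by auto
  moreover have "w' = (w' * N + k') div N" "k' = (w' * N + k') mod N" using assms by auto
  ultimately show "w = w' \<and> k = k'" using * by metis
qed simp

lemma FlowD:
  assumes "Flow n z s"
  shows "Dem n z s"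
    "state_inv n z s"
    "state_net n z s"
    "\<And>w. w < n \<Longrightarrow> w \<noteq> arr s ''s'' 0 \<Longrightarrow> arr s ''F'' w + arr s ''e'' w \<le> arr s ''N'' 0"
    "\<And>w. w < n \<Longrightarrow> arr s ''F'' w \<le> arr s ''N'' 0"
    "arr s ''F'' (arr s ''s'' 0) = 0"
proof -
  show D: "Dem n z s" and inv: "state_inv n z s"
    using assms by (auto simp: Flow_def)
  show tf: "state_net n z s"
    by (rule Dem_token_flow[OF D])
  interpret token_flow n "arr s ''s'' 0" "adjacent z" "arr s ''c''" by (rule tf)
  have N: "arr s ''N'' 0 = N" using DemD(6)[OF D] by (simp add: N_def)
  show *: "arr s ''F'' w + arr s ''e'' w \<le> arr s ''N'' 0" if "w < n" "w \<noteq> arr s ''s'' 0" for w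
    using throughput_le[OF inv that] N by simp
  show F0: "arr s ''F'' (arr s ''s'' 0) = 0" by (rule flow_invD(2)[OF inv])
  show "arr s ''F'' w \<le> arr s ''N'' 0" if "w < n" for w
    using *[of w] that F0 by (cases "w = arr s ''s'' 0") auto
qed

text \<open>Rows of \<open>b\<close> are separated only for indices below \<open>N\<close>. The
  throughput bound for the new flow shows that all its slots have such indices, so
  \<open>slot\<close> may assume this.\<close>

lemma FlowI:
  assumes "Dem n z s" "clean s"
    and inv: "token_flow.flow_inv n (arr s ''s'' 0) (adjacent z) (arr s ''c'')
       (arr s ''h'') (arr s ''e'') (arr s ''F'') b"
    and slot: "\<And>w k. w < n \<Longrightarrow> k < arr s ''F'' w \<Longrightarrow> k < arr s ''N'' 0 \<Longrightarrow> slot s w k = b w k"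
  shows "Flow n z s"
proof -
  interpret token_flow n "arr s ''s'' 0" "adjacent z" "arr s ''c''"
    by (rule Dem_token_flow[OF assms(1)])
  have N: "arr s ''N'' 0 = N" using DemD(6)[OF assms(1)] by (simp add: N_def)
  have "slot s w k = b w k" if "w < n" "k < arr s ''F'' w" for w k
  proof (rule slot[OF that])
    have "w \<noteq> arr s ''s'' 0" using flow_invD(2)[OF inv] that(2) by (cases "w = arr s ''s'' 0") auto
    then show "k < arr s ''N'' 0" using throughput_le[OF inv that(1)] that(2) N by simp
  qed
  from flow_inv_cong[OF inv this] show ?thesis using assms unfolding Flow_def by blast
qed

abbreviation lower :: "dnr_data \<Rightarrow> state \<Rightarrow> nat \<Rightarrow> nat \<Rightarrow> bool" where
  "lower z s w j \<equiv> {w, j} \<in> gph z \<and> arr s ''h'' j + arr s ''F'' w + 1 < arr s ''h'' w"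

abbreviation tight :: "state \<Rightarrow> nat \<Rightarrow> nat \<Rightarrow> nat \<Rightarrow> bool" where
  "tight s w x y \<equiv> slot s x y = w \<and> arr s ''h'' x = arr s ''h'' w + y + 1"

text \<open>The auxiliary \<open>v\<close> freezes the progress measure before the action, so that
  \<open>Done\<close> can state its decrease.\<close>

definition Act :: "nat \<Rightarrow> dnr_data \<times> nat \<times> nat \<Rightarrow> state \<Rightarrow> bool" where
  "Act n y s \<longleftrightarrow> (case y of (z, v, w) \<Rightarrow> Flow n z s \<and> arr s ''i'' 0 = w \<and> w < n \<and> w \<noteq> arr s ''s'' 0 \<and>
     arr s ''e'' w > 0 \<and> prog n s = v \<and> arr s ''g'' 0 = 1)"

lemma Act_nupd [simp]: "x \<in> {''u'', ''v'', ''y'', ''j'', ''k''} \<Longrightarrow> Act n y (nupd x i k s) = Act n y s"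
  by (cases y rule: prod_cases3) (elim insertE emptyE; simp add: Act_def)

lemma ActD:
  assumes "Act n (z, v, w) s"
  shows "Flow n z s" "arr s ''i'' 0 = w" "w < n" "w \<noteq> arr s ''s'' 0" "arr s ''e'' w > 0" "prog n s = v"
    "arr s ''g'' 0 = 1" "arr s ''n'' 0 = n"
  using assms DemD(2)[of n z s] FlowD(1)[of n z s] by (auto simp: Act_def)

definition Done :: "nat \<Rightarrow> dnr_data \<times> nat \<times> nat \<Rightarrow> state \<Rightarrow> bool" where
  "Done n y s \<longleftrightarrow> (case y of (z, v, w) \<Rightarrow> Flow n z s \<and> arr s ''i'' 0 = w \<and> prog n s < v \<and> arr s ''g'' 0 = 1)"

abbreviation none_lower :: "nat \<Rightarrow> dnr_data \<times> nat \<times> nat \<Rightarrow> state \<Rightarrow> bool" where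
  "none_lower n y s \<equiv> \<forall>j<n. \<not> lower (fst y) s (snd (snd y)) j"

abbreviation lower_found :: "nat \<Rightarrow> dnr_data \<times> nat \<times> nat \<Rightarrow> state \<Rightarrow> bool" where
  "lower_found n y s \<equiv> (let w = snd (snd y); z = fst y in
     (arr s ''u'' 0 < n \<and> lower z s w (arr s ''u'' 0)) \<or> (arr s ''u'' 0 = n \<and> (\<forall>j<n. \<not> lower z s w j)))"

abbreviation slot_found :: "nat \<Rightarrow> dnr_data \<times> nat \<times> nat \<Rightarrow> state \<Rightarrow> bool" where
  "slot_found n y s \<equiv> (let w = snd (snd y) in
     (arr s ''v'' 0 < n \<and> arr s ''y'' 0 < arr s ''F'' (arr s ''v'' 0) \<and> tight s w (arr s ''v'' 0) (arr s ''y'' 0)) \<or>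
     (arr s ''v'' 0 = n \<and> (\<forall>x<n. \<forall>y<arr s ''F'' x. \<not> tight s w x y)))"

lemma find_lower:
  "hoare Act find_lower (\<lambda>n y s. Act n y s \<and> lower_found n y s)"
  unfolding find_lower_def
proof (rule hoare_Seq)
  show "hoare Act (put ''u'' (var ''n'')) (\<lambda>n y s. Act n y s \<and> arr s ''u'' 0 = n)"
    by (rule hoare_straight) (auto dest: ActD(8))
  show "hoare (\<lambda>n y s. Act n y s \<and> arr s ''u'' 0 = n) (For ''j'' (var ''n'') test_lower)
   (\<lambda>n y s. Act n y s \<and> lower_found n y s)"
    (is "hoare _ (For _ _ (If ?b ?c _)) _")
  proof -
    let ?I = "\<lambda>n y M k s. Act n y s \<and> M = n \<and> (let w = snd (snd y); z = fst y in
     (arr s ''u'' 0 < n \<and> lower z s w (arr s ''u'' 0)) \<or> (arr s ''u'' 0 = n \<and> (\<forall>j<k. \<not> lower z s w j)))"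
    show ?thesis
    proof (rule hoare_For_straight[where I = ?I, OF _ _ poly_bounded_id])
      fix n M k s and y :: "dnr_data \<times> nat \<times> nat"
      obtain z v w where y: "y = (z, v, w)" by (metis surj_pair)
      assume I: "?I n y M k s" and k: "arr s ''j'' 0 = k" "k < M"
      have A: "Act n (z, v, w) s" using I y by simp
      have b: "bval ?b s \<longleftrightarrow> lower z s w k"
        using k I ActD[OF A] DemD(3,9)[OF FlowD(1)[OF ActD(1)[OF A]]] by simp
      show "?I n y M (Suc k) (nupd ''j'' 0 (Suc k) (eff (If ?b ?c Skip) s)) \<and>
          arr (eff (If ?b ?c Skip) s) ''j'' 0 = k"
        unfolding eff.simps b using I k y by (cases "lower z s w k") (auto simp: Let_def less_Suc_eq)
    qed (auto dest: ActD(8))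
  qed
qed

lemma find_slot:
  "hoare (\<lambda>n y s. Act n y s \<and> none_lower n y s) find_slot
     (\<lambda>n y s. Act n y s \<and> none_lower n y s \<and> slot_found n y s)"
  unfolding find_slot_def
proof (rule hoare_Seq)
  let ?A = "\<lambda>n y s. Act n y s \<and> none_lower n y s"
  let ?found = "\<lambda>n y s. arr s ''v'' 0 < n \<and> arr s ''y'' 0 < arr s ''F'' (arr s ''v'' 0) \<and>
      tight s (snd (snd y)) (arr s ''v'' 0) (arr s ''y'' 0)"
  let ?none = "\<lambda>n y s k. arr s ''v'' 0 = n \<and> (\<forall>x<k. \<forall>i<arr s ''F'' x. \<not> tight s (snd (snd y)) x i)"
  let ?I = "\<lambda>n y M k s. ?A n y s \<and> M = n \<and> (?found n y s \<or> ?none n y s k)"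
  show "hoare ?A (put ''v'' (var ''n'')) (\<lambda>n y s. ?A n y s \<and> arr s ''v'' 0 = n)"
    by (rule hoare_straight) (auto dest: ActD(8))
  show "hoare (\<lambda>n y s. ?A n y s \<and> arr s ''v'' 0 = n)
    (For ''j'' (var ''n'') (For ''k'' (NRead ''F'' (var ''j'')) test_slot))
    (\<lambda>n y s. Act n y s \<and> none_lower n y s \<and> slot_found n y s)"
    (is "hoare _ (For _ _ (For _ _ (If ?b ?c _))) _")
  proof (rule hoare_For[where I = ?I, OF _ poly_bounded_id])
    let ?I' = "\<lambda>n (y, M', j) M k s. ?A n y s \<and> M' = n \<and> j < n \<and> arr s ''j'' 0 = j \<and> M = arr s ''F'' j \<and>
        (?found n y s \<or> ?none n y s j \<and> (\<forall>i<k. \<not> tight s (snd (snd y)) j i))"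
    show "hoare (\<lambda>n (y, M, j) s. ?I n y M j s \<and> arr s ''j'' 0 = j \<and> j < M)
      (For ''k'' (NRead ''F'' (var ''j'')) (If ?b ?c Skip))
      (\<lambda>n (y, M, j) s. ?I n y M (Suc j) (nupd ''j'' 0 (Suc j) s) \<and> arr s ''j'' 0 = j)"
    proof (rule hoare_For_straight[where I = ?I' and g = "\<lambda>n. n * (n * n + 1)"])
      fix n M k s and x :: "(dnr_data \<times> nat \<times> nat) \<times> nat \<times> nat"
      obtain z v w M' j where x: "x = ((z, v, w), M', j)" by (metis surj_pair)
      assume I': "?I' n x M k s" and k: "arr s ''k'' 0 = k" "k < M"
      then have A: "Act n (z, v, w) s" and j: "j < n" "arr s ''j'' 0 = j" "M = arr s ''F'' j" unfolding x by auto
      have b: "bval ?b s \<longleftrightarrow> tight s w j k"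
        using k j ActD(2)[OF A] DemD(8)[OF FlowD(1)[OF ActD(1)[OF A]] j(1)] by (simp add: slot_def)
      show "?I' n x M (Suc k) (nupd ''k'' 0 (Suc k) (eff (If ?b ?c Skip) s)) \<and>
          arr (eff (If ?b ?c Skip) s) ''k'' 0 = k"
      proof (cases "tight s w j k")
        case True
        then show ?thesis using I' k j unfolding x eff.simps b by simp
      next
        case False
        then show ?thesis using I' k j unfolding x eff.simps b by (auto simp: less_Suc_eq)
      qed
    next
      show "poly_bounded (\<lambda>n. n * (n * n + 1))" by (intro poly_bounded_intros)
    next
      fix n M k s and x :: "(dnr_data \<times> nat \<times> nat) \<times> nat \<times> nat"
      obtain z v w M' j where x: "x = ((z, v, w), M', j)" by (metis surj_pair)
      assume I': "?I' n x M k s"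
      then have A: "Act n (z, v, w) s" and j: "j < n" "arr s ''j'' 0 = j" "M = arr s ''F'' j" unfolding x by auto
      note Fl = ActD(1)[OF A]
      show "nval (NRead ''F'' (var ''j'')) s = M \<and> M \<le> n * (n * n + 1)"
        using FlowD(5)[OF Fl j(1)] DemD(7)[OF FlowD(1)[OF Fl]] j by simp
    next
      fix n s and x :: "(dnr_data \<times> nat \<times> nat) \<times> nat \<times> nat"
      obtain y M' j where x: "x = (y, M', j)" by (metis surj_pair)
      assume "(case x of (y, M, j) \<Rightarrow> \<lambda>s. ?I n y M j s \<and> arr s ''j'' 0 = j \<and> j < M) s"
      then show "?I' n x (nval (NRead ''F'' (var ''j'')) s) 0 (nupd ''k'' 0 0 s)" unfolding x by simp
    next
      fix n M s and x :: "(dnr_data \<times> nat \<times> nat) \<times> nat \<times> nat"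
      obtain y M' j where x: "x = (y, M', j)" by (metis surj_pair)
      assume "?I' n x M M s"
      then show "(case x of (y, M, j) \<Rightarrow> \<lambda>s. ?I n y M (Suc j) (nupd ''j'' 0 (Suc j) s) \<and> arr s ''j'' 0 = j) s"
        unfolding x by (auto simp: less_Suc_eq)
    qed simp
  qed (auto dest: ActD(8))
qed

lemma push:
  "hoare (\<lambda>n y s. Act n y s \<and> arr s ''u'' 0 < n \<and> lower (fst y) s (snd (snd y)) (arr s ''u'' 0)) push Done"
proof (rule hoare_straight)
  fix n s and y :: "dnr_data \<times> nat \<times> nat"
  obtain z v w where y: "y = (z, v, w)" by (metis surj_pair)
  assume "Act n y s \<and> arr s ''u'' 0 < n \<and> lower (fst y) s (snd (snd y)) (arr s ''u'' 0)"
  then have A: "Act n (z, v, w) s" and u: "arr s ''u'' 0 < n" "lower z s w (arr s ''u'' 0)" unfolding y by auto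
  note A' = ActD[OF A]
  note F = FlowD[OF A'(1)]
  note D = DemD[OF F(1)]
  define u where "u = arr s ''u'' 0"
  let ?s = "eff push s"
  let ?N = "arr s ''N'' 0" and ?F = "arr s ''F''" and ?e = "arr s ''e''"
  \<comment> \<open>The token waiting at \<open>w\<close> leaves a free slot in the row of
    \<open>w\<close>.\<close>
  have Fw: "?F w < ?N" using F(4)[OF A'(3,4)] A'(5) by simp
  have st: "arr ?s = (arr s)(''b'' := (arr s ''b'')(w * ?N + ?F w := u), ''F'' := ?F(w := ?F w + 1),
      ''e'' := (?e(w := ?e w - 1))(u := ?e u + 1))"
    using A'(2) D(8)[OF A'(3)] u by (auto simp: push_def u_def fun_eq_iff)
  interpret token_flow n "arr s ''s'' 0" "adjacent z" "arr s ''c''" by (rule F(3))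
  have hu: "arr s ''h'' u + ?F w + 2 \<le> arr s ''h'' w" and adj: "{w, u} \<in> gph z" and un: "u < n"
    using u by (auto simp: u_def)
  note step = push_step[OF F(2) A'(3,4,5) un adj hu refl refl refl]
  have Dem': "Dem n z ?s" using F(1) by (auto simp: push_def)
  have "Flow n z ?s"
  proof (rule FlowI[OF Dem'])
    show "clean ?s" using A'(1) by (simp add: st Flow_def)
    show "token_flow.flow_inv n (arr ?s ''s'' 0) (adjacent z) (arr ?s ''c'') (arr ?s ''h'') (arr ?s ''e'')
       (arr ?s ''F'') (\<lambda>x k. if x = w \<and> k = ?F w then u else slot s x k)"
      using step(1) by (simp add: st)
    fix x k assume "x < n" "k < arr ?s ''F'' x" "k < arr ?s ''N'' 0"
    then have "k < ?N" by (simp add: st)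
    then show "slot ?s x k = (if x = w \<and> k = ?F w then u else slot s x k)"
      using slot_index[OF _ Fw, of k x w] by (simp add: slot_def st)
  qed
  moreover have "prog n ?s < v" using step(2) A'(6) by (simp add: prog_def st)
  ultimately show "Done n y ?s" unfolding y Done_def using A' by (simp add: st)
qed (simp add: push_def)

lemma give_back:
  "hoare (\<lambda>n y s. Act n y s \<and> none_lower n y s \<and> arr s ''v'' 0 < n \<and>
      arr s ''y'' 0 < arr s ''F'' (arr s ''v'' 0) \<and> tight s (snd (snd y)) (arr s ''v'' 0) (arr s ''y'' 0)) give_back Done"
proof (rule hoare_straight)
  fix n s and y' :: "dnr_data \<times> nat \<times> nat"
  obtain z v w where y: "y' = (z, v, w)" by (metis surj_pair)
  define x where "x = arr s ''v'' 0"
  define y where "y = arr s ''y'' 0"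
  let ?N = "arr s ''N'' 0" and ?F = "arr s ''F''" and ?e = "arr s ''e''"
  assume "Act n y' s \<and> (\<forall>j<n. \<not> lower (fst y') s (snd (snd y')) j) \<and> arr s ''v'' 0 < n \<and>
      arr s ''y'' 0 < arr s ''F'' (arr s ''v'' 0) \<and> tight s (snd (snd y')) (arr s ''v'' 0) (arr s ''y'' 0)"
  then have A: "Act n (z, v, w) s" and stuck: "\<And>j. j < n \<Longrightarrow> \<not> lower z s w j"
    and x: "x < n" "y < ?F x" "slot s x y = w" "arr s ''h'' x = arr s ''h'' w + y + 1"
    unfolding y x_def y_def by auto
  note A' = ActD[OF A]
  note F = FlowD[OF A'(1)]
  note D = DemD[OF F(1)]
  let ?s = "eff give_back s"
  have xw: "x \<noteq> w" using x by auto
  have yN: "y < ?N" using F(5)[OF x(1)] x by simp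
  have FN: "?F x - 1 < ?N" using F(5)[OF x(1)] x by simp
  have st: "arr ?s = (arr s)(''F'' := ?F(x := ?F x - 1), ''b'' := (arr s ''b'')(x * ?N + y := slot s x (?F x - 1)),
      ''e'' := (?e(x := ?e x + 1))(w := ?e w - 1))"
    using A'(2) D(8)[OF x(1)] xw by (auto simp: give_back_def x_def y_def slot_def fun_eq_iff)
  interpret token_flow n "arr s ''s'' 0" "adjacent z" "arr s ''c''" by (rule F(3))
  have stuck': "arr s ''h'' w \<le> arr s ''h'' u + ?F w + 1" if "u < n" "{w, u} \<in> gph z" for u
    using stuck[OF that(1)] that(2) by simp
  note step = return_step[OF F(2) A'(3,4,5) stuck' x refl refl refl]
  have Dem': "Dem n z ?s" using F(1) by (auto simp: give_back_def)
  have "Flow n z ?s"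
  proof (rule FlowI[OF Dem'])
    show "clean ?s" using A'(1) by (simp add: st Flow_def)
    show "token_flow.flow_inv n (arr ?s ''s'' 0) (adjacent z) (arr ?s ''c'') (arr ?s ''h'') (arr ?s ''e'')
       (arr ?s ''F'') (\<lambda>v k. if v = x \<and> k = y then slot s x (?F x - 1) else slot s v k)"
      using step(1) by (simp add: st)
    fix x' k assume "x' < n" "k < arr ?s ''F'' x'" "k < arr ?s ''N'' 0"
    then have "k < ?N" by (simp add: st)
    then show "slot ?s x' k = (if x' = x \<and> k = y then slot s x (?F x - 1) else slot s x' k)"
      using slot_index[OF _ yN, of k x' x] by (simp add: slot_def st)
  qed
  moreover have "prog n ?s < v" using step(2) A'(6) by (simp add: prog_def st)
  ultimately show "Done n y' ?s" unfolding y Done_def using A' by (simp add: st)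
qed (simp add: give_back_def)

lemma raise:
  "hoare (\<lambda>n y s. Act n y s \<and> none_lower n y s \<and>
      (\<forall>x<n. \<forall>i<arr s ''F'' x. \<not> tight s (snd (snd y)) x i)) raise Done"
proof (rule hoare_straight)
  fix n s and y :: "dnr_data \<times> nat \<times> nat"
  obtain z v w where y: "y = (z, v, w)" by (metis surj_pair)
  let ?F = "arr s ''F''"
  assume "Act n y s \<and> none_lower n y s \<and>
      (\<forall>x<n. \<forall>i<arr s ''F'' x. \<not> tight s (snd (snd y)) x i)"
  then have A: "Act n (z, v, w) s" and stuck: "\<And>j. j < n \<Longrightarrow> \<not> lower z s w j"
    and none: "\<And>x i. x < n \<Longrightarrow> i < ?F x \<Longrightarrow> \<not> tight s w x i" unfolding y by auto
  note A' = ActD[OF A]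
  note F = FlowD[OF A'(1)]
  let ?s = "eff raise s"
  have st: "arr ?s = (arr s)(''h'' := (arr s ''h'')(w := arr s ''h'' w + 1))"
    using A'(2) by (auto simp: raise_def)
  interpret token_flow n "arr s ''s'' 0" "adjacent z" "arr s ''c''" by (rule F(3))
  have stuck': "arr s ''h'' w \<le> arr s ''h'' u + ?F w + 1" if "u < n" "{w, u} \<in> gph z" for u
    using stuck[OF that(1)] that(2) by simp
  have none': "arr s ''h'' x \<noteq> arr s ''h'' w + i + 1" if "x < n" "i < ?F x" "slot s x i = w" for x i
    using none[OF that(1,2)] that(3) by simp
  note step = raise_step[OF F(2) A'(3,4,5) stuck' none' refl]
  have changed: "arr ?s ''h'' = (arr s ''h'')(w := arr s ''h'' w + 1)" by (simp add: st)
  have same: "arr ?s ''s'' = arr s ''s''" "arr ?s ''c'' = arr s ''c''" "arr ?s ''e'' = arr s ''e''"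
    "arr ?s ''F'' = arr s ''F''" "arr ?s ''b'' = arr s ''b''" "arr ?s ''N'' = arr s ''N''"
    by (simp_all add: st)
  have Dem': "Dem n z ?s" using F(1) by (auto simp: raise_def)
  have "Flow n z ?s"
  proof (rule FlowI[OF Dem'])
    show "clean ?s" using A'(1) by (simp add: st Flow_def)
    show "token_flow.flow_inv n (arr ?s ''s'' 0) (adjacent z) (arr ?s ''c'') (arr ?s ''h'') (arr ?s ''e'')
       (arr ?s ''F'') (slot s)"
      using step(1) unfolding same changed .
    show "slot ?s x k = slot s x k" for x k unfolding slot_def same ..
  qed
  moreover have "prog n ?s < v" using step(2) unfolding A'(6)[symmetric] prog_def same changed .
  moreover have "arr ?s ''i'' 0 = w" "arr ?s ''g'' 0 = 1" using A'(2,7) by (simp_all add: raise_def)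
  ultimately show "Done n y ?s" unfolding y Done_def by simp
qed (simp add: raise_def)

lemma act: "hoare Act act Done"
  unfolding act_def
proof (rule hoare_Seq[OF find_lower hoare_If[OF _ hoare_Seq[OF _ hoare_If]]])
  have n: "arr s ''n'' 0 = n" if "Act n y s" for n y s
    using ActD(8)[of n "fst y" "fst (snd y)" "snd (snd y)" s] that by simp
  show "hoare (\<lambda>n y s. (Act n y s \<and> lower_found n y s) \<and> bval (NLess (var ''u'') (var ''n'')) s) push Done"
  proof (rule hoare_pre[OF push])
    fix n y s assume *: "(Act n y s \<and> lower_found n y s) \<and> bval (NLess (var ''u'') (var ''n'')) s"
    then show "Act n y s \<and> arr s ''u'' 0 < n \<and> lower (fst y) s (snd (snd y)) (arr s ''u'' 0)"
      using n[of n y s] by (auto simp: Let_def)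
  qed
  show "hoare (\<lambda>n y s. (Act n y s \<and> lower_found n y s) \<and> \<not> bval (NLess (var ''u'') (var ''n'')) s) find_slot
     (\<lambda>n y s. Act n y s \<and> none_lower n y s \<and> slot_found n y s)"
  proof (rule hoare_pre[OF find_slot])
    fix n y s assume "(Act n y s \<and> lower_found n y s) \<and> \<not> bval (NLess (var ''u'') (var ''n'')) s"
    then show "Act n y s \<and> none_lower n y s" using n[of n y s] by (auto simp: Let_def)
  qed
  let ?P = "\<lambda>n y s. Act n y s \<and> none_lower n y s \<and> slot_found n y s"
  show "hoare (\<lambda>n y s. ?P n y s \<and> bval (NLess (var ''v'') (var ''n'')) s) give_back Done"
  proof (rule hoare_pre[OF give_back])
    fix n y s assume "?P n y s \<and> bval (NLess (var ''v'') (var ''n'')) s"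
    then show "Act n y s \<and> none_lower n y s \<and> arr s ''v'' 0 < n \<and>
      arr s ''y'' 0 < arr s ''F'' (arr s ''v'' 0) \<and> tight s (snd (snd y)) (arr s ''v'' 0) (arr s ''y'' 0)"
      using n[of n y s] by (auto simp: Let_def)
  qed
  show "hoare (\<lambda>n y s. ?P n y s \<and> \<not> bval (NLess (var ''v'') (var ''n'')) s) raise Done"
  proof (rule hoare_pre[OF raise])
    fix n y s assume "?P n y s \<and> \<not> bval (NLess (var ''v'') (var ''n'')) s"
    then show "Act n y s \<and> none_lower n y s \<and> (\<forall>x<n. \<forall>i<arr s ''F'' x. \<not> tight s (snd (snd y)) x i)"
      using n[of n y s] by (auto simp: Let_def)
  qed
qed

lemma prog_le:
  assumes "Flow n z s"
  defines "N \<equiv> n * (n * n + 1)"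
  shows "prog n s \<le> (2 * N + 1) * (n * (n * (N + 2))) + 2 * (N * (n * (N + 2))) + n * (N * N + 2 * N)"
proof -
  interpret token_flow n "arr s ''s'' 0" "adjacent z" "arr s ''c''" by (rule FlowD(3)[OF assms(1)])
  let ?N = "token_flow.N n (arr s ''c'')"
  have N: "?N \<le> N"
    using DemD(6,7)[OF FlowD(1)[OF assms(1)]] by (simp add: N_def assms(2))
  have "prog n s \<le> (2 * ?N + 1) * (n * (n * (?N + 2))) + 2 * (?N * (n * (?N + 2))) + n * (?N * ?N + 2 * ?N)"
    unfolding prog_def using progress_bound[OF FlowD(2)[OF assms(1)]] unfolding hmax_def .
  also have "\<dots> \<le> (2 * N + 1) * (n * (n * (N + 2))) + 2 * (N * (n * (N + 2))) + n * (N * N + 2 * N)"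
    using N by (intro add_mono mult_mono order.refl) simp_all
  finally show ?thesis .
qed

lemma flow_pass:
  "hoare (\<lambda>n (z, v) s. Flow n z s \<and> arr s ''g'' 0 = 0 \<and> prog n s < v)
     (For ''i'' (var ''n'')
        visit)
     (\<lambda>n (z, v) s. Flow n z s \<and> (arr s ''g'' 0 = 0 \<and> prog n s < v \<and>
         (\<forall>w<n. w \<noteq> arr s ''s'' 0 \<longrightarrow> arr s ''e'' w = 0) \<or> arr s ''g'' 0 = 1 \<and> prog n s + 1 < v))"
proof -
  \<comment> \<open>While \<open>g\<close> is \<open>0\<close> nothing has moved, so the vertices
    scanned so far are still without waiting tokens. After an action nothing is claimed about them,
    but \<open>prog\<close> has dropped further.\<close>
  let ?J = "\<lambda>n (z, v) M k s. Flow n z s \<and> M = n \<and> (arr s ''g'' 0 = 0 \<and> prog n s < v \<and>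
         (\<forall>w<k. w \<noteq> arr s ''s'' 0 \<longrightarrow> arr s ''e'' w = 0) \<or> arr s ''g'' 0 = 1 \<and> prog n s + 1 < v)"
  let ?pre = "\<lambda>n (y, M, k) s. ?J n y M k s \<and> arr s ''i'' 0 = k \<and> k < M"
  let ?post = "\<lambda>n (y, M, k) s. ?J n y M (Suc k) (nupd ''i'' 0 (Suc k) s) \<and> arr s ''i'' 0 = k"
  let ?b = "BAnd (NLess (NConst 0) (NRead ''e'' (var ''i''))) (BNot (NEq (var ''i'') (var ''s'')))"
  let ?K = "\<lambda>n ((z, v), M, k) s. Flow n z s \<and> arr s ''i'' 0 = k \<and> k < n \<and> M = n \<and> k \<noteq> arr s ''s'' 0 \<and>
       arr s ''e'' k > 0 \<and> prog n s < v \<and> arr s ''g'' 0 = 1"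
  have body: "hoare ?pre (If ?b (Seq (put ''g'' (NConst 1)) act) Skip) ?post"
  proof (rule hoare_If[OF hoare_Seq])
    show "hoare (\<lambda>n x s. ?pre n x s \<and> bval ?b s) (put ''g'' (NConst 1)) ?K"
      by (rule hoare_straight) auto
    show "hoare ?K act ?post"
    proof (rule hoare_conseq[OF act])
      fix n s and x :: "(dnr_data \<times> nat) \<times> nat \<times> nat"
      obtain z v M k where x: "x = ((z, v), M, k)" by (metis surj_pair)
      assume K: "?K n x s"
      show "\<exists>y. Act n y s \<and> (\<forall>s'. Done n y s' \<longrightarrow> ?post n x s')"
        using K unfolding x by (intro exI[of _ "(z, prog n s, k)"]) (auto simp: Act_def Done_def)
    qed
    show "hoare (\<lambda>n x s. ?pre n x s \<and> \<not> bval ?b s) Skip ?post"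
      by (rule hoare_straight) (auto simp: less_Suc_eq)
  qed
  show ?thesis
    by (rule hoare_For[where I = ?J, OF body poly_bounded_id]) (auto dest: DemD(2)[OF FlowD(1)])
qed

lemma flow_phase:
  "hoare (\<lambda>n z s. Dem n z s \<and> Zero s \<and> (\<forall>v<n. arr s ''e'' v = arr s ''c'' v)) flow_phase
     (\<lambda>n z s. Flow n z s \<and> (\<forall>w<n. w \<noteq> arr s ''s'' 0 \<longrightarrow> arr s ''e'' w = 0))"
  unfolding flow_phase_def
proof (rule hoare_Seq)
  let ?I = "\<lambda>n z s. Flow n z s \<and> arr s ''g'' 0 \<le> 1 \<and>
      (arr s ''g'' 0 = 0 \<longrightarrow> (\<forall>w<n. w \<noteq> arr s ''s'' 0 \<longrightarrow> arr s ''e'' w = 0))"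
  show "hoare (\<lambda>n z s. Dem n z s \<and> Zero s \<and> (\<forall>v<n. arr s ''e'' v = arr s ''c'' v)) (put ''g'' (NConst 1)) ?I"
  proof (rule hoare_straight)
    fix n z s assume *: "Dem n z s \<and> Zero s \<and> (\<forall>v<n. arr s ''e'' v = arr s ''c'' v)"
    interpret token_flow n "arr s ''s'' 0" "adjacent z" "arr s ''c''"
      by (rule Dem_token_flow) (use * in blast)
    have "flow_inv (arr s ''h'') (arr s ''e'') (arr s ''F'') (slot s)"
      using flow_inv_init[of "arr s ''e''" "slot s"] * by (simp add: Zero_def)
    then have "Flow n z s" using * by (simp add: Flow_def Zero_def)
    then show "?I n z (eff (put ''g'' (NConst 1)) s)" by simp
  qed simp
  let ?body = "Seq (put ''g'' (NConst 0)) (For ''i'' (var ''n'')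
        visit)"
  let ?b = "NLess (NConst 0) (var ''g'')"
  have "hoare ?I (While ?b ?body) (\<lambda>n z s. ?I n z s \<and> \<not> bval ?b s)"
  \<comment> \<open>A pass that acts lowers \<open>prog\<close>; the last, idle pass only lowers
    \<open>g\<close>. Their sum decreases in both cases.\<close>
  proof (rule hoare_While[where V = "\<lambda>n z s. prog n s + arr s ''g'' 0"])
    have "hoare (\<lambda>n (z, v) s. ?I n z s \<and> bval ?b s \<and> prog n s + arr s ''g'' 0 = v) (put ''g'' (NConst 0))
        (\<lambda>n (z, v) s. Flow n z s \<and> arr s ''g'' 0 = 0 \<and> prog n s < v)"
      by (rule hoare_straight) auto
    from hoare_Seq[OF this flow_pass]
    show "hoare (\<lambda>n (z, v) s. ?I n z s \<and> bval ?b s \<and> prog n s + arr s ''g'' 0 = v) ?body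
        (\<lambda>n (z, v) s. ?I n z s \<and> prog n s + arr s ''g'' 0 < v)"
    proof (rule hoare_conseq)
      fix n s and y :: "dnr_data \<times> nat"
      assume "(case y of (z, v) \<Rightarrow> \<lambda>s. ?I n z s \<and> bval ?b s \<and> prog n s + arr s ''g'' 0 = v) s"
      then show "\<exists>y'. (case y' of (z, v) \<Rightarrow> \<lambda>s. ?I n z s \<and> bval ?b s \<and> prog n s + arr s ''g'' 0 = v) s \<and>
        (\<forall>s'. (case y' of (z, v) \<Rightarrow> \<lambda>s. Flow n z s \<and> (arr s ''g'' 0 = 0 \<and> prog n s < v \<and>
         (\<forall>w<n. w \<noteq> arr s ''s'' 0 \<longrightarrow> arr s ''e'' w = 0) \<or> arr s ''g'' 0 = 1 \<and> prog n s + 1 < v)) s' \<longrightarrow>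
          (case y of (z, v) \<Rightarrow> \<lambda>s. ?I n z s \<and> prog n s + arr s ''g'' 0 < v) s')"
        by (intro exI[of _ y]) (cases y, auto)
    qed
    let ?N = "\<lambda>n. n * (n * n + 1) :: nat"
    show "poly_bounded (\<lambda>n. ((2 * ?N n + 1) * (n * (n * (?N n + 2))) + 2 * (?N n * (n * (?N n + 2))) +
        n * (?N n * ?N n + 2 * ?N n)) + 1)"
      by (intro poly_bounded_intros)
    fix n z s assume I: "?I n z s"
    then have "Flow n z s" and g: "arr s ''g'' 0 \<le> 1" by auto
    from add_mono[OF prog_le[OF this(1)] g]
    show "prog n s + arr s ''g'' 0 \<le> ((2 * ?N n + 1) * (n * (n * (?N n + 2))) + 2 * (?N n * (n * (?N n + 2))) +
        n * (?N n * ?N n + 2 * ?N n)) + 1" .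
  qed
  then show "hoare ?I (While ?b ?body)
    (\<lambda>n z s. Flow n z s \<and> (\<forall>w<n. w \<noteq> arr s ''s'' 0 \<longrightarrow> arr s ''e'' w = 0))"
    by (rule hoare_conseq) auto
qed

section \<open>The rounding phase: choosing \<open>mu\<close> and the parents\<close>

abbreviation add_square :: com where
  "add_square \<equiv> Seq (inc ''ph'' (NConst 0) (NRead ''F'' (var ''i''))) (inc ''wf'' (NConst 0) (NConst 1))"

definition sum_squares :: com where
  "sum_squares = Seq (put ''ph'' (NConst 0)) (Seq (put ''wf'' (NConst 0))
     (For ''i'' (var ''n'') (For ''k'' (NRead ''F'' (var ''i''))
        add_square)))"

text \<open>\<open>mu\<close> becomes the ceiling of \<open>\<Phi> / (\<Sum>w. F w)\<close>, with
  value \<open>0\<close> if there is no flow.\<close>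

definition find_mu :: com where
  "find_mu = Seq (put ''r'' (NConst 0)) (Seq (put ''mu'' (NConst 0)) (While (NLess (var ''r'') (var ''ph''))
     (Seq (inc ''r'' (NConst 0) (var ''wf'')) (inc ''mu'' (NConst 0) (NConst 1)))))"

text \<open>The sum bounds every single height and is still polynomial, so it can end the scan over
  the heights.\<close>

definition sum_heights :: com where
  "sum_heights = Seq (put ''hm'' (NConst 0))
     (For ''i'' (var ''n'') (inc ''hm'' (NConst 0) (NRead ''h'' (var ''i''))))"

definition target :: nexp where
  "target = NRead ''b'' (NAdd (NRead ''B'' (var ''i'')) (var ''k''))"

text \<open>Per token of the vertex to be attached, the part of the growth of the potential that
  depends on the parent \<open>x\<close>: the cross term in the square of the colour's load, and
  \<open>mu\<close> times the depth of \<open>x\<close>.\<close>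

definition key :: "nexp \<Rightarrow> nexp" where
  "key x = NAdd (NAdd (NRead ''A'' (NRead ''C'' x)) (NRead ''A'' (NRead ''C'' x))) (NRead ''m'' x)"

definition detach_tokens :: com where
  "detach_tokens = For ''k'' (NRead ''F'' (var ''i'')) (dec ''A'' (NRead ''C'' target))"

abbreviation test_best :: com where
  "test_best \<equiv> If (NLess (key target) (key (var ''u''))) (put ''u'' target) Skip"

definition find_best :: com where
  "find_best = Seq (put ''u'' (NRead ''b'' (NRead ''B'' (var ''i''))))
     (For ''k'' (NRead ''F'' (var ''i'')) test_best)"

definition link :: com where
  "link = Seq (NAssign ''T'' (NAdd (NRead ''R'' (var ''i'')) (var ''u'')) (NConst 1))
     (Seq (NAssign ''P'' (var ''i'') (var ''u''))
     (Seq (NAssign ''m'' (var ''i'') (NAdd (NRead ''m'' (var ''u'')) (var ''mu'')))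
     (Seq (If (NEq (var ''u'') (var ''s'')) (NAssign ''C'' (var ''i'') (var ''i''))
             (NAssign ''C'' (var ''i'') (NRead ''C'' (var ''u''))))
          (inc ''A'' (NRead ''C'' (var ''i'')) (NRead ''F'' (var ''i''))))))"

definition attach :: com where
  "attach = Seq detach_tokens (Seq find_best link)"

abbreviation round_visit :: com where
  "round_visit \<equiv> If (NEq (NRead ''h'' (var ''i'')) (NAdd (var ''p'') (NConst 1))) attach Skip"

text \<open>Targets are strictly lower than their senders, so a scan by increasing height attaches
  all targets of a vertex before the vertex itself.\<close>

definition round_phase :: com where
  "round_phase = Seq (NAssign ''C'' (var ''s'') (var ''s'')) (For ''p'' (var ''hm'') (For ''i'' (var ''n'')
     round_visit))"

definition Fin :: "nat \<Rightarrow> dnr_data \<Rightarrow> state \<Rightarrow> bool" where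
  "Fin n z s \<longleftrightarrow> Flow n z s \<and> (\<forall>w<n. w \<noteq> arr s ''s'' 0 \<longrightarrow> arr s ''e'' w = 0)"

lemma Fin_nupd [simp]:
  "x \<notin> {''n'', ''E'', ''R'', ''s'', ''c'', ''N'', ''B'', ''T'', ''A'', ''m'', ''h'', ''e'', ''F'', ''b''} \<Longrightarrow>
     Fin n z (nupd x i k s) = Fin n z s"
  by (auto simp: Fin_def)

lemma FinD:
  assumes "Fin n z s"
  shows "Flow n z s" "arr s ''n'' 0 = n" "\<And>w. w < n \<Longrightarrow> arr s ''F'' w \<le> n * (n * n + 1)"
proof -
  show F: "Flow n z s" using assms by (simp add: Fin_def)
  show "arr s ''n'' 0 = n" by (rule DemD(2)[OF FlowD(1)[OF F]])
  show "arr s ''F'' w \<le> n * (n * n + 1)" if "w < n" for w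
    using FlowD(5)[OF F that] DemD(7)[OF FlowD(1)[OF F]] by simp
qed

abbreviation sqs :: "nat \<Rightarrow> state \<Rightarrow> nat" where "sqs n s \<equiv> (\<Sum>w<n. arr s ''F'' w * arr s ''F'' w)"

abbreviation total :: "nat \<Rightarrow> state \<Rightarrow> nat" where "total n s \<equiv> (\<Sum>w<n. arr s ''F'' w)"

lemma poly_bounded_N: "poly_bounded (\<lambda>n. n * (n * n + 1))"
  by (intro poly_bounded_intros)

lemma sum_squares:
  "hoare Fin sum_squares (\<lambda>n z s. Fin n z s \<and> arr s ''ph'' 0 = sqs n s \<and> arr s ''wf'' 0 = total n s)"
  unfolding sum_squares_def
proof (rule hoare_Seq[OF _ hoare_Seq])
  show "hoare Fin (put ''ph'' (NConst 0)) (\<lambda>n z s. Fin n z s \<and> arr s ''ph'' 0 = 0)"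
    by (rule hoare_straight) auto
  show "hoare (\<lambda>n z s. Fin n z s \<and> arr s ''ph'' 0 = 0) (put ''wf'' (NConst 0))
      (\<lambda>n z s. Fin n z s \<and> arr s ''ph'' 0 = 0 \<and> arr s ''wf'' 0 = 0)"
    by (rule hoare_straight) auto
  let ?I = "\<lambda>n z M k s. Fin n z s \<and> M = n \<and> arr s ''ph'' 0 = sqs k s \<and> arr s ''wf'' 0 = total k s"
  show "hoare (\<lambda>n z s. Fin n z s \<and> arr s ''ph'' 0 = 0 \<and> arr s ''wf'' 0 = 0)
     (For ''i'' (var ''n'') (For ''k'' (NRead ''F'' (var ''i''))
        add_square))
     (\<lambda>n z s. Fin n z s \<and> arr s ''ph'' 0 = sqs n s \<and> arr s ''wf'' 0 = total n s)"
  proof (rule hoare_For[where I = ?I, OF _ poly_bounded_id])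
    let ?I' = "\<lambda>n (z, M', i) M k s. Fin n z s \<and> M' = n \<and> i < n \<and> arr s ''i'' 0 = i \<and> M = arr s ''F'' i \<and>
        arr s ''ph'' 0 = sqs i s + k * arr s ''F'' i \<and> arr s ''wf'' 0 = total i s + k"
    show "hoare (\<lambda>n (z, M, k) s. ?I n z M k s \<and> arr s ''i'' 0 = k \<and> k < M)
      (For ''k'' (NRead ''F'' (var ''i''))
        add_square)
      (\<lambda>n (z, M, k) s. ?I n z M (Suc k) (nupd ''i'' 0 (Suc k) s) \<and> arr s ''i'' 0 = k)"
      by (rule hoare_For_straight[where I = ?I', OF _ _ poly_bounded_N]) (auto simp: FinD(3)[simplified])
  qed (auto dest: FinD(2))
qed

lemma find_mu:
  "hoare (\<lambda>n z s. Fin n z s \<and> arr s ''ph'' 0 = sqs n s \<and> arr s ''wf'' 0 = total n s) find_mu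
     (\<lambda>n z s. Fin n z s \<and> sqs n s \<le> arr s ''mu'' 0 * total n s \<and> arr s ''mu'' 0 * total n s \<le> sqs n s + total n s)"
  unfolding find_mu_def
proof (rule hoare_Seq[OF _ hoare_Seq])
  let ?P = "\<lambda>n z s. Fin n z s \<and> arr s ''ph'' 0 = sqs n s \<and> arr s ''wf'' 0 = total n s"
  let ?I = "\<lambda>n z s. ?P n z s \<and> arr s ''r'' 0 = arr s ''mu'' 0 * total n s \<and> arr s ''r'' 0 \<le> sqs n s + total n s"
  show "hoare ?P (put ''r'' (NConst 0)) (\<lambda>n z s. ?P n z s \<and> arr s ''r'' 0 = 0)"
    by (rule hoare_straight) auto
  show "hoare (\<lambda>n z s. ?P n z s \<and> arr s ''r'' 0 = 0) (put ''mu'' (NConst 0)) ?I"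
    by (rule hoare_straight) auto
  show "hoare ?I (While (NLess (var ''r'') (var ''ph''))
     (Seq (inc ''r'' (NConst 0) (var ''wf'')) (inc ''mu'' (NConst 0) (NConst 1))))
     (\<lambda>n z s. Fin n z s \<and> sqs n s \<le> arr s ''mu'' 0 * total n s \<and> arr s ''mu'' 0 * total n s \<le> sqs n s + total n s)"
    (is "hoare _ (While ?b ?c) _")
  proof (rule hoare_While_straight[where V = "\<lambda>n z s. sqs n s - arr s ''r'' 0"])
    fix n z s assume I: "?I n z s" and b: "bval ?b s"
    \<comment> \<open>Without flow, \<open>ph\<close> would be \<open>0\<close> as well and the
      guard false; so each round increases \<open>r\<close>.\<close>
    have "total n s > 0"
    proof (rule ccontr)
      assume "\<not> total n s > 0"
      then have "\<forall>w<n. arr s ''F'' w = 0" by auto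
      then have "sqs n s = 0" by simp
      then show False using I b by simp
    qed
    then show "?I n z (eff ?c s) \<and> sqs n (eff ?c s) - arr (eff ?c s) ''r'' 0 < sqs n s - arr s ''r'' 0"
      using I b by simp
  next
    show "poly_bounded (\<lambda>n. n * ((n * (n * n + 1)) * (n * (n * n + 1))))" by (intro poly_bounded_intros)
    fix n z s assume I: "?I n z s"
    have "sqs n s \<le> n * ((n * (n * n + 1)) * (n * (n * n + 1)))"
      using sum_bounded_above[of "{..<n}" "\<lambda>w. arr s ''F'' w * arr s ''F'' w" "(n * (n * n + 1)) * (n * (n * n + 1))"]
        FinD(3)[of n z s] I mult_le_mono by (simp del: mult_Suc_right)
    then show "sqs n s - arr s ''r'' 0 \<le> n * ((n * (n * n + 1)) * (n * (n * n + 1)))" by linarith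
  qed auto
qed

text \<open>What the rounding phase only reads. The arrays \<open>T\<close>, \<open>A\<close> and
  \<open>m\<close>, which \<open>Flow\<close> requires to be zero, are left free.\<close>

definition Stat :: "nat \<Rightarrow> dnr_data \<Rightarrow> state \<Rightarrow> bool" where
  "Stat n z s \<longleftrightarrow> Dem n z s \<and>
     state_inv n z s \<and>
     (\<forall>w<n. w \<noteq> arr s ''s'' 0 \<longrightarrow> arr s ''e'' w = 0) \<and>
     sqs n s \<le> arr s ''mu'' 0 * total n s \<and> arr s ''mu'' 0 * total n s \<le> sqs n s + total n s \<and>
     arr s ''hm'' 0 = (\<Sum>v<n. arr s ''h'' v)"

lemma Stat_nupd [simp]:
  "x \<notin> {''n'', ''E'', ''R'', ''s'', ''c'', ''N'', ''B'', ''h'', ''e'', ''F'', ''b'', ''mu'', ''hm''} \<Longrightarrow>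
     Stat n z (nupd x i k s) = Stat n z s"
  by (simp add: Stat_def eq_commute[of _ x])

lemma sum_heights:
  "hoare (\<lambda>n z s. Fin n z s \<and> sqs n s \<le> arr s ''mu'' 0 * total n s \<and>
       arr s ''mu'' 0 * total n s \<le> sqs n s + total n s) sum_heights
     (\<lambda>n z s. Stat n z s \<and> clean s)"
  unfolding sum_heights_def
proof (rule hoare_Seq)
  let ?P = "\<lambda>n z s. Fin n z s \<and> sqs n s \<le> arr s ''mu'' 0 * total n s \<and>
       arr s ''mu'' 0 * total n s \<le> sqs n s + total n s"
  show "hoare ?P (put ''hm'' (NConst 0)) (\<lambda>n z s. ?P n z s \<and> arr s ''hm'' 0 = 0)"
    by (rule hoare_straight) auto
  show "hoare (\<lambda>n z s. ?P n z s \<and> arr s ''hm'' 0 = 0)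
      (For ''i'' (var ''n'') (inc ''hm'' (NConst 0) (NRead ''h'' (var ''i''))))
      (\<lambda>n z s. Stat n z s \<and> clean s)"
    by (rule hoare_For_straight[where I = "\<lambda>n z M k s. ?P n z s \<and> M = n \<and> arr s ''hm'' 0 = (\<Sum>v<k. arr s ''h'' v)",
          OF _ _ poly_bounded_id])
      (auto simp: Stat_def Fin_def Flow_def DemD(2))
qed

lemma Stat_rounding:
  assumes "Stat n z s"
  shows "rounding n (arr s ''s'' 0) (adjacent z) (arr s ''c'') (arr s ''h'') (arr s ''e'') (arr s ''F'') (slot s)"
proof -
  have D: "Dem n z s" using assms by (simp add: Stat_def)
  interpret token_flow n "arr s ''s'' 0" "adjacent z" "arr s ''c''" by (rule Dem_token_flow[OF D])
  show ?thesis
    by unfold_locales (use assms DemD(5)[OF D] in \<open>auto simp: Stat_def scaled_def\<close>)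
qed

lemma StatD:
  assumes "Stat n z s"
  shows "Dem n z s" "state_inv n z s"
    "arr s ''n'' 0 = n" "\<And>w. w < n \<Longrightarrow> arr s ''F'' w \<le> n * (n * n + 1)"
    "arr s ''hm'' 0 \<le> n * (n * (n * (n * n + 1) + 2))" "arr s ''h'' (arr s ''s'' 0) = 0"
    "\<And>w. w < n \<Longrightarrow> w \<noteq> arr s ''s'' 0 \<Longrightarrow> arr s ''F'' w > 0"
    "\<And>w k. w < n \<Longrightarrow> k < arr s ''F'' w \<Longrightarrow> slot s w k < n \<and> arr s ''h'' (slot s w k) < arr s ''h'' w"
    "\<And>w. w < n \<Longrightarrow> arr s ''h'' w \<le> arr s ''hm'' 0"
proof -
  show D: "Dem n z s" and inv: "state_inv n z s"
    using assms by (auto simp: Stat_def)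
  interpret rounding n "arr s ''s'' 0" "adjacent z" "arr s ''c''" "arr s ''h''" "arr s ''e''" "arr s ''F''" "slot s"
    by (rule Stat_rounding[OF assms])
  show "arr s ''n'' 0 = n" by (rule DemD(2)[OF D])
  have N: "arr s ''N'' 0 = N" using DemD(6)[OF D] by (simp add: N_def)
  have F0: "arr s ''F'' (arr s ''s'' 0) = 0" by (rule flow_invD(2)[OF inv])
  show "arr s ''F'' w \<le> n * (n * n + 1)" if "w < n" for w
    using throughput_le[OF inv that] F0 N DemD(7)[OF D] by (cases "w = arr s ''s'' 0") auto
  have "arr s ''h'' v \<le> n * (n * (n * n + 1) + 2)" if "v < n" for v
  proof -
    have "arr s ''h'' v \<le> n * (N + 2)" using height_le[OF inv that] by (simp add: hmax_def)
    also have "\<dots> \<le> n * (n * (n * n + 1) + 2)" using DemD(7)[OF D] N by (intro mult_left_mono) simp_all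
    finally show ?thesis .
  qed
  then show "arr s ''hm'' 0 \<le> n * (n * (n * (n * n + 1) + 2))"
    using sum_bounded_above[of "{..<n}" "arr s ''h''" "n * (n * (n * n + 1) + 2)"] assms by (simp add: Stat_def)
  show "arr s ''h'' (arr s ''s'' 0) = 0" by (rule flow_invD(1)[OF inv])
  show "arr s ''F'' w > 0" if "w < n" "w \<noteq> arr s ''s'' 0" for w using F_pos[OF that] .
  show "slot s w k < n \<and> arr s ''h'' (slot s w k) < arr s ''h'' w" if "w < n" "k < arr s ''F'' w" for w k
    using flow_invD(3,5)[OF inv that] by simp
  show "arr s ''h'' w \<le> arr s ''hm'' 0" if "w < n" for w
    using member_le_sum[of w "{..<n}" "arr s ''h''"] that assms by (simp add: Stat_def)
qed

text \<open>The vertices that have been attached when the vertices of height \<open>p + 1\<close> below \<open>i\<close> have been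
  processed.\<close>

definition lev :: "nat \<Rightarrow> state \<Rightarrow> nat \<Rightarrow> nat \<Rightarrow> nat set" where
  "lev n s p i = {v. v < n \<and> v \<noteq> arr s ''s'' 0 \<and> (arr s ''h'' v \<le> p \<or> arr s ''h'' v = p + 1 \<and> v < i)}"

text \<open>The loads \<open>A\<close> are a parameter, because between \<open>detach_tokens\<close>
  and \<open>link\<close> the array of that name holds the reduced loads \<open>A1\<close> of
  \<open>round_step\<close>.\<close>

definition Rnd :: "nat \<Rightarrow> nat set \<Rightarrow> (nat \<Rightarrow> nat) \<Rightarrow> state \<Rightarrow> bool" where
  "Rnd n S A s \<longleftrightarrow> rounding.round_inv n (arr s ''s'' 0) (arr s ''c'') (arr s ''F'') (slot s) (arr s ''mu'' 0) S
       (arr s ''P'') (arr s ''C'') (arr s ''m'') A \<and>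
     (\<forall>i<n. \<forall>j<n. arr s ''T'' (i * n + j) \<noteq> 0 \<longleftrightarrow> i \<in> S \<and> arr s ''P'' i = j)"


lemma lev_nupd [simp]: "x \<notin> {''s'', ''h''} \<Longrightarrow> lev n (nupd x i k s) = lev n s"
  by (auto simp: lev_def fun_eq_iff)

lemma Rnd_nupd [simp]:
  "x \<notin> {''s'', ''c'', ''F'', ''b'', ''N'', ''mu'', ''P'', ''C'', ''m'', ''T''} \<Longrightarrow> Rnd n S A (nupd x i k s) = Rnd n S A s"
  by (simp add: Rnd_def eq_commute[of _ x])

type_synonym attach_aux = "dnr_data \<times> nat \<times> nat \<times> (nat \<Rightarrow> nat)"

definition Att :: "nat \<Rightarrow> attach_aux \<Rightarrow> state \<Rightarrow> bool" where
  "Att n y s \<longleftrightarrow> (case y of (z, p, w, A) \<Rightarrow> Stat n z s \<and> arr s ''i'' 0 = w \<and> arr s ''p'' 0 = p \<and> w < n \<and>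
     arr s ''h'' w = p + 1 \<and> Rnd n (lev n s p w) A s)"

lemma Att_nupd [simp]: "x \<in> {''A'', ''u'', ''k''} \<Longrightarrow> Att n y (nupd x i k s) = Att n y s"
  by (cases y rule: prod_cases4) (elim insertE emptyE; simp add: Att_def)

lemma AttD:
  assumes "Att n (z, p, w, A) s"
  shows "Stat n z s" "arr s ''i'' 0 = w" "w < n" "w \<noteq> arr s ''s'' 0" "arr s ''p'' 0 = p"
    "arr s ''h'' w = p + 1" "Rnd n (lev n s p w) A s"
    "nval (NRead ''F'' (var ''i'')) s = arr s ''F'' w" "arr s ''F'' w \<le> n * (n * n + 1)" "arr s ''F'' w > 0"
    "nval target s = slot s w (arr s ''k'' 0)" "arr s ''B'' w = w * arr s ''N'' 0"
proof -
  show S: "Stat n z s" and i: "arr s ''i'' 0 = w" and w: "w < n" and "arr s ''p'' 0 = p"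
    and h: "arr s ''h'' w = p + 1" and "Rnd n (lev n s p w) A s"
    using assms by (auto simp: Att_def)
  show src: "w \<noteq> arr s ''s'' 0" using h StatD(6)[OF S] by auto
  show "nval (NRead ''F'' (var ''i'')) s = arr s ''F'' w" using i by simp
  show "arr s ''F'' w \<le> n * (n * n + 1)" by (rule StatD(4)[OF S w])
  show "arr s ''F'' w > 0" by (rule StatD(7)[OF S w src])
  show B: "arr s ''B'' w = w * arr s ''N'' 0" by (rule DemD(8)[OF StatD(1)[OF S] w])
  then show "nval target s = slot s w (arr s ''k'' 0)" using i by (simp add: target_def slot_def)
qed

abbreviation drained :: "state \<Rightarrow> (nat \<Rightarrow> nat) \<Rightarrow> nat \<Rightarrow> nat \<Rightarrow> nat \<Rightarrow> nat" where
  "drained s A w k \<equiv> \<lambda>a. A a - (\<Sum>j<k. of_bool (arr s ''C'' (slot s w j) = a))"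

abbreviation drained_all :: "attach_aux \<Rightarrow> state \<Rightarrow> bool" where
  "drained_all y s \<equiv> arr s ''A'' = drained s (snd (snd (snd y))) (fst (snd (snd y))) (arr s ''F'' (fst (snd (snd y))))"

lemma detach_tokens:
  "hoare (\<lambda>n y s. Att n y s \<and> arr s ''A'' = snd (snd (snd y))) detach_tokens
     (\<lambda>n y s. Att n y s \<and> drained_all y s)"
  unfolding detach_tokens_def
proof (rule hoare_For_straight[where g = "\<lambda>n. n * (n * n + 1)" and
    I = "\<lambda>n y M k s. Att n y s \<and> M = arr s ''F'' (fst (snd (snd y))) \<and>
      arr s ''A'' = drained s (snd (snd (snd y))) (fst (snd (snd y))) k"])
  fix n M k s and y :: attach_aux
  obtain z p w A where y: "y = (z, p, w, A)" by (metis prod_cases4)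
  assume I: "Att n y s \<and> M = arr s ''F'' (fst (snd (snd y))) \<and>
      arr s ''A'' = drained s (snd (snd (snd y))) (fst (snd (snd y))) k"
    and k: "arr s ''k'' 0 = k" "k < M"
  have At: "Att n (z, p, w, A) s" and AA: "arr s ''A'' = drained s A w k" using I y by auto
  have t: "nval target s = slot s w k" using AttD(11)[OF At] k by simp
  let ?c = "dec ''A'' (NRead ''C'' target)"
  have "eff ?c s = nupd ''A'' (arr s ''C'' (slot s w k)) (arr s ''A'' (arr s ''C'' (slot s w k)) - 1) s"
    by (simp add: t)
  \<comment> \<open>Truncated decrements one at a time agree with one truncated subtraction of their
    number.\<close>
  moreover have "(arr s ''A'')(arr s ''C'' (slot s w k) := arr s ''A'' (arr s ''C'' (slot s w k)) - 1) =
      drained s A w (Suc k)"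
    unfolding AA by (auto simp: fun_eq_iff)
  ultimately show "(Att n y (nupd ''k'' 0 (Suc k) (eff ?c s)) \<and>
      M = arr (nupd ''k'' 0 (Suc k) (eff ?c s)) ''F'' (fst (snd (snd y))) \<and>
      arr (nupd ''k'' 0 (Suc k) (eff ?c s)) ''A'' =
        drained (nupd ''k'' 0 (Suc k) (eff ?c s)) (snd (snd (snd y))) (fst (snd (snd y))) (Suc k)) \<and>
      arr (eff ?c s) ''k'' 0 = k"
    using I k unfolding y by simp
next
  show "poly_bounded (\<lambda>n. n * (n * n + 1))" by (rule poly_bounded_N)
next
  fix n M k s and y :: attach_aux
  obtain z p w A where y: "y = (z, p, w, A)" by (metis prod_cases4)
  assume I: "Att n y s \<and> M = arr s ''F'' (fst (snd (snd y))) \<and>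
      arr s ''A'' = drained s (snd (snd (snd y))) (fst (snd (snd y))) k"
  then have At: "Att n (z, p, w, A) s" by (simp add: y)
  show "nval (NRead ''F'' (var ''i'')) s = M \<and> M \<le> n * (n * n + 1)"
    using I AttD(8,9)[OF At] unfolding y by simp
next
  fix n s and y :: attach_aux
  obtain z p w A where y: "y = (z, p, w, A)" by (metis prod_cases4)
  assume *: "Att n y s \<and> arr s ''A'' = snd (snd (snd y))"
  then have At: "Att n (z, p, w, A) s" by (simp add: y)
  show "Att n y (nupd ''k'' 0 0 s) \<and>
      nval (NRead ''F'' (var ''i'')) s = arr (nupd ''k'' 0 0 s) ''F'' (fst (snd (snd y))) \<and>
      arr (nupd ''k'' 0 0 s) ''A'' = drained (nupd ''k'' 0 0 s) (snd (snd (snd y))) (fst (snd (snd y))) 0"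
    using * AttD(8)[OF At] unfolding y by simp
qed auto

abbreviation kval :: "state \<Rightarrow> nat \<Rightarrow> nat" where
  "kval s v \<equiv> 2 * arr s ''A'' (arr s ''C'' v) + arr s ''m'' v"

lemma find_best:
  "hoare (\<lambda>n y s. Att n y s \<and> drained_all y s) find_best
     (\<lambda>n y s. Att n y s \<and> drained_all y s \<and> (let w = fst (snd (snd y)) in
        (\<exists>k<arr s ''F'' w. arr s ''u'' 0 = slot s w k) \<and>
        (\<forall>k<arr s ''F'' w. kval s (arr s ''u'' 0) \<le> kval s (slot s w k))))"
  unfolding find_best_def
proof (rule hoare_Seq)
  let ?P = "\<lambda>n y s. Att n y s \<and> drained_all y s"
  let ?I = "\<lambda>n y M k s. ?P n y s \<and> M = arr s ''F'' (fst (snd (snd y))) \<and> (let w = fst (snd (snd y)) in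
        (\<exists>k<arr s ''F'' w. arr s ''u'' 0 = slot s w k) \<and>
        (\<forall>j<k. kval s (arr s ''u'' 0) \<le> kval s (slot s w j)))"
  let ?w = "\<lambda>y. fst (snd (snd y))"
  \<comment> \<open>Slot \<open>0\<close> is a legitimate first candidate because
    \<open>F w > 0\<close>.\<close>
  show "hoare ?P (put ''u'' (NRead ''b'' (NRead ''B'' (var ''i''))))
      (\<lambda>n y s. ?P n y s \<and> (\<exists>k<arr s ''F'' (?w y). arr s ''u'' 0 = slot s (?w y) k))"
  proof (rule hoare_straight)
    fix n s and y :: attach_aux
    obtain z p w A where y: "y = (z, p, w, A)" by (metis prod_cases4)
    assume *: "?P n y s"
    then have At: "Att n (z, p, w, A) s" by (simp add: y)
    let ?s = "eff (put ''u'' (NRead ''b'' (NRead ''B'' (var ''i'')))) s"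
    have "arr ?s ''u'' 0 = slot ?s w 0" using AttD(2,12)[OF At] by (simp add: slot_def)
    moreover have "arr ?s ''F'' w > 0" using AttD(10)[OF At] by simp
    ultimately have "\<exists>k<arr ?s ''F'' w. arr ?s ''u'' 0 = slot ?s w k" by blast
    moreover have "?P n y ?s" using * by simp
    ultimately show "?P n y ?s \<and> (\<exists>k<arr ?s ''F'' (?w y). arr ?s ''u'' 0 = slot ?s (?w y) k)"
      unfolding y by simp
  qed simp
  show "hoare (\<lambda>n y s. ?P n y s \<and> (\<exists>k<arr s ''F'' (?w y). arr s ''u'' 0 = slot s (?w y) k))
    (For ''k'' (NRead ''F'' (var ''i'')) test_best)
    (\<lambda>n y s. Att n y s \<and> drained_all y s \<and> (let w = fst (snd (snd y)) in
        (\<exists>k<arr s ''F'' w. arr s ''u'' 0 = slot s w k) \<and>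
        (\<forall>k<arr s ''F'' w. kval s (arr s ''u'' 0) \<le> kval s (slot s w k))))"
    (is "hoare _ (For _ _ (If ?b ?c _)) _")
  proof (rule hoare_For_straight[where I = ?I, OF _ _ poly_bounded_N])
    fix n M k s and y :: attach_aux
    obtain z p w A where y: "y = (z, p, w, A)" by (metis prod_cases4)
    assume I: "?I n y M k s" and k: "arr s ''k'' 0 = k" "k < M"
    then have At: "Att n (z, p, w, A) s" by (simp add: y)
    have t: "nval target s = slot s w k" using AttD(11)[OF At] k by simp
    have b: "bval ?b s \<longleftrightarrow> kval s (slot s w k) < kval s (arr s ''u'' 0)"
      by (simp add: key_def t mult_2)
    have kF: "k < arr s ''F'' w" using I k unfolding y by simp
    let ?s = "nupd ''k'' 0 (Suc k) (eff (If ?b ?c Skip) s)"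
    have s: "?s = nupd ''k'' 0 (Suc k) (if kval s (slot s w k) < kval s (arr s ''u'' 0)
      then nupd ''u'' 0 (slot s w k) s else s)"
      unfolding eff.simps b by (simp add: t)
    have i: "arr (eff (If ?b ?c Skip) s) ''k'' 0 = k" using k unfolding eff.simps b by simp
    have A: "arr s ''A'' = drained s A w (arr s ''F'' w)" and M: "M = arr s ''F'' w"
      and ex: "\<exists>k<arr s ''F'' w. arr s ''u'' 0 = slot s w k"
      and all: "\<forall>j<k. kval s (arr s ''u'' 0) \<le> kval s (slot s w j)"
      using I unfolding y Let_def fst_conv snd_conv by blast+
    have "?I n y M (Suc k) ?s"
    proof (cases "kval s (slot s w k) < kval s (arr s ''u'' 0)")
      case True
      let ?t = "nupd ''k'' 0 (Suc k) (nupd ''u'' 0 (slot s w k) s)"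
      have s': "?s = ?t" unfolding s using True by (simp only: if_True)
      have same: "arr ?t ''A'' = arr s ''A''" "arr ?t ''C'' = arr s ''C''" "arr ?t ''m'' = arr s ''m''"
        "arr ?t ''F'' = arr s ''F''" "slot ?t = slot s" "arr ?t ''u'' 0 = slot s w k" by simp_all
      have At': "Att n (z, p, w, A) ?t" using At by simp
      have "kval s (slot s w k) \<le> kval s (slot s w j)" if "j < Suc k" for j
      proof (cases "j = k")
        case False
        then have "j < k" using that by simp
        then have "kval s (arr s ''u'' 0) \<le> kval s (slot s w j)" using all by blast
        then show ?thesis using True by linarith
      qed simp
      then show ?thesis
        using A M kF At' unfolding s' y Let_def fst_conv snd_conv same by blast
    next
      case False
      let ?t = "nupd ''k'' 0 (Suc k) s"
      have s': "?s = ?t" unfolding s using False by (simp only: if_False)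
      have same: "arr ?t ''A'' = arr s ''A''" "arr ?t ''C'' = arr s ''C''" "arr ?t ''m'' = arr s ''m''"
        "arr ?t ''F'' = arr s ''F''" "slot ?t = slot s" "arr ?t ''u'' = arr s ''u''" by simp_all
      have At': "Att n (z, p, w, A) ?t" using At by simp
      have "kval s (arr s ''u'' 0) \<le> kval s (slot s w j)" if "j < Suc k" for j
      proof (cases "j = k")
        case True
        then show ?thesis using False by simp
      next
        case False
        then have "j < k" using that by simp
        then show ?thesis using all by blast
      qed
      then show ?thesis
        using A M ex At' unfolding s' y Let_def fst_conv snd_conv same by blast
    qed
    then show "?I n y M (Suc k) ?s \<and> arr (eff (If ?b ?c Skip) s) ''k'' 0 = k" using i by blast
  next
    fix n M k s and y :: attach_aux
    obtain z p w A where y: "y = (z, p, w, A)" by (metis prod_cases4)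
    assume I: "?I n y M k s"
    then have At: "Att n (z, p, w, A) s" by (simp add: y)
    show "nval (NRead ''F'' (var ''i'')) s = M \<and> M \<le> n * (n * n + 1)"
      using I AttD(8,9)[OF At] unfolding y by simp
  next
    fix n s and y :: attach_aux
    obtain z p w A where y: "y = (z, p, w, A)" by (metis prod_cases4)
    assume *: "?P n y s \<and> (\<exists>k<arr s ''F'' (?w y). arr s ''u'' 0 = slot s (?w y) k)"
    then have At: "Att n (z, p, w, A) s" by (simp add: y)
    show "?I n y (nval (NRead ''F'' (var ''i'')) s) 0 (nupd ''k'' 0 0 s)"
      using * AttD(8)[OF At] unfolding y by (simp add: Let_def)
  qed (auto simp: Let_def)
qed


lemma link:
  "hoare (\<lambda>n y s. Att n y s \<and> drained_all y s \<and> (let w = fst (snd (snd y)) in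
        (\<exists>k<arr s ''F'' w. arr s ''u'' 0 = slot s w k) \<and>
        (\<forall>k<arr s ''F'' w. kval s (arr s ''u'' 0) \<le> kval s (slot s w k)))) link
     (\<lambda>n (z, p, w, A) s. Stat n z s \<and> arr s ''i'' 0 = w \<and> arr s ''p'' 0 = p \<and>
        Rnd n (lev n s p (Suc w)) (arr s ''A'') s)"
proof (rule hoare_straight)
  fix n s and y :: attach_aux
  obtain z p w A where y: "y = (z, p, w, A)" by (metis prod_cases4)
  assume *: "Att n y s \<and> drained_all y s \<and> (let w = fst (snd (snd y)) in
        (\<exists>k<arr s ''F'' w. arr s ''u'' 0 = slot s w k) \<and>
        (\<forall>k<arr s ''F'' w. kval s (arr s ''u'' 0) \<le> kval s (slot s w k)))"
  define u where "u = arr s ''u'' 0"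
  have At: "Att n (z, p, w, A) s" and A1: "arr s ''A'' = drained s A w (arr s ''F'' w)"
    and best: "\<And>k. k < arr s ''F'' w \<Longrightarrow> kval s u \<le> kval s (slot s w k)"
    using * unfolding y u_def Let_def fst_conv snd_conv by blast+
  obtain k0 where k0: "k0 < arr s ''F'' w" "u = slot s w k0"
    using * unfolding y u_def Let_def fst_conv snd_conv by blast
  note a = AttD[OF At]
  note S = StatD[OF a(1)]
  have un: "u < n" using S(8)[OF a(3) k0(1)] k0(2) by simp
  let ?src = "arr s ''s'' 0"
  define C' where "C' = (arr s ''C'')(w := if u = ?src then w else arr s ''C'' u)"
  let ?s = "eff link s"
  have R: "arr s ''R'' w = w * n" by (rule DemD(3)[OF S(1) a(3)])
  have T: "arr ?s ''T'' = (arr s ''T'')(w * n + u := 1)"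
    and P: "arr ?s ''P'' = (arr s ''P'')(w := u)"
    and m: "arr ?s ''m'' = (arr s ''m'')(w := arr s ''m'' u + arr s ''mu'' 0)"
    and C: "arr ?s ''C'' = C'"
    and A: "arr ?s ''A'' = (arr s ''A'')(C' w := arr s ''A'' (C' w) + arr s ''F'' w)"
    and same: "arr ?s ''s'' = arr s ''s''" "arr ?s ''c'' = arr s ''c''" "arr ?s ''F'' = arr s ''F''"
      "slot ?s = slot s" "arr ?s ''mu'' = arr s ''mu''" "lev n ?s = lev n s"
    and stat: "Stat n z ?s" and ip: "arr ?s ''i'' 0 = w" "arr ?s ''p'' 0 = p"
    using a(1,2,5) R by (simp_all add: link_def u_def C'_def)
  interpret rounding n ?src "adjacent z" "arr s ''c''" "arr s ''h''" "arr s ''e''" "arr s ''F''" "slot s"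
      "arr s ''mu'' 0"
    by (rule Stat_rounding[OF a(1)])
  define L where "L = lev n s p w"
  have ri: "round_inv L (arr s ''P'') (arr s ''C'') (arr s ''m'') A"
    and Tsh: "\<And>i j. i < n \<Longrightarrow> j < n \<Longrightarrow> arr s ''T'' (i * n + j) \<noteq> 0 \<longleftrightarrow> i \<in> L \<and> arr s ''P'' i = j"
    using a(7) unfolding Rnd_def L_def by blast+
  have wL: "w \<notin> L" using a(6) by (simp add: L_def lev_def)
  have insL: "insert w L = lev n s p (Suc w)" using a(3,4,6) by (auto simp: L_def lev_def)
  \<comment> \<open>Targets of \<open>w\<close> have height at most \<open>p\<close>, and all such
    vertices other than the source belong to \<open>L\<close>.\<close>
  have ready: "slot s w k \<in> insert ?src L" if "k < arr s ''F'' w" for k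
    using S(8)[OF a(3) that] a(6) by (auto simp: L_def lev_def)
  have "round_inv (insert w L) ((arr s ''P'')(w := u)) C' ((arr s ''m'')(w := arr s ''m'' u + arr s ''mu'' 0))
      ((arr s ''A'')(C' w := arr s ''A'' (C' w) + arr s ''F'' w))"
  proof (rule round_step[OF ri a(3,4) wL ready _ k0 _ refl refl _ refl])
    show "arr s ''A'' a = A a - (\<Sum>k<arr s ''F'' w. of_bool (arr s ''C'' (slot s w k) = a))" for a
      using A1 by simp
  qed (simp_all add: best C'_def)
  moreover have "arr ?s ''T'' (i * n + j) \<noteq> 0 \<longleftrightarrow> i \<in> insert w L \<and> arr ?s ''P'' i = j" if "i < n" "j < n" for i j
  proof -
    have "i * n + j = w * n + u \<longleftrightarrow> i = w \<and> j = u" by (rule slot_index[OF that(2) un])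
    then show ?thesis using Tsh[OF that] wL unfolding T P by auto
  qed
  ultimately have "Rnd n (insert w L) (arr ?s ''A'') ?s" unfolding Rnd_def P m C A same by blast
  then have "Rnd n (lev n ?s p (Suc w)) (arr ?s ''A'') ?s" unfolding insL same .
  then show "(case y of (z, p, w, A) \<Rightarrow> \<lambda>s. Stat n z s \<and> arr s ''i'' 0 = w \<and> arr s ''p'' 0 = p \<and>
        Rnd n (lev n s p (Suc w)) (arr s ''A'') s) ?s"
    using stat ip unfolding y by simp
qed (simp add: link_def)

lemma attach:
  "hoare (\<lambda>n y s. Att n y s \<and> arr s ''A'' = snd (snd (snd y))) attach
     (\<lambda>n (z, p, w, A) s. Stat n z s \<and> arr s ''i'' 0 = w \<and> arr s ''p'' 0 = p \<and>
        Rnd n (lev n s p (Suc w)) (arr s ''A'') s)"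
  unfolding attach_def by (rule hoare_Seq[OF detach_tokens hoare_Seq[OF find_best link]])

lemma round_pass:
  "hoare (\<lambda>n (z, p) s. Stat n z s \<and> arr s ''p'' 0 = p \<and> Rnd n (lev n s p 0) (arr s ''A'') s)
     (For ''i'' (var ''n'') round_visit)
     (\<lambda>n (z, p) s. Stat n z s \<and> arr s ''p'' 0 = p \<and> Rnd n (lev n s (Suc p) 0) (arr s ''A'') s)"
proof -
  let ?J = "\<lambda>n (z, p) M k s. Stat n z s \<and> M = n \<and> arr s ''p'' 0 = p \<and> Rnd n (lev n s p k) (arr s ''A'') s"
  let ?b = "NEq (NRead ''h'' (var ''i'')) (NAdd (var ''p'') (NConst 1))"
  let ?pre = "\<lambda>n (y, M, k) s. ?J n y M k s \<and> arr s ''i'' 0 = k \<and> k < M"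
  let ?post = "\<lambda>n (y, M, k) s. ?J n y M (Suc k) (nupd ''i'' 0 (Suc k) s) \<and> arr s ''i'' 0 = k"
  have body: "hoare ?pre (If ?b attach Skip) ?post"
  proof (rule hoare_If)
    show "hoare (\<lambda>n x s. ?pre n x s \<and> bval ?b s) attach ?post"
    proof (rule hoare_conseq[OF attach])
      fix n s and x :: "(dnr_data \<times> nat) \<times> nat \<times> nat"
      obtain z p M k where x: "x = ((z, p), M, k)" by (metis surj_pair)
      assume *: "?pre n x s \<and> bval ?b s"
      show "\<exists>y. (Att n y s \<and> arr s ''A'' = snd (snd (snd y))) \<and>
          (\<forall>s'. (case y of (z, p, w, A) \<Rightarrow> \<lambda>s. Stat n z s \<and> arr s ''i'' 0 = w \<and> arr s ''p'' 0 = p \<and>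
              Rnd n (lev n s p (Suc w)) (arr s ''A'') s) s' \<longrightarrow> ?post n x s')"
        using * unfolding x by (intro exI[of _ "(z, p, k, arr s ''A'')"]) (auto simp: Att_def)
    qed
    show "hoare (\<lambda>n x s. ?pre n x s \<and> \<not> bval ?b s) Skip ?post"
    proof (rule hoare_straight)
      fix n s and x :: "(dnr_data \<times> nat) \<times> nat \<times> nat"
      obtain z p M k where x: "x = ((z, p), M, k)" by (metis surj_pair)
      assume *: "?pre n x s \<and> \<not> bval ?b s"
      then have "lev n s p (Suc k) = lev n s p k" unfolding x by (auto simp: lev_def less_Suc_eq)
      then show "?post n x (eff Skip s)" using * unfolding x by simp
    qed simp
  qed
  show ?thesis
  proof (rule hoare_For[where I = ?J, OF body poly_bounded_id])
    fix n M s and y :: "dnr_data \<times> nat"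
    obtain z p where y: "y = (z, p)" by (cases y)
    assume *: "?J n y M M s"
    have "lev n s p n = lev n s (Suc p) 0" by (auto simp: lev_def)
    then show "(case y of (z, p) \<Rightarrow> \<lambda>s. Stat n z s \<and> arr s ''p'' 0 = p \<and> Rnd n (lev n s (Suc p) 0) (arr s ''A'') s) s"
      using * unfolding y by auto
  qed (auto simp: StatD(3))
qed

lemma round_phase:
  "hoare (\<lambda>n z s. Stat n z s \<and> clean s) round_phase
     (\<lambda>n z s. Stat n z s \<and> Rnd n ({..<n} - {arr s ''s'' 0}) (arr s ''A'') s)"
  unfolding round_phase_def
proof (rule hoare_Seq)
  show "hoare (\<lambda>n z s. Stat n z s \<and> clean s)
      (NAssign ''C'' (var ''s'') (var ''s'')) (\<lambda>n z s. Stat n z s \<and> Rnd n (lev n s 0 0) (arr s ''A'') s)"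
  proof (rule hoare_straight)
    fix n z s assume *: "Stat n z s \<and> clean s"
    let ?s = "eff (NAssign ''C'' (var ''s'') (var ''s'')) s"
    have st: "Stat n z ?s" using * by simp
    interpret rounding n "arr ?s ''s'' 0" "adjacent z" "arr ?s ''c''" "arr ?s ''h''" "arr ?s ''e''" "arr ?s ''F''"
        "slot ?s" "arr ?s ''mu'' 0"
      by (rule Stat_rounding[OF st])
    \<comment> \<open>Every vertex but the source has a slot, hence a lower target and a positive
      height.\<close>
    have pos: "arr ?s ''h'' v \<noteq> 0" if "v < n" "v \<noteq> arr ?s ''s'' 0" for v
      using StatD(8)[OF st that(1), of 0] StatD(7)[OF st that] by auto
    have L: "lev n ?s 0 0 = {}" unfolding lev_def using pos by force
    have ri: "round_inv {} (arr ?s ''P'') (arr ?s ''C'') (arr ?s ''m'') (arr ?s ''A'')"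
      by (rule round_inv_init) (use * in simp_all)
    have "Rnd n (lev n ?s 0 0) (arr ?s ''A'') ?s"
      unfolding Rnd_def L by (intro conjI ri) (use * in simp)
    with st show "Stat n z ?s \<and> Rnd n (lev n ?s 0 0) (arr ?s ''A'') ?s" by blast
  qed simp
  let ?I = "\<lambda>n z M k s. Stat n z s \<and> M = arr s ''hm'' 0 \<and> Rnd n (lev n s k 0) (arr s ''A'') s"
  show "hoare (\<lambda>n z s. Stat n z s \<and> Rnd n (lev n s 0 0) (arr s ''A'') s) (For ''p'' (var ''hm'') (For ''i'' (var ''n'')
     round_visit))
     (\<lambda>n z s. Stat n z s \<and> Rnd n ({..<n} - {arr s ''s'' 0}) (arr s ''A'') s)"
  proof (rule hoare_For[where I = ?I and g = "\<lambda>n. n * (n * (n * (n * n + 1) + 2))"])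
    show "hoare (\<lambda>n (z, M, k) s. ?I n z M k s \<and> arr s ''p'' 0 = k \<and> k < M)
      (For ''i'' (var ''n'') round_visit)
      (\<lambda>n (z, M, k) s. ?I n z M (Suc k) (nupd ''p'' 0 (Suc k) s) \<and> arr s ''p'' 0 = k)" (is "hoare ?pre ?c ?post")
    \<comment> \<open>The frame keeps \<open>hm\<close>, whose value \<open>M\<close> does not occur
      in the specification of \<open>round_pass\<close>.\<close>
    proof (rule hoare_conseq[OF hoare_frame[OF round_pass, of "''hm''"]])
      show "''hm'' \<notin> nat_writes ?c"
        by (simp add: For_def attach_def detach_tokens_def find_best_def link_def)
      fix n s and x :: "dnr_data \<times> nat \<times> nat"
      obtain z M k where x: "x = (z, M, k)" by (metis surj_pair)
      assume "?pre n x s"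
      then show "\<exists>y. (case y of (y', v) \<Rightarrow> \<lambda>s. (case y' of (z, p) \<Rightarrow> \<lambda>s. Stat n z s \<and> arr s ''p'' 0 = p \<and>
          Rnd n (lev n s p 0) (arr s ''A'') s) s \<and> arr s ''hm'' = v) s \<and>
        (\<forall>s'. (case y of (y', v) \<Rightarrow> \<lambda>s. (case y' of (z, p) \<Rightarrow> \<lambda>s. Stat n z s \<and> arr s ''p'' 0 = p \<and>
          Rnd n (lev n s (Suc p) 0) (arr s ''A'') s) s \<and> arr s ''hm'' = v) s' \<longrightarrow> ?post n x s')"
        unfolding x by (intro exI[of _ "((z, k), arr s ''hm'')"]) simp
    qed
    show "poly_bounded (\<lambda>n. n * (n * (n * (n * n + 1) + 2)))" by (intro poly_bounded_intros)
    fix n z M s assume *: "?I n z M M s"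
    then have "lev n s M 0 = {..<n} - {arr s ''s'' 0}"
      using StatD(9)[of n z s] by (auto simp: lev_def)
    with * show "Stat n z s \<and> Rnd n ({..<n} - {arr s ''s'' 0}) (arr s ''A'') s" by metis
  next
    fix n z M k s assume "?I n z M k s"
    then show "nval (var ''hm'') s = M \<and> M \<le> n * (n * (n * (n * n + 1) + 2))"
      using StatD(5)[of n z s] by simp
  qed auto
qed


section \<open>The whole algorithm and its approximation guarantee\<close>

definition dnr_alg :: com where
  "dnr_alg = Seq find_source (Seq scale_demands (Seq slot_bases (Seq flow_phase
     (Seq sum_squares (Seq find_mu (Seq sum_heights round_phase))))))"

lemma dnr_alg:
  "hoare (\<lambda>n z s. Inst n z s \<and> Zero s) dnr_alg
     (\<lambda>n z s. Stat n z s \<and> Rnd n ({..<n} - {arr s ''s'' 0}) (arr s ''A'') s)"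
  unfolding dnr_alg_def
  by (rule hoare_Seq[OF find_source hoare_Seq[OF scale_demands hoare_Seq[OF slot_bases
        hoare_Seq[OF flow_phase[folded Fin_def] hoare_Seq[OF sum_squares hoare_Seq[OF find_mu
        hoare_Seq[OF sum_heights round_phase]]]]]]])

lemma output_approx:
  assumes st: "Stat n z s" and rnd: "Rnd n ({..<n} - {arr s ''s'' 0}) A s"
  shows "spanning_tree {..<n} (gph z) (output_edges n s)"
    and "loss (dmd z) (\<lambda>_. 1) (output_edges n s) \<le> 288 * sqrt n * OPT {..<n} (gph z) (dmd z) (\<lambda>_. 1)"
proof -
  let ?src = "arr s ''s'' 0" and ?P = "arr s ''P''"
  interpret rounding n ?src "adjacent z" "arr s ''c''" "arr s ''h''" "arr s ''e''" "arr s ''F''" "slot s"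
      "arr s ''mu'' 0"
    by (rule Stat_rounding[OF st])
  have ri: "round_inv ({..<n} - {?src}) ?P (arr s ''C'') (arr s ''m'') A"
    and T: "\<And>i j. i < n \<Longrightarrow> j < n \<Longrightarrow> arr s ''T'' (i * n + j) \<noteq> 0 \<longleftrightarrow> i \<in> {..<n} - {?src} \<and> ?P i = j"
    using rnd unfolding Rnd_def by blast+
  have mu: "sqs n s \<le> arr s ''mu'' 0 * total n s" "arr s ''mu'' 0 * total n s \<le> sqs n s + total n s"
    using st by (simp_all add: Stat_def)
  have D: "Dem n z s" by (rule StatD(1)[OF st])
  note S = SrcD[OF DemD(1)[OF D]]
  have inst: "dnr_instance {..<n} (gph z) (dmd z) (\<lambda>_. 1)" using S(1) by (simp add: Inst_def)
  have rt: "rooted_tree {..<n} ?src ?P (arr s ''h'')" by (rule round_final(1)[OF ri mu])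
  have edge: "{v, ?P v} \<in> gph z" if v: "v < n" "v \<noteq> ?src" for v
  proof -
    obtain k where "k < arr s ''F'' v" "slot s v k = ?P v" using round_invD(4)[OF ri, of v] v by auto
    then show ?thesis using flow_invD(4)[OF StatD(2)[OF st] v(1), of k] by simp
  qed
  have out: "output_edges n s = rooted_tree.edges {..<n} ?src ?P"
  proof -
    have "?P v < n" if "v < n" "v \<noteq> ?src" for v using rooted_tree.par_in[OF rt, of v] that by simp
    moreover have "output_edges n s = {{i, j} | i j. i < n \<and> j < n \<and> i \<noteq> ?src \<and> ?P i = j}"
      unfolding output_edges_def arr_def[symmetric] using T by auto
    ultimately show ?thesis unfolding rooted_tree.edges_def[OF rt] by auto
  qed
  have approx: "(\<Sum>w\<in>{..<n} - {?src}. (rooted_tree.load {..<n} ?src ?P (dmd z) w)\<^sup>2)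
      \<le> 4 * (72 * sqrt n) * (\<Sum>w\<in>{..<n} - {?src}. (rooted_tree.load {..<n} ?src par' (dmd z) w)\<^sup>2)"
    if "rooted_tree {..<n} ?src par' rk'" "\<And>v. v < n \<Longrightarrow> v \<noteq> ?src \<Longrightarrow> {v, par' v} \<in> gph z" for par' rk'
  proof (rule scaled_loss[OF rt that(1) DemD(5)[OF D] S(8) S(5) S(6) _ round_approx[OF ri mu that]])
    show "n > 0" using src by simp
  qed simp_all
  show "spanning_tree {..<n} (gph z) (output_edges n s)"
    unfolding out by (rule loss_le_OPT(1)[OF inst src rt edge approx])
  have "loss (dmd z) (\<lambda>_. 1) (output_edges n s) \<le> 4 * (72 * sqrt n) * OPT {..<n} (gph z) (dmd z) (\<lambda>_. 1)"
    unfolding out by (rule loss_le_OPT(2)[OF inst src rt edge approx])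
  then show "loss (dmd z) (\<lambda>_. 1) (output_edges n s) \<le> 288 * sqrt n * OPT {..<n} (gph z) (dmd z) (\<lambda>_. 1)"
    by simp
qed

lemma input_Inst:
  assumes "dnr_instance {..<n} E d (\<lambda>_. 1)" "card (sources {..<n} d) = 1"
  shows "Inst n (E, d) (input_state n E d)" "Zero (input_state n E d)"
proof -
  have "i * n + j < n * n \<and> (i * n + j) div n = i \<and> (i * n + j) mod n = j" if "i < n" "j < n" for i j
  proof -
    have "i * n + j < Suc i * n" using that by simp
    also have "\<dots> \<le> n * n" using that by (intro mult_right_mono) auto
    finally show ?thesis using that by simp
  qed
  then show "Inst n (E, d) (input_state n E d)"
    using assms by (simp add: Inst_def gph_def dmd_def arr_def rarr_def input_state_def)
  show "Zero (input_state n E d)"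
    by (simp add: Zero_def arr_def input_state_def)
qed

theorem theorem1:
  "\<exists>(alg :: com) (p :: nat poly) (C :: real).
     \<forall>(n :: nat) (E :: nat set set) (d :: nat \<Rightarrow> real).
       dnr_instance {..<n} E d (\<lambda>_. 1) \<and> card (sources {..<n} d) = 1 \<longrightarrow>
         halts_within (poly p n) alg (input_state n E d) \<and>
         (\<forall>T \<in> set_pmf (output_pmf (poly p n) alg n E d). spanning_tree {..<n} E T) \<and>
         measure_pmf.expectation (output_pmf (poly p n) alg n E d) (loss d (\<lambda>_. 1))
           \<le> C * sqrt (real n) * OPT {..<n} E d (\<lambda>_. 1)"
proof -
  obtain f where f: "poly_bounded f"
    "\<And>n z s. Inst n z s \<and> Zero s \<Longrightarrow> \<exists>t s'. t \<le> f n \<and> exe dnr_alg s t s' \<and>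
       Stat n z s' \<and> Rnd n ({..<n} - {arr s' ''s'' 0}) (arr s' ''A'') s'"
    using dnr_alg unfolding hoare_def by blast
  obtain p where p: "\<And>n. f n \<le> poly p n" using f(1) by (auto simp: poly_bounded_def)
  show ?thesis
  proof (intro exI allI impI)
    fix n :: nat and E :: "nat set set" and d :: "nat \<Rightarrow> real"
    assume *: "dnr_instance {..<n} E d (\<lambda>_. 1) \<and> card (sources {..<n} d) = 1"
    obtain t s where t: "t \<le> f n" and e: "exe dnr_alg (input_state n E d) t s"
      and s: "Stat n (E, d) s" "Rnd n ({..<n} - {arr s ''s'' 0}) (arr s ''A'') s"
      using f(2)[of n "(E, d)" "input_state n E d"] input_Inst * by blast
    \<comment> \<open>The run is a point mass, so the expectation is the loss of a single
      tree.\<close>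
    have run: "run (poly p n) (dnr_alg, input_state n E d) = return_pmf (Skip, s)"
      by (rule exe_run[OF e]) (rule order.trans[OF t p])
    have out: "output_pmf (poly p n) dnr_alg n E d = return_pmf (output_edges n s)"
      unfolding output_pmf_def run by simp
    note approx = output_approx[OF s, unfolded gph_def dmd_def fst_conv snd_conv]
    show "halts_within (poly p n) dnr_alg (input_state n E d) \<and>
         (\<forall>T \<in> set_pmf (output_pmf (poly p n) dnr_alg n E d). spanning_tree {..<n} E T) \<and>
         measure_pmf.expectation (output_pmf (poly p n) dnr_alg n E d) (loss d (\<lambda>_. 1))
           \<le> 288 * sqrt (real n) * OPT {..<n} E d (\<lambda>_. 1)"
      unfolding out using approx by (simp add: halts_within_def run)
  qed
qed

end
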